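(* Let $\Phi$ be the $L$-periodic solution of the Cahn-Hilliard problem $\partial_t\Phi=\Delta[F'(\Phi)-\epsilon^2\Delta\Phi]$ on $\Omega=(0,L)^2$, $0<t\le T$, with $F(\Phi)=\frac14(\Phi^2-1)^2$ and initial data $\Phi^0$. Assume that there are integers $m\ge 1$, $p\ge 1$ and a constant $K_\phi>0$ such that $$\|\Phi^0\|_{H^{m+4}}+\sum_{k=0}^{2}\|\partial_t^{(k)}\Phi(t)\|_{H^{m+4-k}}+\sum_{k=3}^{p+1}\|\partial_t^{(k)}\Phi(t)\|_{L^2}\le K_\phi\quad\text{for } 0<t<T.$$ Assume that the differentiation matrix $D_{\mathrm R}=A_{\mathrm E}^{-1}E_{s_{\mathrm I}}$ of the R-IERK method and its inverse $D_{\mathrm R}^{-1}$ are positive definite. Assume that, with a constant $K_1$ independent of the time-steps, the temporal stage defects satisfy $\|\zeta_{\mathrm R}^{n,i+1}\|_{L^2}\le K_1\tau_n$ for $1\le n\le N$, $1\le i\le s_{\mathrm I}$, and that, with a constant $K_T$ independent of the time-steps, $N\tau\le K_T T$, where $\tau=\max_n\tau_n$. If the maximum time-step size $\tau$ is sufficiently small, then there exists a constant $C_\phi>0$, independent of the time-step sizes $\tau_n$, such that the stage solutions $U^{n,i}$ of the time-discrete system are bounded: $$\|U^{n,i}\|_{H^{m+4}}+\big\|(U^{n,i}-U^{n,1})/\tau_n\big\|_{H^m}\le C_\phi/\epsilon^2\quad\text{for } 1\le n\le N,\ 2\le i\le s.$$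
   Context: Let $\Omega=(0,L)^2$ and $0<\epsilon<1$; all functions are $L$-periodic in each direction, and $H^q$ denotes the periodic Sobolev space $H^q_{per}(\Omega)$. For a stabilization parameter $\kappa\ge0$ put $L_\kappa v=-\epsilon^2\Delta v+\kappa v$ and $f_\kappa(v)=\kappa v-F'(v)$, so that the equation reads $\partial_t\Phi=\Delta[L_\kappa\Phi-f_\kappa(\Phi)]$. Time mesh: $0=t_0<t_1<\dots<t_N=T$, $\tau_n=t_n-t_{n-1}$, $\tau=\max_n\tau_n$. Method: $s\ge2$ is the number of stages and $s_{\mathrm I}:=s-1$. The coefficients $\hat a_{i+1,j}$ ($1\le j\le i\le s_{\mathrm I}$) are real constants with $\hat a_{k+1,k}\ne0$; the abscissas are $c_1=0$, $c_{i+1}=\sum_{j=1}^{i}\hat a_{i+1,j}$, with $c_i>0$ for $2\le i\le s-1$ and $c_s=1$. $A_{\mathrm E}:=(\hat a_{i+1,j})_{i,j=1}^{s_{\mathrm I}}$ is the lower triangular matrix of these coefficients (zero for $j>i$), and $E_{s_{\mathrm I}}$ is the $s_{\mathrm I}\times s_{\mathrm I}$ lower triangular matrix with all entries on and below the diagonal equal to $1$. A (not necessarily symmetric) real matrix $D$ is called positive definite if its symmetric part $(D+D^T)/2$ is positive definite. Time-discrete system (refined implicit-explicit Runge-Kutta, R-IERK): with $U^{n,j+\frac12}:=\frac12(U^{n,j}+U^{n,j+1})$, $$U^{n,i+1}=U^{n,1}+\tau_n\sum_{j=1}^{i}\hat a_{i+1,j}\,\Delta\big[L_\kappa U^{n,j+\frac12}-f_\kappa(U^{n,j})\big],\quad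 1\le n\le N,\ 1\le i\le s_{\mathrm I},$$ with $U^{1,1}=\Phi^0$ and $U^{n+1,1}=U^{n,s}$. Temporal defects: with $\Phi^{n,i}:=\Phi(\cdot,t_{n-1}+c_i\tau_n)$ and $\Phi^{n,j+\frac12}:=\frac12(\Phi^{n,j}+\Phi^{n,j+1})$, the functions $\zeta_{\mathrm R}^{n,i+1}$ are defined by $$\Phi^{n,i+1}=\Phi^{n,1}+\tau_n\sum_{j=1}^{i}\hat a_{i+1,j}\,\Delta\big[L_\kappa\Phi^{n,j+\frac12}-f_\kappa(\Phi^{n,j})\big]+\tau_n\zeta_{\mathrm R}^{n,i+1}.$$ Constants may depend on $\epsilon,\kappa,T,\Omega$, the exact solution, the method coefficients, $K_1$ and $K_T$, but not on the time-steps $\tau_n$ or on $N$; likewise for the threshold in "sufficiently small". *)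

theory Defs
  imports "HOL-Analysis.Analysis" "Jordan_Normal_Form.Gauss_Jordan_Elimination"
begin

type_synonym field2 = "real \<times> real \<Rightarrow> real"

definition square :: "real \<Rightarrow> (real \<times> real) set" where
  "square L = {0<..<L} \<times> {0<..<L}"

definition periodic2 :: "real \<Rightarrow> field2 \<Rightarrow> bool" where
  "periodic2 L u \<longleftrightarrow> (\<forall>x y. u (x + L, y) = u (x, y) \<and> u (x, y + L) = u (x, y))"

text \<open>Elements of the Lebesgue and Sobolev spaces are represented by functions on the whole plane
  that are periodic at every point; they are identified when equal almost everywhere.\<close>

definition eq_ae :: "real \<Rightarrow> field2 \<Rightarrow> field2 \<Rightarrow> bool" where
  "eq_ae L u v \<longleftrightarrow> (AE z in lebesgue_on (square L). u z = v z)"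

definition in_L2 :: "real \<Rightarrow> field2 \<Rightarrow> bool" where
  "in_L2 L u \<longleftrightarrow> periodic2 L u \<and> u \<in> borel_measurable (lebesgue_on (square L)) \<and>
     integrable (lebesgue_on (square L)) (\<lambda>z. (u z)\<^sup>2)"

definition L2_norm :: "real \<Rightarrow> field2 \<Rightarrow> real" where
  "L2_norm L u = sqrt (\<integral>z. (u z)\<^sup>2 \<partial>lebesgue_on (square L))"

definition pd1 :: "field2 \<Rightarrow> field2" where
  "pd1 \<phi> = (\<lambda>(x, y). deriv (\<lambda>r. \<phi> (r, y)) x)"

definition pd2 :: "field2 \<Rightarrow> field2" where
  "pd2 \<phi> = (\<lambda>(x, y). deriv (\<lambda>r. \<phi> (x, r)) y)"

definition pd :: "nat \<Rightarrow> nat \<Rightarrow> field2 \<Rightarrow> field2" where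
  "pd i j \<phi> = (pd1 ^^ i) ((pd2 ^^ j) \<phi>)"

primrec Ck_fun :: "nat \<Rightarrow> field2 \<Rightarrow> bool" where
  "Ck_fun 0 \<phi> \<longleftrightarrow> continuous_on UNIV \<phi>"
| "Ck_fun (Suc k) \<phi> \<longleftrightarrow> (\<forall>z. \<phi> differentiable (at z)) \<and> Ck_fun k (pd1 \<phi>) \<and> Ck_fun k (pd2 \<phi>)"

definition test_fun :: "real \<Rightarrow> field2 \<Rightarrow> bool" where
  "test_fun L \<phi> \<longleftrightarrow> periodic2 L \<phi> \<and> (\<forall>k. Ck_fun k \<phi>)"

text \<open>Testing against smooth periodic functions, instead of functions with compact support in the
  open square, makes the spaces below the periodic ones: no jump across the boundary of a period
  cell is allowed.\<close>

definition has_weak_deriv :: "real \<Rightarrow> nat \<Rightarrow> nat \<Rightarrow> field2 \<Rightarrow> field2 \<Rightarrow> bool" where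
  "has_weak_deriv L i j u v \<longleftrightarrow> in_L2 L u \<and> in_L2 L v \<and>
     (\<forall>\<phi>. test_fun L \<phi> \<longrightarrow>
        (\<integral>z. u z * pd i j \<phi> z \<partial>lebesgue_on (square L)) =
        (-1) ^ (i + j) * (\<integral>z. v z * \<phi> z \<partial>lebesgue_on (square L)))"

text \<open>Unique up to \<^const>\<open>eq_ae\<close> when it exists, unspecified otherwise.\<close>

definition weak_deriv :: "real \<Rightarrow> nat \<Rightarrow> nat \<Rightarrow> field2 \<Rightarrow> field2" where
  "weak_deriv L i j u = (SOME v. has_weak_deriv L i j u v)"

definition in_H :: "real \<Rightarrow> nat \<Rightarrow> field2 \<Rightarrow> bool" where
  "in_H L q u \<longleftrightarrow> (\<forall>i j. i + j \<le> q \<longrightarrow> (\<exists>v. has_weak_deriv L i j u v))"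

text \<open>Only meaningful together with \<^const>\<open>in_H\<close>.\<close>

definition H_norm :: "real \<Rightarrow> nat \<Rightarrow> field2 \<Rightarrow> real" where
  "H_norm L q u = sqrt (\<Sum>(i, j) \<in> {(i, j). i + j \<le> q}. (L2_norm L (weak_deriv L i j u))\<^sup>2)"

definition laplace :: "real \<Rightarrow> field2 \<Rightarrow> field2" where
  "laplace L u = (\<lambda>z. weak_deriv L 2 0 u z + weak_deriv L 0 2 u z)"

definition double_well :: "real \<Rightarrow> real" where
  "double_well v = (v\<^sup>2 - 1)\<^sup>2 / 4"

text \<open>Derivative at \<open>t\<close>, relative to the time set \<open>S\<close>, of \<open>\<Phi>\<close> as a function with values in the
  Hilbert space of square integrable functions.\<close>

definition has_time_deriv :: "real \<Rightarrow> real set \<Rightarrow> (real \<Rightarrow> field2) \<Rightarrow> field2 \<Rightarrow> real \<Rightarrow> bool" where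
  "has_time_deriv L S \<Phi> v t \<longleftrightarrow> (\<forall>r\<in>S. in_L2 L (\<Phi> r)) \<and> in_L2 L v \<and>
     ((\<lambda>r. L2_norm L (\<lambda>z. (\<Phi> r z - \<Phi> t z) / (r - t) - v z)) \<longlongrightarrow> 0) (at t within S)"

definition CH_solution ::
  "real \<Rightarrow> real \<Rightarrow> real \<Rightarrow> field2 \<Rightarrow> (real \<Rightarrow> field2) \<Rightarrow> bool" where
  "CH_solution L T \<epsilon> \<Phi>0 \<Phi> \<longleftrightarrow>
     in_L2 L \<Phi>0 \<and> (\<forall>t\<in>{0..T}. in_L2 L (\<Phi> t)) \<and>
     eq_ae L (\<Phi> 0) \<Phi>0 \<and>
     ((\<lambda>t. L2_norm L (\<lambda>z. \<Phi> t z - \<Phi>0 z)) \<longlongrightarrow> 0) (at_right 0) \<and>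
     (\<forall>t\<in>{0<..T}. in_H L 4 (\<Phi> t) \<and>
        has_time_deriv L {0..T} \<Phi>
          (laplace L (\<lambda>z. deriv double_well (\<Phi> t z) - \<epsilon>\<^sup>2 * laplace L (\<Phi> t) z)) t)"

text \<open>\<open>\<Phi>t k\<close> is the time derivative of \<open>\<Phi>\<close> of order \<open>k\<close>.\<close>

definition CH_regular ::
  "real \<Rightarrow> real \<Rightarrow> nat \<Rightarrow> nat \<Rightarrow> real \<Rightarrow> field2 \<Rightarrow> (real \<Rightarrow> field2) \<Rightarrow> bool" where
  "CH_regular L T m p K\<phi> \<Phi>0 \<Phi> \<longleftrightarrow> in_H L (m + 4) \<Phi>0 \<and>
     (\<exists>\<Phi>t :: nat \<Rightarrow> real \<Rightarrow> field2. \<Phi>t 0 = \<Phi> \<and>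
        (\<forall>k\<le>p. \<forall>t\<in>{0<..<T}. has_time_deriv L {0<..<T} (\<Phi>t k) (\<Phi>t (Suc k) t) t) \<and>
        (\<forall>t\<in>{0<..<T}.
           (\<forall>k\<le>2. in_H L (m + 4 - k) (\<Phi>t k t)) \<and>
           H_norm L (m + 4) \<Phi>0 + (\<Sum>k=0..2. H_norm L (m + 4 - k) (\<Phi>t k t))
             + (\<Sum>k=3..p+1. L2_norm L (\<Phi>t k t)) \<le> K\<phi>))"

definition L_op :: "real \<Rightarrow> real \<Rightarrow> real \<Rightarrow> field2 \<Rightarrow> field2" where
  "L_op L \<epsilon> \<kappa> v = (\<lambda>z. - \<epsilon>\<^sup>2 * laplace L v z + \<kappa> * v z)"

definition f_nl :: "real \<Rightarrow> real \<Rightarrow> real" where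
  "f_nl \<kappa> v = \<kappa> * v - deriv double_well v"

definition time_mesh :: "real \<Rightarrow> nat \<Rightarrow> (nat \<Rightarrow> real) \<Rightarrow> bool" where
  "time_mesh T N t \<longleftrightarrow> t 0 = 0 \<and> t N = T \<and> (\<forall>n\<in>{1..N}. t (n - 1) < t n)"

definition step :: "(nat \<Rightarrow> real) \<Rightarrow> nat \<Rightarrow> real" where
  "step t n = t n - t (n - 1)"

definition max_step :: "nat \<Rightarrow> (nat \<Rightarrow> real) \<Rightarrow> real" where
  "max_step N t = Max (step t ` {1..N})"

text \<open>The method coefficients are \<open>a (i + 1) j\<close> for \<open>1 \<le> j \<le> i \<le> s - 1\<close>; no other value of
  \<open>a\<close> is ever used.  The sum is empty for \<open>i = 1\<close>, which gives the first abscissa \<open>0\<close>.\<close>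

definition abscissa :: "(nat \<Rightarrow> nat \<Rightarrow> real) \<Rightarrow> nat \<Rightarrow> real" where
  "abscissa a i = (\<Sum>j=1..i-1. a i j)"

definition RIERK_method :: "nat \<Rightarrow> (nat \<Rightarrow> nat \<Rightarrow> real) \<Rightarrow> bool" where
  "RIERK_method s a \<longleftrightarrow> 2 \<le> s \<and> (\<forall>k\<in>{1..s-1}. a (k + 1) k \<noteq> 0) \<and>
     (\<forall>i\<in>{2..s-1}. 0 < abscissa a i) \<and> abscissa a s = 1"

text \<open>Rows and columns of \<^const>\<open>Matrix.mat\<close> are numbered from \<open>0\<close>, stages from \<open>1\<close>.\<close>

definition A_E :: "nat \<Rightarrow> (nat \<Rightarrow> nat \<Rightarrow> real) \<Rightarrow> real Matrix.mat" where
  "A_E s a = Matrix.mat (s - 1) (s - 1) (\<lambda>(i, j). if j \<le> i then a (i + 2) (j + 1) else 0)"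

definition E_mat :: "nat \<Rightarrow> real Matrix.mat" where
  "E_mat n = Matrix.mat n n (\<lambda>(i, j). if j \<le> i then 1 else 0)"

definition D_R :: "nat \<Rightarrow> (nat \<Rightarrow> nat \<Rightarrow> real) \<Rightarrow> real Matrix.mat" where
  "D_R s a = the (mat_inverse (A_E s a)) * E_mat (s - 1)"

definition pos_def :: "real Matrix.mat \<Rightarrow> bool" where
  "pos_def D \<longleftrightarrow> square_mat D \<and>
     (let S = (1 / 2) \<cdot>\<^sub>m (D + transpose_mat D)
      in \<forall>x \<in> carrier_vec (dim_row D). x \<noteq> 0\<^sub>v (dim_row D) \<longrightarrow> 0 < scalar_prod x (mult_mat_vec S x))"

text \<open>The increment common to the scheme and to the temporal defects, as a functional of the
  stage functions \<open>V 1, \<dots>, V (i + 1)\<close> of one step.\<close>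

definition stage_sum ::
  "real \<Rightarrow> real \<Rightarrow> real \<Rightarrow> (nat \<Rightarrow> nat \<Rightarrow> real) \<Rightarrow> (nat \<Rightarrow> field2) \<Rightarrow> nat \<Rightarrow> field2" where
  "stage_sum L \<epsilon> \<kappa> a V i = (\<lambda>z. \<Sum>j=1..i. a (i + 1) j *
     laplace L (\<lambda>y. L_op L \<epsilon> \<kappa> (\<lambda>w. (V j w + V (j + 1) w) / 2) y - f_nl \<kappa> (V j y)) z)"

definition RIERK_solution ::
  "real \<Rightarrow> real \<Rightarrow> real \<Rightarrow> nat \<Rightarrow> (nat \<Rightarrow> nat \<Rightarrow> real) \<Rightarrow> nat \<Rightarrow> (nat \<Rightarrow> real) \<Rightarrow>
     field2 \<Rightarrow> (nat \<Rightarrow> nat \<Rightarrow> field2) \<Rightarrow> bool" where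
  "RIERK_solution L \<epsilon> \<kappa> s a N t \<Phi>0 U \<longleftrightarrow>
     (\<forall>n\<in>{1..N}. \<forall>i\<in>{1..s}. in_H L 4 (U n i)) \<and>
     eq_ae L (U 1 1) \<Phi>0 \<and>
     (\<forall>n\<in>{1..<N}. eq_ae L (U (n + 1) 1) (U n s)) \<and>
     (\<forall>n\<in>{1..N}. \<forall>i\<in>{1..s-1}.
        eq_ae L (U n (i + 1)) (\<lambda>z. U n 1 z + step t n * stage_sum L \<epsilon> \<kappa> a (U n) i z))"

definition exact_stage ::
  "(nat \<Rightarrow> nat \<Rightarrow> real) \<Rightarrow> (nat \<Rightarrow> real) \<Rightarrow> (real \<Rightarrow> field2) \<Rightarrow> nat \<Rightarrow> nat \<Rightarrow> field2" where
  "exact_stage a t \<Phi> n i = \<Phi> (t (n - 1) + abscissa a i * step t n)"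

text \<open>\<open>defect \<dots> n i\<close> is the defect of stage \<open>i + 1\<close> in step \<open>n\<close>.\<close>

definition defect ::
  "real \<Rightarrow> real \<Rightarrow> real \<Rightarrow> (nat \<Rightarrow> nat \<Rightarrow> real) \<Rightarrow> (nat \<Rightarrow> real) \<Rightarrow> (real \<Rightarrow> field2) \<Rightarrow>
     nat \<Rightarrow> nat \<Rightarrow> field2" where
  "defect L \<epsilon> \<kappa> a t \<Phi> n i = (\<lambda>z.
     (exact_stage a t \<Phi> n (i + 1) z - exact_stage a t \<Phi> n 1 z) / step t n
       - stage_sum L \<epsilon> \<kappa> a (exact_stage a t \<Phi> n) i z)"

text \<open>The first conjunct makes the defects well defined.  It follows from the regularity of
  \<open>\<Phi>\<close> as long as the stage times are at most \<open>T\<close>, but abscissas larger than \<open>1\<close> are not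
  excluded.\<close>

definition defects_bounded ::
  "real \<Rightarrow> real \<Rightarrow> real \<Rightarrow> nat \<Rightarrow> (nat \<Rightarrow> nat \<Rightarrow> real) \<Rightarrow> nat \<Rightarrow> (nat \<Rightarrow> real) \<Rightarrow>
     (real \<Rightarrow> field2) \<Rightarrow> real \<Rightarrow> bool" where
  "defects_bounded L \<epsilon> \<kappa> s a N t \<Phi> K1 \<longleftrightarrow>
     (\<forall>n\<in>{1..N}. \<forall>i\<in>{1..s}. in_H L 4 (exact_stage a t \<Phi> n i)) \<and>
     (\<forall>n\<in>{1..N}. \<forall>i\<in>{1..s-1}. L2_norm L (defect L \<epsilon> \<kappa> a t \<Phi> n i) \<le> K1 * step t n)"

end

(*
  In Fourier coefficients the scheme decouples, except for the nonlinear term G, into one small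
  linear system per mode, with eigenvalue l of minus the Laplacian.  Multiplying by the
  differentiation matrix D and testing with the increments of the stages gives, because D is
  positive definite, the one-step estimate

    |V_s|^2 <= (1 + tau) |V_1|^2 + C tau sum_j (|G_j|^2 + |zeta_j|^2 / rho^4),    rho^2 ~ 1 + l,

  uniformly in the mode: in every Sobolev norm the scheme is stable without loss of derivatives in
  the nonlinearity, and defects need only be controlled two orders lower.  Positivity of the
  diagonal of the inverse of D bounds the intermediate stages.

  Since H^2 is an algebra, a defect of size tau in L^2 gives, by a discrete Gronwall argument, an
  H^2 error of size tau, so that for small steps the numerical solution stays within distance 1 of
  the exact one in H^2.  Given this H^2 bound the cubic term grows at most linearly in the norm of
  order m + 4, and a second application of the one-step estimate, now without defects, bounds that
  norm.  The difference quotients are read off from the stage equations.  The exact solution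
  enters only through its values at t_0, ..., t_{N-1}.
*)
theory Submission
  imports Defs "HOL-Library.Product_Plus" "Jordan_Normal_Form.Determinant"
begin

section \<open>Characters of the torus\<close>

text \<open>The definitions speak of weak derivatives tested against smooth periodic functions,
  while all estimates live on Fourier coefficients. The passage must work both ways: a weak
  derivative multiplies coefficients by its symbol, and coefficients that decay must come from a
  function possessing weak derivatives. This needs the theorems of Riesz-Fischer and Parseval, hence
  completeness of the characters. The obstacle in the estimates is a circle: the Lipschitz constant
  of the cubic term depends on a bound of the numerical solution, which is to be derived with its
  help. Constants are therefore fixed in one order. A bound \<open>M0\<close> of the exact solution
  at the mesh points gives the provisional bound \<open>M0 + 1\<close> for the first stage of a
  step; this determines a bound \<open>B\<close> for all stages of that step, \<open>B\<close> the
  Lipschitz constant, this the Gronwall constant, and only then is \<open>\<tau>0\<close> chosen so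
  small that the provisional bound survives up to time \<open>T\<close>. The constant mode is
  treated apart, since its eigenvalue is zero and cannot be divided by. There the nonlinear term
  drops out as well, so that only defects remain.\<close>

lemma finite_sums_tail:
  fixes f :: "'i \<Rightarrow> real"
  assumes "\<And>k. 0 \<le> f k" "\<And>F. finite F \<Longrightarrow> sum f F \<le> B" "0 < e"
  obtains G where "finite G" "\<And>F. finite F \<Longrightarrow> F \<inter> G = {} \<Longrightarrow> sum f F \<le> e"
proof -
  let ?S = "SUP F\<in>{F. finite F}. sum f F"
  have bdd: "bdd_above (sum f ` {F. finite F})"
    using assms(2) by (auto simp: bdd_above_def)
  obtain G where G: "finite G" "?S - e < sum f G"
    using less_cSUP_iff[OF _ bdd, of "?S - e"] assms(3) by auto
  show ?thesis
  proof (rule that[OF G(1)])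
    fix F assume F: "finite F" "F \<inter> G = {}"
    have "sum f F + sum f G = sum f (F \<union> G)"
      using F G by (simp add: sum.union_disjoint)
    also have "\<dots> \<le> ?S"
      using F G by (intro cSUP_upper bdd) auto
    finally show "sum f F \<le> e" using G(2) by simp
  qed
qed

text \<open>Monotone convergence: the sum of the moduli has finite integral, so it is finite almost
  everywhere. This supplies the pointwise limit in the Riesz-Fischer theorem.\<close>

lemma AE_summable_of_integral_bound:
  fixes w :: "nat \<Rightarrow> 'a \<Rightarrow> real"
  assumes "\<And>n. integrable N (w n)" "summable (\<lambda>n. \<integral>x. \<bar>w n x\<bar> \<partial>N)"
  shows "AE x in N. summable (\<lambda>n. \<bar>w n x\<bar>)"
proof -
  have "(\<integral>\<^sup>+x. (\<Sum>n. ennreal \<bar>w n x\<bar>) \<partial>N) = (\<Sum>n. \<integral>\<^sup>+x. ennreal \<bar>w n x\<bar> \<partial>N)"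
    using assms(1) by (intro nn_integral_suminf) (auto intro!: borel_measurable_integrable)
  also have "\<dots> = (\<Sum>n. ennreal (\<integral>x. \<bar>w n x\<bar> \<partial>N))"
    using assms(1) by (intro suminf_cong nn_integral_eq_integral) auto
  also have "\<dots> = ennreal (\<Sum>n. \<integral>x. \<bar>w n x\<bar> \<partial>N)"
    using assms(2) by (intro suminf_ennreal2) auto
  finally have "(\<integral>\<^sup>+x. (\<Sum>n. ennreal \<bar>w n x\<bar>) \<partial>N) \<noteq> \<infinity>" by simp
  then have "AE x in N. (\<Sum>n. ennreal \<bar>w n x\<bar>) \<noteq> \<infinity>"
    using assms(1) by (intro nn_integral_PInf_AE) auto
  then show ?thesis
    by eventually_elim (auto intro: summable_suminf_not_top)
qed

locale torus =
  fixes L :: real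
  assumes L_pos: "0 < L"
begin

abbreviation "M \<equiv> lebesgue_on (square L)"

definition freq :: real where "freq = 2 * pi / L"

lemma freq_pos: "0 < freq"
  using L_pos by (simp add: freq_def)

lemma freq_mult_L: "freq * L = 2 * pi"
  using L_pos by (simp add: freq_def)

definition wave :: "int \<times> int \<Rightarrow> real \<times> real \<Rightarrow> complex" where
  "wave k z = cis (freq * (of_int (fst k) * fst z + of_int (snd k) * snd z))"

lemma wave_add: "wave (j + k) z = wave j z * wave k z"
  by (simp add: wave_def cis_mult algebra_simps)

lemma wave_uminus: "wave (- k) z = cnj (wave k z)"
  by (simp add: wave_def cis_cnj algebra_simps)

lemma wave_zero [simp]: "wave 0 z = 1"
  by (simp add: wave_def)

lemma norm_wave [simp]: "cmod (wave k z) = 1"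
  by (simp add: wave_def)

lemma continuous_on_wave [continuous_intros]: "continuous_on S (wave k)"
  unfolding wave_def by (intro continuous_intros)

lemma wave_periodic: "wave k (x + L, y) = wave k (x, y)" "wave k (x, y + L) = wave k (x, y)"
proof -
  have *: "cis (2 * pi * of_int n + t) = cis t" for n :: int and t
    by (simp flip: cis_mult add: cis_multiple_2pi)
  have "freq * (of_int (fst k) * (x + L) + of_int (snd k) * y) =
      freq * L * of_int (fst k) + freq * (of_int (fst k) * x + of_int (snd k) * y)"
    by (simp add: algebra_simps)
  then show "wave k (x + L, y) = wave k (x, y)" by (simp add: wave_def freq_mult_L *)
  have "freq * (of_int (fst k) * x + of_int (snd k) * (y + L)) =
      freq * L * of_int (snd k) + freq * (of_int (fst k) * x + of_int (snd k) * y)"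
    by (simp add: algebra_simps)
  then show "wave k (x, y + L) = wave k (x, y)" by (simp add: wave_def freq_mult_L *)
qed

text \<open>Solutions and test functions are real, so characters enter through real parts. The
  complex coefficient \<open>c\<close> covers cosine and sine at once and lets differentiation act
  as a multiplication of \<open>c\<close>.\<close>

definition re_wave :: "complex \<Rightarrow> int \<times> int \<Rightarrow> field2" where
  "re_wave c k z = Re (c * wave k z)"

lemma re_wave_has_derivative:
  "(re_wave c k has_derivative
     (\<lambda>h. freq * (of_int (fst k) * fst h + of_int (snd k) * snd h) * re_wave (\<i> * c) k z)) (at z)"
  unfolding re_wave_def wave_def
  by (auto intro!: derivative_eq_intros simp: fun_eq_iff algebra_simps)

lemma pd1_re_wave: "pd1 (re_wave c k) = re_wave (freq * of_int (fst k) * \<i> * c) k"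
proof -
  have "((\<lambda>r. re_wave c k (r, y)) has_real_derivative
          re_wave (freq * of_int (fst k) * \<i> * c) k (x, y)) (at x)" for x y
    unfolding re_wave_def wave_def
    by (auto intro!: derivative_eq_intros simp: algebra_simps)
  then show ?thesis by (auto simp: pd1_def fun_eq_iff DERIV_imp_deriv)
qed

lemma pd2_re_wave: "pd2 (re_wave c k) = re_wave (freq * of_int (snd k) * \<i> * c) k"
proof -
  have "((\<lambda>r. re_wave c k (x, r)) has_real_derivative
          re_wave (freq * of_int (snd k) * \<i> * c) k (x, y)) (at y)" for x y
    unfolding re_wave_def wave_def
    by (auto intro!: derivative_eq_intros simp: algebra_simps)
  then show ?thesis by (auto simp: pd2_def fun_eq_iff DERIV_imp_deriv)
qed

text \<open>The symbol of \<^term>\<open>pd i j\<close>.\<close>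

definition dsym :: "nat \<Rightarrow> nat \<Rightarrow> int \<times> int \<Rightarrow> complex" where
  "dsym i j k = (freq * of_int (fst k) * \<i>) ^ i * (freq * of_int (snd k) * \<i>) ^ j"

lemma pd_re_wave: "pd i j (re_wave c k) = re_wave (dsym i j k * c) k"
proof -
  have 2: "(pd2 ^^ j) (re_wave c k) = re_wave ((freq * of_int (snd k) * \<i>) ^ j * c) k" for c
    by (induction j) (simp_all add: pd2_re_wave mult.assoc)
  have 1: "(pd1 ^^ i) (re_wave c k) = re_wave ((freq * of_int (fst k) * \<i>) ^ i * c) k" for c
    by (induction i) (simp_all add: pd1_re_wave mult.assoc)
  show ?thesis by (simp add: pd_def 1 2 dsym_def mult.assoc)
qed

lemma continuous_on_re_wave [continuous_intros]: "continuous_on S (re_wave c k)"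
  unfolding re_wave_def by (intro continuous_intros)

lemma Ck_fun_re_wave: "Ck_fun n (re_wave c k)"
  by (induction n arbitrary: c)
     (auto simp: continuous_on_re_wave pd1_re_wave pd2_re_wave differentiable_def
       intro: re_wave_has_derivative)

lemma test_fun_re_wave: "test_fun L (re_wave c k)"
  by (auto simp: test_fun_def periodic2_def Ck_fun_re_wave re_wave_def wave_periodic)

section \<open>Integration over one period cell\<close>

lemma square_eq_box: "square L = box (0, 0) (L, L)"
  by (auto simp: square_def box_def Basis_prod_def)

lemma square_sets [measurable]: "square L \<in> sets lebesgue"
  by (simp add: square_eq_box)

lemma square_lmeasurable: "square L \<in> lmeasurable"
  by (simp add: square_eq_box)

lemma measure_square: "measure lebesgue (square L) = L\<^sup>2"
proof -
  have "measure lebesgue (square L) = measure lborel (cbox (0, 0) (L, L))"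
    by (simp add: square_eq_box measure_lborel_box_eq measure_lborel_cbox_eq)
  also have "\<dots> = L\<^sup>2"
    using L_pos by (simp add: content_Pair power2_eq_square)
  finally show ?thesis .
qed

lemma finite_measure_M: "finite_measure M"
  by (intro finite_measure_lebesgue_on square_lmeasurable)

lemma measure_M [simp]: "measure M (square L) = L\<^sup>2"
  using measure_restrict_space[of "square L" lebesgue "square L"] measure_square
  by (simp add: square_sets)

lemma continuous_measurable_M:
  fixes g :: "real \<times> real \<Rightarrow> 'b::euclidean_space"
  assumes "continuous_on UNIV g"
  shows "g \<in> borel_measurable M"
  using continuous_imp_measurable_on_sets_lebesgue[OF continuous_on_subset[OF assms subset_UNIV] square_sets] .

lemma wave_measurable [measurable]: "wave k \<in> borel_measurable M"
  by (intro continuous_measurable_M continuous_intros)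

lemma re_wave_measurable [measurable]: "re_wave c k \<in> borel_measurable M"
  by (intro continuous_measurable_M continuous_intros)

lemma continuous_bounded_M:
  fixes g :: "real \<times> real \<Rightarrow> 'b::euclidean_space"
  assumes "continuous_on UNIV g"
  obtains B where "\<And>z. z \<in> square L \<Longrightarrow> norm (g z) \<le> B"
proof -
  have "compact (g ` cbox (0, 0) (L, L))"
    by (intro compact_continuous_image continuous_on_subset[OF assms]) auto
  then obtain B where "\<forall>w \<in> g ` cbox (0, 0) (L, L). norm w \<le> B"
    using compact_imp_bounded bounded_iff by blast
  moreover have "square L \<subseteq> cbox (0, 0) (L, L)"
    by (simp add: square_eq_box box_subset_cbox)
  ultimately show ?thesis using that by blast
qed

lemma bounded_integrable_M:
  fixes g :: "real \<times> real \<Rightarrow> 'b::euclidean_space"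
  assumes "g \<in> borel_measurable M" "AE z in M. norm (g z) \<le> B"
  shows "integrable M g"
  using finite_measure.integrable_const_bound[OF finite_measure_M assms(2,1)] .

lemma continuous_integrable_M:
  fixes g :: "real \<times> real \<Rightarrow> 'b::euclidean_space"
  assumes "continuous_on UNIV g"
  shows "integrable M g"
proof -
  obtain B where "\<And>z. z \<in> square L \<Longrightarrow> norm (g z) \<le> B"
    using continuous_bounded_M[OF assms] by blast
  then show ?thesis
    by (intro bounded_integrable_M[where B = B] continuous_measurable_M assms AE_I2) auto
qed

lemma lebesgue_integral_continuous:
  fixes g :: "real \<times> real \<Rightarrow> 'b::euclidean_space"
  assumes "continuous_on UNIV g"
  shows "(\<integral>z. g z \<partial>M) = integral {0..L} (\<lambda>x. integral {0..L} (\<lambda>y. g (x, y)))"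
    and "(\<integral>z. g z \<partial>M) = integral {0..L} (\<lambda>y. integral {0..L} (\<lambda>x. g (x, y)))"
proof -
  have "(\<integral>z. g z \<partial>M) = integral (square L) g"
    by (intro lebesgue_integral_eq_integral continuous_integrable_M assms square_sets)
  also have "\<dots> = integral (cbox (0, 0) (L, L)) g"
    by (simp add: square_eq_box integral_open_interval)
  finally have *: "(\<integral>z. g z \<partial>M) = integral (cbox (0, 0) (L, L)) g" .
  also have "\<dots> = integral (cbox 0 L) (\<lambda>x. integral (cbox 0 L) (\<lambda>y. g (x, y)))"
    by (intro integral_prod_continuous continuous_on_subset[OF assms]) auto
  finally show 1: "(\<integral>z. g z \<partial>M) = integral {0..L} (\<lambda>x. integral {0..L} (\<lambda>y. g (x, y)))"
    by simp
  also have "\<dots> = integral {0..L} (\<lambda>y. integral {0..L} (\<lambda>x. g (x, y)))"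
    using integral_swap_continuous[of 0 0 L L "\<lambda>x y. g (x, y)"] continuous_on_subset[OF assms subset_UNIV]
    by simp
  finally show "(\<integral>z. g z \<partial>M) = integral {0..L} (\<lambda>y. integral {0..L} (\<lambda>x. g (x, y)))" .
qed

lemma Ck_fun_imp_continuous: "Ck_fun n \<phi> \<Longrightarrow> continuous_on UNIV \<phi>"
  by (cases n) (auto simp: continuous_on_eq_continuous_at differentiable_imp_continuous_within)

lemma pd1_has_derivative:
  assumes "\<And>z. \<phi> differentiable (at z)"
  shows "((\<lambda>r. \<phi> (r, y)) has_real_derivative pd1 \<phi> (x, y)) (at x)"
proof -
  have "(\<lambda>r. \<phi> (r, y)) differentiable (at x)"
  proof (rule differentiable_compose[of \<phi> "\<lambda>r. (r, y)"])
    show "\<phi> differentiable (at (x, y))"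
      by (rule assms)
    show "(\<lambda>r. (r, y)) differentiable (at x)"
      by (intro differentiable_Pair differentiable_ident differentiable_const)
  qed
  then show ?thesis
    by (simp add: pd1_def DERIV_deriv_iff_real_differentiable)
qed

lemma pd2_has_derivative:
  assumes "\<And>z. \<phi> differentiable (at z)"
  shows "((\<lambda>r. \<phi> (x, r)) has_real_derivative pd2 \<phi> (x, y)) (at y)"
proof -
  have "(\<lambda>r. \<phi> (x, r)) differentiable (at y)"
  proof (rule differentiable_compose[of \<phi> "\<lambda>r. (x, r)"])
    show "\<phi> differentiable (at (x, y))"
      by (rule assms)
    show "(\<lambda>r. (x, r)) differentiable (at y)"
      by (intro differentiable_Pair differentiable_ident differentiable_const)
  qed
  then show ?thesis
    by (simp add: pd2_def DERIV_deriv_iff_real_differentiable)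
qed

text \<open>Integrating in the differentiated variable first, the fundamental theorem leaves the
  difference of the values at the two ends of a period.\<close>

lemma integral_pd1_zero:
  assumes "periodic2 L \<phi>" "\<And>z. \<phi> differentiable (at z)" "continuous_on UNIV (pd1 \<phi>)"
  shows "(\<integral>z. pd1 \<phi> z \<partial>M) = 0"
proof -
  have "integral {0..L} (\<lambda>x. pd1 \<phi> (x, y)) = 0" for y
  proof -
    have "((\<lambda>x. pd1 \<phi> (x, y)) has_integral \<phi> (L, y) - \<phi> (0, y)) {0..L}"
      using L_pos pd1_has_derivative[OF assms(2)]
      by (intro fundamental_theorem_of_calculus)
         (auto simp flip: has_real_derivative_iff_has_vector_derivative intro: DERIV_subset)
    moreover have "\<phi> (L, y) = \<phi> (0, y)"
      using assms(1) by (metis add_0 periodic2_def)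
    ultimately show ?thesis by (simp add: integral_unique)
  qed
  then show ?thesis by (simp add: lebesgue_integral_continuous(2)[OF assms(3)])
qed

lemma integral_pd2_zero:
  assumes "periodic2 L \<phi>" "\<And>z. \<phi> differentiable (at z)" "continuous_on UNIV (pd2 \<phi>)"
  shows "(\<integral>z. pd2 \<phi> z \<partial>M) = 0"
proof -
  have "integral {0..L} (\<lambda>y. pd2 \<phi> (x, y)) = 0" for x
  proof -
    have "((\<lambda>y. pd2 \<phi> (x, y)) has_integral \<phi> (x, L) - \<phi> (x, 0)) {0..L}"
      using L_pos pd2_has_derivative[OF assms(2)]
      by (intro fundamental_theorem_of_calculus)
         (auto simp flip: has_real_derivative_iff_has_vector_derivative intro: DERIV_subset)
    moreover have "\<phi> (x, L) = \<phi> (x, 0)"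
      using assms(1) by (metis add_0 periodic2_def)
    ultimately show ?thesis by (simp add: integral_unique)
  qed
  then show ?thesis by (simp add: lebesgue_integral_continuous(1)[OF assms(3)])
qed

lemma integrable_wave [simp]: "integrable M (wave k)"
  by (intro continuous_integrable_M continuous_intros)

lemma integral_re_wave: "(\<integral>z. re_wave c k z \<partial>M) = Re (c * (\<integral>z. wave k z \<partial>M))"
  by (simp add: re_wave_def)

text \<open>A nonconstant character is, up to a nonzero factor \<open>w\<close>, a derivative of
  itself, and derivatives of periodic functions have integral zero. As this is known for real parts
  only, it is used with every complex \<open>c\<close>.\<close>

lemma integral_wave: "(\<integral>z. wave k z \<partial>M) = (if k = 0 then of_real (L\<^sup>2) else 0)"
proof (cases "k = 0")
  case True
  then show ?thesis by (simp add: scaleR_conv_of_real)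
next
  case False
  have per: "periodic2 L (re_wave c k)" "\<And>z. re_wave c k differentiable (at z)" for c
    using test_fun_re_wave[of c k] unfolding differentiable_def
    by (simp add: test_fun_def, blast intro: re_wave_has_derivative)
  have "\<exists>w. w \<noteq> 0 \<and> (\<forall>c. Re (w * c * (\<integral>z. wave k z \<partial>M)) = 0)"
  proof (cases "fst k = 0")
    case True
    then have "snd k \<noteq> 0" using False by (simp add: prod_eq_iff)
    then show ?thesis
      using integral_pd2_zero[OF per] freq_pos
      by (intro exI[of _ "freq * of_int (snd k) * \<i>"])
         (simp add: pd2_re_wave integral_re_wave continuous_intros)
  next
    case False
    then show ?thesis
      using integral_pd1_zero[OF per] freq_pos
      by (intro exI[of _ "freq * of_int (fst k) * \<i>"])
         (simp add: pd1_re_wave integral_re_wave continuous_intros)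
  qed
  then obtain w where w: "w \<noteq> 0" "\<And>c. Re (w * c * (\<integral>z. wave k z \<partial>M)) = 0" by blast
  let ?I = "\<integral>z. wave k z \<partial>M"
  \<comment> \<open>The coefficient is chosen so that \<open>w * c\<close> becomes the conjugate of
    the integral and the real part its squared modulus.\<close>
  have "Re (cnj ?I * ?I) = 0"
    using w(2)[of "cnj ?I / w"] w(1) by simp
  then have "?I = 0"
    by (simp add: complex_eq_iff sum_squares_eq_zero_iff)
  then show ?thesis using False by simp
qed

section \<open>Completeness of the characters\<close>


lemma in_L2_D:
  assumes "in_L2 L u"
  shows "periodic2 L u" "u \<in> borel_measurable M" "integrable M (\<lambda>z. (u z)\<^sup>2)"
  using assms by (auto simp: in_L2_def)

lemma in_L2_integrable_mult:
  assumes u: "in_L2 L u" and v: "in_L2 L v"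
  shows "integrable M (\<lambda>z. u z * v z)"
proof (rule Bochner_Integration.integrable_bound)
  show "integrable M (\<lambda>z. (u z)\<^sup>2 + (v z)\<^sup>2)"
    using in_L2_D[OF u] in_L2_D[OF v] by simp
  show "(\<lambda>z. u z * v z) \<in> borel_measurable M"
    using in_L2_D[OF u] in_L2_D[OF v] by simp
  have "\<bar>a * b\<bar> \<le> a\<^sup>2 + b\<^sup>2" for a b :: real
    using sum_squares_bound[of "\<bar>a\<bar>" "\<bar>b\<bar>"] mult_nonneg_nonneg[of "\<bar>a\<bar>" "\<bar>b\<bar>"]
    by (simp add: abs_mult del: mult_nonneg_nonneg)
  then show "AE z in M. norm (u z * v z) \<le> norm ((u z)\<^sup>2 + (v z)\<^sup>2)"
    by simp
qed

lemma in_L2_bounded: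
  assumes "periodic2 L g" "g \<in> borel_measurable M" "AE z in M. \<bar>g z\<bar> \<le> B"
  shows "in_L2 L g"
  unfolding in_L2_def
proof (intro conjI assms bounded_integrable_M[where B = "B\<^sup>2"])
  show "(\<lambda>z. (g z)\<^sup>2) \<in> borel_measurable M"
    using assms(2) by simp
  show "AE z in M. norm ((g z)\<^sup>2) \<le> B\<^sup>2"
    using assms(3) by eventually_elim (use power_mono[of "\<bar>g _\<bar>" B 2] in simp)
qed

lemma in_L2_const: "in_L2 L (\<lambda>z. c)"
  by (rule in_L2_bounded[where B = "\<bar>c\<bar>"]) (auto simp: periodic2_def)

lemma in_L2_integrable: "in_L2 L u \<Longrightarrow> integrable M u"
  using in_L2_integrable_mult[OF _ in_L2_const[of 1]] by simp

lemma in_L2_mult_bounded: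
  assumes u: "in_L2 L u" and g: "periodic2 L g" "g \<in> borel_measurable M" "AE z in M. \<bar>g z\<bar> \<le> B"
  shows "in_L2 L (\<lambda>z. u z * g z)"
  unfolding in_L2_def
proof (intro conjI)
  show "periodic2 L (\<lambda>z. u z * g z)"
    using in_L2_D(1)[OF u] g(1) by (simp add: periodic2_def)
  show meas: "(\<lambda>z. u z * g z) \<in> borel_measurable M"
    using in_L2_D(2)[OF u] g(2) by simp
  show "integrable M (\<lambda>z. (u z * g z)\<^sup>2)"
  proof (rule Bochner_Integration.integrable_bound)
    show "integrable M (\<lambda>z. B\<^sup>2 * (u z)\<^sup>2)"
      using in_L2_D(3)[OF u] by simp
    show "(\<lambda>z. (u z * g z)\<^sup>2) \<in> borel_measurable M"
      using meas by simp
    show "AE z in M. norm ((u z * g z)\<^sup>2) \<le> norm (B\<^sup>2 * (u z)\<^sup>2)"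
      using g(3)
    proof eventually_elim
      case (elim z)
      have "(g z)\<^sup>2 \<le> B\<^sup>2" using power_mono[OF elim, of 2] by simp
      then have "(u z)\<^sup>2 * (g z)\<^sup>2 \<le> (u z)\<^sup>2 * B\<^sup>2" by (intro mult_left_mono) auto
      then show ?case by (simp add: power_mult_distrib mult.commute)
    qed
  qed
qed

lemma in_L2_add:
  assumes u: "in_L2 L u" and v: "in_L2 L v"
  shows "in_L2 L (\<lambda>z. u z + v z)"
proof -
  have "integrable M (\<lambda>z. (u z)\<^sup>2 + 2 * (u z * v z) + (v z)\<^sup>2)"
    using in_L2_D[OF u] in_L2_D[OF v] in_L2_integrable_mult[OF u v] by simp
  moreover have "(\<lambda>z. (u z)\<^sup>2 + 2 * (u z * v z) + (v z)\<^sup>2) = (\<lambda>z. (u z + v z)\<^sup>2)"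
    by (simp add: fun_eq_iff power2_eq_square algebra_simps)
  ultimately show ?thesis
    using in_L2_D[OF u] in_L2_D[OF v] by (simp add: in_L2_def periodic2_def)
qed

lemma in_L2_cmult: "in_L2 L u \<Longrightarrow> in_L2 L (\<lambda>z. c * u z)"
  by (auto simp: in_L2_def periodic2_def power_mult_distrib)

lemma in_L2_diff: "in_L2 L u \<Longrightarrow> in_L2 L v \<Longrightarrow> in_L2 L (\<lambda>z. u z - v z)"
  using in_L2_add[OF _ in_L2_cmult[of v "- 1"]] by simp

lemma in_L2_sum: "(\<And>i. i \<in> I \<Longrightarrow> in_L2 L (u i)) \<Longrightarrow> in_L2 L (\<lambda>z. \<Sum>i\<in>I. u i z)"
proof (induction I rule: infinite_finite_induct)
  case (insert x F)
  then show ?case by (simp add: in_L2_add)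
qed (use in_L2_const[of 0] in simp_all)

lemma in_L2_re_wave: "in_L2 L (re_wave c k)"
proof -
  have "\<bar>re_wave c k z\<bar> \<le> cmod c" for z
    using abs_Re_le_cmod[of "c * wave k z"] by (simp add: re_wave_def norm_mult)
  then show ?thesis
    using test_fun_re_wave[of c k] by (intro in_L2_bounded[where B = "cmod c"]) (auto simp: test_fun_def)
qed

lemma in_L2_mult_re_wave: "in_L2 L u \<Longrightarrow> in_L2 L (\<lambda>z. u z * re_wave c k z)"
proof (rule in_L2_mult_bounded[where B = "cmod c"])
  show "AE z in M. \<bar>re_wave c k z\<bar> \<le> cmod c"
    using abs_Re_le_cmod[of "c * wave k z" for z] by (simp add: re_wave_def norm_mult)
qed (use test_fun_re_wave[of c k] in \<open>auto simp: test_fun_def\<close>)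

text \<open>Normalised so that a constant is its own coefficient at frequency 0; Parseval's identity
  then carries a factor \<open>L\<^sup>2\<close>.\<close>

definition fc :: "field2 \<Rightarrow> int \<times> int \<Rightarrow> complex" where
  "fc u k = (\<integral>z. of_real (u z) * wave (- k) z \<partial>M) / of_real (L\<^sup>2)"

lemma integrable_times_wave:
  assumes "in_L2 L u"
  shows "integrable M (\<lambda>z. of_real (u z) * wave k z)"
proof (rule Bochner_Integration.integrable_bound)
  show "integrable M u" using in_L2_integrable[OF assms] .
  show "(\<lambda>z. of_real (u z) * wave k z) \<in> borel_measurable M"
    using in_L2_D(2)[OF assms] by simp
qed (simp add: norm_mult)

lemma integral_times_wave: "(\<integral>z. of_real (u z) * wave k z \<partial>M) = of_real (L\<^sup>2) * fc u (- k)"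
  using L_pos by (simp add: fc_def)

lemma fc_cong_ae:
  assumes "in_L2 L u" "in_L2 L v" "eq_ae L u v"
  shows "fc u = fc v"
proof
  fix k
  have "(\<integral>z. of_real (u z) * wave (- k) z \<partial>M) = (\<integral>z. of_real (v z) * wave (- k) z \<partial>M)"
  proof (rule integral_cong_AE)
    show "AE z in M. of_real (u z) * wave (- k) z = of_real (v z) * wave (- k) z"
      using assms(3) unfolding eq_ae_def by eventually_elim simp
  qed (use in_L2_D(2)[OF assms(1)] in_L2_D(2)[OF assms(2)] in simp_all)
  then show "fc u k = fc v k" by (simp add: fc_def)
qed

lemma fc_add: "in_L2 L u \<Longrightarrow> in_L2 L v \<Longrightarrow> fc (\<lambda>z. u z + v z) k = fc u k + fc v k"
  by (simp add: fc_def algebra_simps add_divide_distrib integrable_times_wave)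

lemma fc_cmult: "fc (\<lambda>z. c * u z) k = of_real c * fc u k"
  by (simp add: fc_def mult.assoc)

lemma fc_diff: "in_L2 L u \<Longrightarrow> in_L2 L v \<Longrightarrow> fc (\<lambda>z. u z - v z) k = fc u k - fc v k"
  using fc_add[of u "\<lambda>z. - 1 * v z" k] fc_cmult[of "- 1" v k] in_L2_cmult[of v "- 1"] by simp

lemma fc_sum: "(\<And>i. i \<in> I \<Longrightarrow> in_L2 L (u i)) \<Longrightarrow> fc (\<lambda>z. \<Sum>i\<in>I. u i z) k = (\<Sum>i\<in>I. fc (u i) k)"
proof (induction I rule: infinite_finite_induct)
  case (insert x F)
  then show ?case by (simp add: fc_add in_L2_sum)
qed (simp_all add: fc_def)

lemma fc_uminus: "fc u (- k) = cnj (fc u k)"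
proof -
  have "cnj (\<integral>z. of_real (u z) * wave (- k) z \<partial>M) = (\<integral>z. cnj (of_real (u z) * wave (- k) z) \<partial>M)"
    by (rule Bochner_Integration.integral_cnj[symmetric])
  also have "\<dots> = (\<integral>z. of_real (u z) * wave k z \<partial>M)"
    by (simp add: wave_uminus)
  finally show ?thesis by (simp add: fc_def)
qed

lemma of_real_re_wave: "of_real (re_wave c k z) = (c * wave k z + cnj c * wave (- k) z) / 2"
  by (simp add: re_wave_def wave_uminus complex_eq_iff)

text \<open>A real wave is half the sum of two conjugate terms, each of which shifts coefficients.
  Hence vanishing of all coefficients is inherited by the product.\<close>

lemma fc_mult_re_wave:
  assumes "in_L2 L u"
  shows "fc (\<lambda>z. u z * re_wave c j z) k = (c * fc u (k - j) + cnj c * fc u (k + j)) / 2"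
proof -
  have "of_real (u z * re_wave c j z) * wave (- k) z =
      (c / 2) * (of_real (u z) * wave (- (k - j)) z) + (cnj c / 2) * (of_real (u z) * wave (- (k + j)) z)" for z
  proof -
    have 1: "wave (- (k - j)) z = wave j z * wave (- k) z" "wave (- (k + j)) z = wave (- j) z * wave (- k) z"
      by (simp_all add: algebra_simps flip: wave_add)
    show ?thesis unfolding 1 by (simp add: of_real_re_wave algebra_simps add_divide_distrib)
  qed
  then have "(\<integral>z. of_real (u z * re_wave c j z) * wave (- k) z \<partial>M) =
      (c / 2) * (of_real (L\<^sup>2) * fc u (k - j)) + (cnj c / 2) * (of_real (L\<^sup>2) * fc u (k + j))"
    using integrable_times_wave[OF assms]
    by (simp only: Bochner_Integration.integral_add integrable_mult_right integral_mult_right_zero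
        integral_times_wave minus_minus)
  then show ?thesis
    using L_pos by (simp add: fc_def[of "\<lambda>z. u z * re_wave c j z"] field_simps)
qed

lemma integral_mult_re_wave:
  assumes "in_L2 L u"
  shows "(\<integral>z. u z * re_wave c k z \<partial>M) = L\<^sup>2 * Re (c * cnj (fc u k))"
proof -
  have "(\<integral>z. u z * re_wave c k z \<partial>M) = (\<integral>z. Re (c * (of_real (u z) * wave k z)) \<partial>M)"
    by (simp add: re_wave_def algebra_simps)
  also have "\<dots> = Re (\<integral>z. c * (of_real (u z) * wave k z) \<partial>M)"
    using integrable_times_wave[OF assms] by (intro integral_Re) simp
  also have "\<dots> = L\<^sup>2 * Re (c * cnj (fc u k))"
    by (simp add: integral_times_wave fc_uminus algebra_simps)
  finally show ?thesis .
qed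

lemma fc_const: "fc (\<lambda>z. a) k = (if k = 0 then of_real a else 0)"
  using L_pos by (auto simp: fc_def integral_wave neg_eq_iff_add_eq_0 simp flip: zero_prod_def)

lemma fc_re_wave: "fc (re_wave c j) k = ((if k = j then c else 0) + (if k = - j then cnj c else 0)) / 2"
  using fc_mult_re_wave[OF in_L2_const[of 1], of c j k] by (auto simp: fc_const eq_neg_iff_add_eq_0)

section \<open>Functions with vanishing coefficients\<close>

definition zero_coeffs :: "field2 \<Rightarrow> bool" where
  "zero_coeffs w \<longleftrightarrow> in_L2 L w \<and> (\<forall>k. fc w k = 0)"

text \<open>Embedding of the torus as a product of two circles, on which the Stone--Weierstrass theorem
  for polynomials applies.\<close>

definition torus_map :: "real \<times> real \<Rightarrow> complex \<times> complex" where
  "torus_map z = (wave (1, 0) z, wave (0, 1) z)"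

lemma continuous_on_torus_map: "continuous_on S torus_map"
  unfolding torus_map_def by (intro continuous_intros)

lemma zero_coeffs_add: "zero_coeffs u \<Longrightarrow> zero_coeffs v \<Longrightarrow> zero_coeffs (\<lambda>z. u z + v z)"
  by (simp add: zero_coeffs_def in_L2_add fc_add)

lemma zero_coeffs_cmult: "zero_coeffs u \<Longrightarrow> zero_coeffs (\<lambda>z. c * u z)"
  by (simp add: zero_coeffs_def in_L2_cmult fc_cmult)

lemma zero_coeffs_mult_re_wave: "zero_coeffs u \<Longrightarrow> zero_coeffs (\<lambda>z. u z * re_wave c k z)"
  by (simp add: zero_coeffs_def in_L2_mult_re_wave fc_mult_re_wave del: split_paired_All)

text \<open>Multiplication by a polynomial in the torus coordinates only shifts coefficients; this
  property, unlike orthogonality to \<open>u\<close>, is stable under products.\<close>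

lemma zero_coeffs_mult_polynomial:
  assumes "real_polynomial_function p" "zero_coeffs u"
  shows "zero_coeffs (\<lambda>z. u z * p (torus_map z))"
  using assms
proof (induction arbitrary: u)
  case (linear f)
  then interpret f: bounded_linear f by simp
  have f: "f (a, b) = f (1, 0) * Re a + f (\<i>, 0) * Im a + f (0, 1) * Re b + f (0, \<i>) * Im b" for a b
  proof -
    have "(a, b) = Re a *\<^sub>R (1, 0) + Im a *\<^sub>R (\<i>, 0) + Re b *\<^sub>R (0, 1) + Im b *\<^sub>R (0, \<i>)"
      by (simp add: complex_eq_iff)
    then show ?thesis by (simp only: f.add f.scaleR) simp
  qed
  have "(\<lambda>z. u z * f (torus_map z)) =
    (\<lambda>z. f (1, 0) * (u z * re_wave 1 (1, 0) z) + f (\<i>, 0) * (u z * re_wave (- \<i>) (1, 0) z)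
      + f (0, 1) * (u z * re_wave 1 (0, 1) z) + f (0, \<i>) * (u z * re_wave (- \<i>) (0, 1) z))"
    by (subst f[of "wave (1, 0) z" "wave (0, 1) z" for z, folded torus_map_def])
       (simp add: re_wave_def algebra_simps)
  then show ?case
    using linear by (simp only: zero_coeffs_add zero_coeffs_cmult zero_coeffs_mult_re_wave)
next
  case (const c)
  then show ?case using zero_coeffs_cmult[of u c] by (simp add: mult.commute)
next
  case (add f g)
  then show ?case using zero_coeffs_add by (simp add: distrib_left)
next
  case (mult f g)
  then show ?case using mult.IH(2)[OF mult.IH(1)[OF mult.prems]] by (simp add: mult.assoc)
qed

lemma zero_coeffs_integral:
  assumes "zero_coeffs w"
  shows "(\<integral>z. w z \<partial>M) = 0"
proof -
  have "in_L2 L w" "fc w 0 = 0" using assms unfolding zero_coeffs_def by blast+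
  then show ?thesis using integral_mult_re_wave[of w 1 0] by (simp add: re_wave_def)
qed

text \<open>On the closed square the map identifies opposite edges. The asymmetric hypotheses record
  what survives: an interior point shares its image with no other point of the closed square,
  boundary included.\<close>

lemma torus_map_inj:
  assumes "z \<in> square L" "w \<in> cbox (0, 0) (L, L)" "torus_map z = torus_map w"
  shows "z = w"
proof -
  have *: "x = y" if "cis (freq * x) = cis (freq * y)" "0 < x" "x < L" "0 \<le> y" "y \<le> L" for x y
  proof -
    have "cis (freq * x - freq * y) = 1"
      using that(1) by (simp flip: cis_divide)
    then have "cos (freq * x - freq * y) = 1"
      by (simp add: complex_eq_iff)
    then obtain n :: int where n: "freq * x - freq * y = of_int n * (2 * pi)"
      by (auto simp: cos_one_2pi_int)
    then have "freq * (x - y) = freq * (of_int n * L)"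
      by (simp add: right_diff_distrib freq_mult_L[symmetric])
    then have xy: "x - y = of_int n * L"
      using freq_pos by simp
    have "\<bar>of_int n * L\<bar> < 1 * L"
      using that by (simp flip: xy)
    then have "\<bar>real_of_int n\<bar> < 1"
      using L_pos by (simp add: abs_mult)
    then have "n = 0" by linarith
    then show "x = y" using xy by simp
  qed
  have "fst z = fst w" "snd z = snd w"
    using assms by (auto simp: torus_map_def wave_def square_def cbox_Pair_eq intro!: *)
  then show ?thesis by (simp add: prod_eq_iff)
qed

text \<open>The polynomial that approximates \<open>f\<close> on the product of the circles
  integrates to zero against \<open>u\<close>. Only the approximation error counts, and this is at
  most \<open>e\<close> times the integral of \<open>\<bar>u z\<bar>\<close>.\<close>

lemma zero_coeffs_continuous_torus:
  assumes "zero_coeffs u" "continuous_on UNIV f"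
  shows "(\<integral>z. u z * f (torus_map z) \<partial>M) = 0"
proof -
  have u: "in_L2 L u" using assms(1) by (simp add: zero_coeffs_def)
  have cont: "continuous_on UNIV (\<lambda>z. f (torus_map z))"
    by (rule continuous_on_compose2[OF assms(2) continuous_on_torus_map]) simp
  have "\<bar>\<integral>z. u z * f (torus_map z) \<partial>M\<bar> \<le> e * (\<integral>z. \<bar>u z\<bar> \<partial>M)" if e: "0 < e" for e
  proof -
    let ?X = "sphere 0 1 \<times> sphere 0 1 :: (complex \<times> complex) set"
    have "compact ?X" by (intro compact_Times) auto
    from Stone_Weierstrass_real_polynomial_function[OF this continuous_on_subset[OF assms(2) subset_UNIV] e]
    obtain p where p: "real_polynomial_function p" "\<And>x. x \<in> ?X \<Longrightarrow> \<bar>f x - p x\<bar> < e"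
      by blast
    have zp: "zero_coeffs (\<lambda>z. u z * p (torus_map z))"
      by (rule zero_coeffs_mult_polynomial[OF p(1) assms(1)])
    obtain B where B: "\<And>z. z \<in> square L \<Longrightarrow> norm (f (torus_map z)) \<le> B"
      using continuous_bounded_M[OF cont] by blast
    have "in_L2 L (\<lambda>z. u z * f (torus_map z))"
    proof (rule in_L2_mult_bounded[OF u, where B = B])
      show "periodic2 L (\<lambda>z. f (torus_map z))"
        by (simp add: periodic2_def torus_map_def wave_periodic)
      show "AE z in M. \<bar>f (torus_map z)\<bar> \<le> B"
        using B by (intro AE_I2) simp
    qed (rule continuous_measurable_M[OF cont])
    then have i1: "integrable M (\<lambda>z. u z * f (torus_map z))"
      by (rule in_L2_integrable)
    have i2: "integrable M (\<lambda>z. u z * p (torus_map z))"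
      using zp by (simp add: zero_coeffs_def in_L2_integrable)
    have "(\<integral>z. u z * f (torus_map z) \<partial>M) = (\<integral>z. u z * (f (torus_map z) - p (torus_map z)) \<partial>M)"
      using i1 i2 zero_coeffs_integral[OF zp] by (simp add: right_diff_distrib)
    also have "\<bar>\<dots>\<bar> \<le> (\<integral>z. e * \<bar>u z\<bar> \<partial>M)"
    proof (rule integral_abs_bound_integral)
      show "integrable M (\<lambda>z. u z * (f (torus_map z) - p (torus_map z)))"
        using i1 i2 by (simp add: right_diff_distrib)
      show "integrable M (\<lambda>z. e * \<bar>u z\<bar>)"
        using in_L2_integrable[OF u] by simp
      fix z
      have "\<bar>f (torus_map z) - p (torus_map z)\<bar> \<le> e"
        using p(2)[of "torus_map z"] by (simp add: torus_map_def less_imp_le)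
      then show "\<bar>u z * (f (torus_map z) - p (torus_map z))\<bar> \<le> e * \<bar>u z\<bar>"
        by (simp add: abs_mult mult.commute[of e] mult_left_mono)
    qed
    finally show ?thesis by simp
  qed
  then have *: "\<bar>\<integral>z. u z * f (torus_map z) \<partial>M\<bar> \<le> e * (\<integral>z. \<bar>u z\<bar> \<partial>M)" if "0 < e" for e
    using that by blast
  define c where "c = (\<integral>z. \<bar>u z\<bar> \<partial>M)"
  have c: "0 \<le> c" "0 < c + 1" by (simp_all add: c_def add_nonneg_pos)
  have "\<bar>\<integral>z. u z * f (torus_map z) \<partial>M\<bar> \<le> 0 + e" if "0 < e" for e
  proof -
    have "0 < e / (c + 1)" using that c by simp
    from *[OF this] have "\<bar>\<integral>z. u z * f (torus_map z) \<partial>M\<bar> \<le> e / (c + 1) * c"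
      by (simp only: c_def)
    also have "\<dots> \<le> e"
      using that c by (simp add: field_simps)
    finally show ?thesis by simp
  qed
  then show ?thesis
    using field_le_epsilon[of "\<bar>\<integral>z. u z * f (torus_map z) \<partial>M\<bar>" 0] by simp
qed

text \<open>The indicator of \<open>G\<close> is a limit of functions continuous on the torus, namely truncated
  multiples of the distance to the complement of \<open>G\<close>.\<close>

lemma zero_coeffs_open:
  assumes "zero_coeffs u" "open G" "G \<subseteq> square L"
  shows "(\<integral>z. u z * indicator G z \<partial>M) = 0"
proof -
  have u: "in_L2 L u" using assms(1) by (simp add: zero_coeffs_def)
  define K where "K = torus_map ` (cbox (0, 0) (L, L) - G)"
  have K: "closed K"
    unfolding K_def
    by (intro compact_imp_closed compact_continuous_image continuous_on_torus_map compact_diff assms) auto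
  \<comment> \<open>A corner of the closed square is never in \<open>G\<close>. This excludes the
    empty \<open>K\<close>, to which \<open>infdist\<close> is zero by convention.\<close>
  have "(0, 0) \<in> cbox (0, 0) (L, L) - G"
    using assms(3) L_pos by (auto simp: square_def cbox_Pair_eq)
  then have "K \<noteq> {}" unfolding K_def by blast
  define f where "f n z = min 1 (real n * infdist z K)" for n z
  have f01: "0 \<le> f n z" "f n z \<le> 1" for n z
    by (auto simp: f_def infdist_nonneg)
  have f_cont: "continuous_on UNIV (f n)" for n
    unfolding f_def by (intro continuous_intros)
  have f_lim: "(\<lambda>n. f n (torus_map z)) \<longlonglongrightarrow> indicator G z" if "z \<in> square L" for z
  proof (cases "z \<in> G")
    case True
    have "torus_map z \<notin> K"
      using torus_map_inj[OF that] True by (auto simp: K_def)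
    then have pos: "0 < infdist (torus_map z) K"
      using K \<open>K \<noteq> {}\<close> infdist_pos_not_in_closed by blast
    obtain N where N: "1 / infdist (torus_map z) K \<le> real N"
      using real_arch_simple by blast
    have "f n (torus_map z) = 1" if "n \<ge> N" for n
    proof -
      have "1 / infdist (torus_map z) K \<le> real n" using N that by simp
      then show ?thesis using pos by (simp add: f_def field_simps)
    qed
    then show ?thesis
      using True by (intro tendsto_eventually) (auto simp: eventually_sequentially)
  next
    case False
    then have "torus_map z \<in> K"
      using that box_subset_cbox[of "(0, 0)" "(L, L)"] by (auto simp: K_def square_eq_box)
    then show ?thesis using False by (simp add: f_def)
  qed
  have "(\<lambda>n. \<integral>z. u z * f n (torus_map z) \<partial>M) \<longlonglongrightarrow> (\<integral>z. u z * indicator G z \<partial>M)"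
  proof (rule integral_dominated_convergence)
    show "integrable M (\<lambda>z. \<bar>u z\<bar>)"
      using in_L2_integrable[OF u] by simp
    have "G \<in> sets M"
      using assms(2,3) by (simp add: sets_restrict_space_iff)
    then show "(\<lambda>z. u z * indicator G z) \<in> borel_measurable M"
      using in_L2_D(2)[OF u] by (intro borel_measurable_times borel_measurable_indicator)
    show "AE z in M. (\<lambda>n. u z * f n (torus_map z)) \<longlonglongrightarrow> u z * indicator G z"
      by (intro AE_I2 tendsto_mult tendsto_const f_lim) simp
  next
    fix n
    have "continuous_on UNIV (\<lambda>z. f n (torus_map z))"
      by (rule continuous_on_compose2[OF f_cont continuous_on_torus_map]) simp
    then show "(\<lambda>z. u z * f n (torus_map z)) \<in> borel_measurable M"
      using in_L2_D(2)[OF u] continuous_measurable_M by (intro borel_measurable_times) auto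
    show "AE z in M. norm (u z * f n (torus_map z)) \<le> \<bar>u z\<bar>"
      using f01[of n] by (intro AE_I2) (simp add: abs_mult mult_left_le)
  qed
  then show ?thesis
    using zero_coeffs_continuous_torus[OF assms(1) f_cont] by (simp add: LIMSEQ_const_iff)
qed

text \<open>It suffices that the integral of \<open>u\<close> over every measurable set vanishes.
  Outer regularity encloses such a set in an open one up to a set \<open>D\<close> of small measure,
  and the integral over \<open>D\<close> is controlled by the \<open>L2\<close> norm.\<close>

lemma zero_coeffs_imp_zero:
  assumes "zero_coeffs u"
  shows "AE z in M. u z = 0"
proof -
  have u: "in_L2 L u" using assms(1) by (simp add: zero_coeffs_def)
  have int_u: "integrable M u" by (rule in_L2_integrable[OF u])
  have "(LINT z:A|M. u z) = 0" if A: "A \<in> sets M" for A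
  proof -
    let ?c = "\<integral>z. (u z)\<^sup>2 \<partial>M"
    have A': "A \<in> sets lebesgue" "A \<subseteq> square L"
      using A by (simp_all add: sets_restrict_space_iff)
    have *: "\<bar>LINT z:A|M. u z\<bar> \<le> e * (?c + 1)" if e: "0 < e" for e
    proof -
      \<comment> \<open>The measure of the excess is taken below the square of \<open>e\<close>,
        because Young's inequality on \<open>D\<close> costs a factor \<open>1 / e\<close>.\<close>
      obtain T where T: "open T" "A \<subseteq> T" "T - A \<in> lmeasurable" "emeasure lebesgue (T - A) < ennreal (e\<^sup>2)"
        using sets_lebesgue_outer_open[OF A'(1), of "e\<^sup>2"] e by auto
      define G where "G = T \<inter> square L"
      define D where "D = G - A"
      have G: "open G" "G \<subseteq> square L" "A \<subseteq> G"
        using T A' by (auto simp: G_def square_eq_box)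
      have Dsub: "D \<subseteq> square L" using G by (auto simp: D_def)
      have Dset: "D \<in> sets M"
        using G A' by (auto simp: D_def sets_restrict_space_iff)
      have "emeasure M D = emeasure lebesgue D"
        using G by (intro emeasure_restrict_space) (auto simp: D_def)
      also have "\<dots> \<le> emeasure lebesgue (T - A)"
        using T by (intro emeasure_mono) (auto simp: D_def G_def)
      finally have "emeasure M D \<le> ennreal (e\<^sup>2)" using T by simp
      then have D: "measure M D \<le> e\<^sup>2"
        by (simp add: measure_def enn2real_leI)
      have iD: "integrable M (indicat_real D)"
        using Dset finite_measure.emeasure_finite[OF finite_measure_M]
        by (simp add: top.not_eq_extremum)
      have i1: "integrable M (\<lambda>z. u z * indicator A z)" "integrable M (\<lambda>z. u z * indicator D z)"
        using integrable_mult_indicator[OF A int_u] integrable_mult_indicator[OF Dset int_u]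
        by (simp_all add: mult.commute)
      have "(\<integral>z. u z * indicator G z \<partial>M) = (\<integral>z. u z * indicator A z + u z * indicator D z \<partial>M)"
        using G by (intro Bochner_Integration.integral_cong) (auto simp: D_def indicator_def)
      also have "\<dots> = (\<integral>z. u z * indicator A z \<partial>M) + (\<integral>z. u z * indicator D z \<partial>M)"
        using i1 by simp
      finally have "(\<integral>z. u z * indicator A z \<partial>M) = - (\<integral>z. u z * indicator D z \<partial>M)"
        using zero_coeffs_open[OF assms G(1,2)] by simp
      then have "\<bar>LINT z:A|M. u z\<bar> = \<bar>\<integral>z. u z * indicator D z \<partial>M\<bar>"
        by (simp add: set_lebesgue_integral_def mult.commute)
      also have "\<dots> \<le> (\<integral>z. e * (u z)\<^sup>2 + (1 / e) * indicator D z \<partial>M)"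
      proof (rule integral_abs_bound_integral)
        show "integrable M (\<lambda>z. e * (u z)\<^sup>2 + (1 / e) * indicator D z)"
          using in_L2_D(3)[OF u] iD by (intro Bochner_Integration.integrable_add integrable_mult_right)
        fix z
        have "0 \<le> (e * \<bar>u z\<bar> - 1)\<^sup>2 / e + \<bar>u z\<bar>" using e by simp
        also have "(e * \<bar>u z\<bar> - 1)\<^sup>2 / e = e * (u z)\<^sup>2 - 2 * \<bar>u z\<bar> + 1 / e"
          using e by (simp add: field_simps power2_eq_square)
        finally show "\<bar>u z * indicator D z\<bar> \<le> e * (u z)\<^sup>2 + (1 / e) * indicator D z"
          using e by (auto simp: indicator_def)
      qed (rule i1)
      also have "\<dots> = e * ?c + (1 / e) * measure M D"
        using in_L2_D(3)[OF u] iD Dsub by (simp add: Int_absorb2)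
      also have "\<dots> \<le> e * ?c + (1 / e) * e\<^sup>2"
        using D e by (intro add_left_mono mult_left_mono) auto
      also have "\<dots> = e * (?c + 1)"
        using e by (simp add: field_simps power2_eq_square)
      finally show ?thesis .
    qed
    have c: "0 < ?c + 1" by (simp add: add_nonneg_pos)
    have "\<bar>LINT z:A|M. u z\<bar> \<le> 0 + e" if "0 < e" for e
      using *[of "e / (?c + 1)"] that c by simp
    then show ?thesis
      using field_le_epsilon[of "\<bar>LINT z:A|M. u z\<bar>" 0] by simp
  qed
  then show ?thesis
    using density_unique_real[OF int_u, of "\<lambda>z. 0"] by (simp add: set_lebesgue_integral_def)
qed

lemma fc_inject:
  assumes "in_L2 L u" "in_L2 L v" "fc u = fc v"
  shows "eq_ae L u v"
proof -
  have "AE z in M. u z - v z = 0"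
    using assms by (intro zero_coeffs_imp_zero) (simp add: zero_coeffs_def in_L2_diff fc_diff)
  then show ?thesis
    unfolding eq_ae_def by eventually_elim simp
qed

section \<open>Riesz--Fischer, Parseval and products\<close>


definition hermitian :: "(int \<times> int \<Rightarrow> complex) \<Rightarrow> bool" where
  "hermitian c \<longleftrightarrow> (\<forall>k. c (- k) = cnj (c k))"

definition trig_sum :: "(int \<times> int \<Rightarrow> complex) \<Rightarrow> (int \<times> int) set \<Rightarrow> field2" where
  "trig_sum c F z = (\<Sum>k\<in>F. re_wave (c k) k z)"

lemma hermitian_fc: "hermitian (fc u)"
  by (simp add: hermitian_def fc_uminus del: split_paired_All)

lemma in_L2_trig_sum: "in_L2 L (trig_sum c F)"
  unfolding trig_sum_def by (intro in_L2_sum in_L2_re_wave)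

text \<open>Since real parts are summed, \<open>k\<close> and \<open>- k\<close> contribute one half
  of the coefficient each. A set \<open>F\<close> that is symmetric reproduces \<open>c\<close> on
  \<open>F\<close>; an asymmetric one yields only half of it at unpaired frequencies.\<close>

lemma fc_trig_sum:
  assumes "hermitian c" "finite F"
  shows "fc (trig_sum c F) k = ((if k \<in> F then c k else 0) + (if - k \<in> F then c k else 0)) / 2"
proof -
  have neg: "k = - j \<longleftrightarrow> - k = j" for j :: "int \<times> int" by auto
  have "fc (trig_sum c F) k = (\<Sum>j\<in>F. ((if k = j then c j else 0) + (if - k = j then cnj (c j) else 0)) / 2)"
    unfolding trig_sum_def by (simp add: fc_sum in_L2_re_wave fc_re_wave neg)
  also have "\<dots> = ((\<Sum>j\<in>F. if k = j then c j else 0) + (\<Sum>j\<in>F. if - k = j then cnj (c j) else 0)) / 2"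
    by (simp add: sum_divide_distrib sum.distrib add_divide_distrib)
  also have "\<dots> = ((if k \<in> F then c k else 0) + (if - k \<in> F then cnj (c (- k)) else 0)) / 2"
    using assms(2) by (simp add: sum.delta')
  also have "cnj (c (- k)) = c k"
    using assms(1) by (metis complex_cnj_cnj hermitian_def)
  finally show ?thesis .
qed

lemma integral_mult_trig_sum:
  assumes "in_L2 L u" "finite F"
  shows "(\<integral>z. u z * trig_sum c F z \<partial>M) = L\<^sup>2 * (\<Sum>k\<in>F. Re (c k * cnj (fc u k)))"
  using assms
  by (simp add: trig_sum_def sum_distrib_left in_L2_integrable_mult in_L2_re_wave integral_mult_re_wave)

text \<open>Only an inequality, because a frequency whose negative is missing from \<open>F\<close>
  counts half.\<close>

lemma integral_trig_sum_square:
  assumes "hermitian c" "finite F"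
  shows "(\<integral>z. (trig_sum c F z)\<^sup>2 \<partial>M) \<le> L\<^sup>2 * (\<Sum>k\<in>F. (cmod (c k))\<^sup>2)"
proof -
  have "(\<integral>z. (trig_sum c F z)\<^sup>2 \<partial>M) = L\<^sup>2 * (\<Sum>k\<in>F. Re (c k * cnj (fc (trig_sum c F) k)))"
    using integral_mult_trig_sum[OF in_L2_trig_sum assms(2), of c F c] by (simp add: power2_eq_square)
  also have "\<dots> \<le> L\<^sup>2 * (\<Sum>k\<in>F. (cmod (c k))\<^sup>2)"
  proof (intro mult_left_mono sum_mono)
    fix k assume "k \<in> F"
    then have "c k * cnj (fc (trig_sum c F) k) = of_real ((cmod (c k))\<^sup>2 * (if - k \<in> F then 1 else 1 / 2))"
      unfolding of_real_mult complex_norm_square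
      by (simp add: fc_trig_sum[OF assms])
    then show "Re (c k * cnj (fc (trig_sum c F) k)) \<le> (cmod (c k))\<^sup>2"
      by simp
  qed simp
  finally show ?thesis .
qed

text \<open>The square of the distance from \<open>u\<close> to \<open>?S\<close> is expanded. The
  cross term is exact, and an upper bound for the square of \<open>?S\<close> is all that is needed
  besides it, so \<open>F\<close> may be asymmetric.\<close>

lemma bessel:
  assumes u: "in_L2 L u" and F: "finite F"
  shows "L\<^sup>2 * (\<Sum>k\<in>F. (cmod (fc u k))\<^sup>2) \<le> (\<integral>z. (u z)\<^sup>2 \<partial>M)"
proof -
  let ?S = "trig_sum (fc u) F" and ?B = "L\<^sup>2 * (\<Sum>k\<in>F. (cmod (fc u k))\<^sup>2)"
  have S: "in_L2 L ?S" by (rule in_L2_trig_sum)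
  have "Re (c * cnj c) = (cmod c)\<^sup>2" for c
    by (simp only: complex_norm_square[symmetric] Re_complex_of_real)
  then have cross: "(\<integral>z. u z * ?S z \<partial>M) = ?B"
    using integral_mult_trig_sum[OF u F] by simp
  have "0 \<le> (\<integral>z. (u z - ?S z)\<^sup>2 \<partial>M)" by simp
  also have "\<dots> = (\<integral>z. (u z)\<^sup>2 - 2 * (u z * ?S z) + (?S z)\<^sup>2 \<partial>M)"
    by (simp add: power2_eq_square algebra_simps)
  also have "\<dots> = (\<integral>z. (u z)\<^sup>2 \<partial>M) - 2 * ?B + (\<integral>z. (?S z)\<^sup>2 \<partial>M)"
    using in_L2_D(3)[OF u] in_L2_D(3)[OF S] in_L2_integrable_mult[OF u S]
    by (simp add: cross)
  finally show ?thesis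
    using integral_trig_sum_square[OF hermitian_fc F, of u] by simp
qed

text \<open>The partial sums are spaced so that the blocks between consecutive ones decay
  geometrically. The series of blocks then converges absolutely almost everywhere, and its sum is
  the required function. A bound on the absolute sums of the coefficients bounds all partial sums,
  hence the limit.\<close>

lemma riesz_fischer:
  assumes herm: "hermitian c" and bound: "\<And>F. finite F \<Longrightarrow> (\<Sum>k\<in>F. (cmod (c k))\<^sup>2) \<le> B"
  obtains v where "in_L2 L v" "fc v = c" "(\<integral>z. (v z)\<^sup>2 \<partial>M) \<le> L\<^sup>2 * B"
    "\<And>A. (\<And>F. finite F \<Longrightarrow> (\<Sum>k\<in>F. cmod (c k)) \<le> A) \<Longrightarrow> AE z in M. \<bar>v z\<bar> \<le> A"
proof -
  have "\<exists>G. finite G \<and> (\<forall>F. finite F \<longrightarrow> F \<inter> G = {} \<longrightarrow> (\<Sum>k\<in>F. (cmod (c k))\<^sup>2) \<le> (1/4) ^ n)" for n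
    using finite_sums_tail[of "\<lambda>k. (cmod (c k))\<^sup>2" B "(1/4) ^ n", OF _ bound] by (metis zero_le_power2 zero_less_divide_1_iff zero_less_numeral zero_less_power)
  then obtain G where G: "\<And>n. finite (G n)"
    "\<And>n F. finite F \<Longrightarrow> F \<inter> G n = {} \<Longrightarrow> (\<Sum>k\<in>F. (cmod (c k))\<^sup>2) \<le> (1/4) ^ n"
    by metis
  \<comment> \<open>The sets \<open>G i\<close> make the tails small, and the enumeration guarantees
    that every frequency is reached eventually.\<close>
  define F where "F n = (\<Union>i\<le>n. G i) \<union> from_nat ` {..n}" for n
  have finF: "finite (F n)" for n by (simp add: F_def G)
  have FSuc: "F n \<subseteq> F (Suc n)" for n by (fastforce simp: F_def)
  have Fmono: "F m \<subseteq> F n" if "m \<le> n" for m n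
    using lift_Suc_mono_le[of F, OF FSuc that] .
  have Fex: "\<exists>N. \<forall>n\<ge>N. k \<in> F n" for k
  proof (intro exI allI impI)
    fix n assume "to_nat k \<le> n"
    moreover have "k = from_nat (to_nat k)" by simp
    ultimately show "k \<in> F n" unfolding F_def by blast
  qed
  define S where "S n = trig_sum c (F n)" for n
  define w where "w n = trig_sum c (F (Suc n) - F n)" for n
  have S_L2: "in_L2 L (S n)" and w_L2: "in_L2 L (w n)" for n
    by (simp_all add: S_def w_def in_L2_trig_sum)
  have S_Suc: "S (Suc n) z = S n z + w n z" for n z
    unfolding S_def w_def trig_sum_def
    using sum.subset_diff[OF FSuc[of n] finF[of "Suc n"], of "\<lambda>k. re_wave (c k) k z"] by simp
  have S_sum: "S n z = S 0 z + (\<Sum>i<n. w i z)" for n z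
    by (induction n) (simp_all add: S_Suc)
  have S_sq: "(\<integral>z. (S n z)\<^sup>2 \<partial>M) \<le> L\<^sup>2 * B" for n
    unfolding S_def
    by (rule order_trans[OF integral_trig_sum_square[OF herm finF] mult_left_mono[OF bound[OF finF]]]) simp
  have w_abs: "(\<integral>z. \<bar>w n z\<bar> \<partial>M) \<le> L\<^sup>2 * (1/2) ^ n" for n
  proof -
    let ?q = "(2::real) ^ n"
    have "(\<integral>z. (w n z)\<^sup>2 \<partial>M) \<le> L\<^sup>2 * (\<Sum>k\<in>F (Suc n) - F n. (cmod (c k))\<^sup>2)"
      unfolding w_def using finF by (intro integral_trig_sum_square[OF herm]) auto
    also have "\<dots> \<le> L\<^sup>2 * (1/4) ^ n"
      using finF by (intro mult_left_mono G) (auto simp: F_def)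
    finally have w2: "(\<integral>z. (w n z)\<^sup>2 \<partial>M) \<le> L\<^sup>2 * (1/4) ^ n" .
    \<comment> \<open>The weight \<open>?q\<close> balances the two terms of Young's inequality: the
      squared norm decays like \<open>(1/4) ^ n\<close>, so both become half of
      \<open>L\<^sup>2 * (1/2) ^ n\<close>.\<close>
    have "(\<integral>z. \<bar>w n z\<bar> \<partial>M) \<le> (\<integral>z. 1 / ?q / 2 + ?q / 2 * (w n z)\<^sup>2 \<partial>M)"
    proof (rule integral_mono)
      show "integrable M (\<lambda>z. 1 / ?q / 2 + ?q / 2 * (w n z)\<^sup>2)"
        using in_L2_D(3)[OF w_L2] in_L2_integrable[OF in_L2_const] by simp
      fix z
      have "0 \<le> (?q * \<bar>w n z\<bar> - 1)\<^sup>2 / (2 * ?q)" by simp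
      also have "\<dots> = 1 / ?q / 2 + ?q / 2 * (w n z)\<^sup>2 - \<bar>w n z\<bar>"
        by (simp add: field_simps power2_eq_square)
      finally show "\<bar>w n z\<bar> \<le> 1 / ?q / 2 + ?q / 2 * (w n z)\<^sup>2" by simp
    qed (use in_L2_integrable[OF w_L2] in simp)
    also have "\<dots> = L\<^sup>2 * (1 / ?q / 2) + ?q / 2 * (\<integral>z. (w n z)\<^sup>2 \<partial>M)"
      using in_L2_D(3)[OF w_L2] in_L2_integrable[OF in_L2_const[of "1 / ?q / 2"]] by simp
    also have "\<dots> \<le> L\<^sup>2 * (1 / ?q / 2) + ?q / 2 * (L\<^sup>2 * (1/4) ^ n)"
      using w2 by (intro add_left_mono mult_left_mono) auto
    also have "(1/4 :: real) ^ n = 1 / ?q / ?q"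
      by (simp add: power_divide flip: power_mult_distrib)
    also have "L\<^sup>2 * (1 / ?q / 2) + ?q / 2 * (L\<^sup>2 * (1 / ?q / ?q)) = L\<^sup>2 * (1/2) ^ n"
      by (simp add: field_simps power_divide)
    finally show ?thesis .
  qed
  have sum_w: "summable (\<lambda>n. \<integral>z. \<bar>w n z\<bar> \<partial>M)"
  proof (rule summable_comparison_test'[where N = 0])
    show "summable (\<lambda>n. L\<^sup>2 * (1/2) ^ n)"
      by (intro summable_mult summable_geometric) simp
    show "norm (\<integral>z. \<bar>w n z\<bar> \<partial>M) \<le> L\<^sup>2 * (1/2) ^ n" for n
      using w_abs by simp
  qed
  have AE_w: "AE z in M. summable (\<lambda>n. \<bar>w n z\<bar>)"
    using AE_summable_of_integral_bound[OF in_L2_integrable[OF w_L2] sum_w] .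
  \<comment> \<open>Periodicity is required at every point. It holds for this \<open>v\<close> even
    where the series diverges, because all its terms are periodic.\<close>
  define v where "v z = S 0 z + (\<Sum>n. w n z)" for z
  have S_lim: "AE z in M. (\<lambda>n. S n z) \<longlonglongrightarrow> v z"
    using AE_w
  proof eventually_elim
    case (elim z)
    have "(\<lambda>n. \<Sum>i<n. w i z) \<longlonglongrightarrow> (\<Sum>n. w n z)"
      using summable_rabs_cancel[OF elim] by (rule summable_LIMSEQ)
    from tendsto_add[OF tendsto_const[of "S 0 z"] this] show ?case
      by (simp add: v_def flip: S_sum)
  qed
  have v_meas [measurable]: "v \<in> borel_measurable M"
    unfolding v_def using in_L2_D(2)[OF w_L2] in_L2_D(2)[OF S_L2] by measurable
  \<comment> \<open>Fatou's lemma gives square integrability of the limit together with the bound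
    for its norm.\<close>
  have "(\<integral>\<^sup>+z. ennreal ((v z)\<^sup>2) \<partial>M) = (\<integral>\<^sup>+z. liminf (\<lambda>n. ennreal ((S n z)\<^sup>2)) \<partial>M)"
  proof (rule nn_integral_cong_AE)
    show "AE z in M. ennreal ((v z)\<^sup>2) = liminf (\<lambda>n. ennreal ((S n z)\<^sup>2))"
      using S_lim
    proof eventually_elim
      case (elim z)
      have "(\<lambda>n. ennreal ((S n z)\<^sup>2)) \<longlonglongrightarrow> ennreal ((v z)\<^sup>2)"
        by (intro tendsto_ennrealI tendsto_power elim)
      from lim_imp_Liminf[OF trivial_limit_sequentially this] show ?case by simp
    qed
  qed
  also have "\<dots> \<le> liminf (\<lambda>n. \<integral>\<^sup>+z. ennreal ((S n z)\<^sup>2) \<partial>M)"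
    using in_L2_D(2)[OF S_L2] by (intro nn_integral_liminf) measurable
  also have "\<dots> \<le> ennreal (L\<^sup>2 * B)"
  proof (rule Liminf_le)
    have "(\<integral>\<^sup>+z. ennreal ((S n z)\<^sup>2) \<partial>M) = ennreal (\<integral>z. (S n z)\<^sup>2 \<partial>M)" for n
      using in_L2_D(3)[OF S_L2] by (intro nn_integral_eq_integral) auto
    then show "\<forall>\<^sub>F n in sequentially. (\<integral>\<^sup>+z. ennreal ((S n z)\<^sup>2) \<partial>M) \<le> ennreal (L\<^sup>2 * B)"
      using S_sq by (simp add: ennreal_leI)
  qed simp
  finally have v_nn: "(\<integral>\<^sup>+z. ennreal ((v z)\<^sup>2) \<partial>M) \<le> ennreal (L\<^sup>2 * B)" .
  have v_int: "integrable M (\<lambda>z. (v z)\<^sup>2)"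
    using v_nn by (intro integrableI_bounded) (auto simp: le_less_trans ennreal_less_top)
  have "periodic2 L v"
    using in_L2_D(1)[OF w_L2] in_L2_D(1)[OF S_L2] by (simp add: periodic2_def v_def)
  then have v_L2: "in_L2 L v"
    using v_int v_meas by (simp add: in_L2_def)
  have B0: "0 \<le> B" using bound[of "{}"] by simp
  have v_sq: "(\<integral>z. (v z)\<^sup>2 \<partial>M) \<le> L\<^sup>2 * B"
    using v_nn v_int B0 by (simp add: nn_integral_eq_integral)
  have v_fc: "fc v k = c k" for k
  proof -
    let ?f = "\<lambda>n z. of_real (w n z) * wave (- k) z"
    have "(\<lambda>n. integral\<^sup>L M (?f n)) sums (\<integral>z. (\<Sum>n. ?f n z) \<partial>M)"
      using AE_w sum_w
      by (intro sums_integral integrable_times_wave w_L2) (simp_all add: norm_mult)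
    also have "(\<integral>z. (\<Sum>n. ?f n z) \<partial>M) = (\<integral>z. of_real (v z - S 0 z) * wave (- k) z \<partial>M)"
    proof (rule integral_cong_AE)
      show "(\<lambda>z. \<Sum>n. ?f n z) \<in> borel_measurable M"
        using in_L2_D(2)[OF w_L2] by measurable
      show "(\<lambda>z. complex_of_real (v z - S 0 z) * wave (- k) z) \<in> borel_measurable M"
        using in_L2_D(2)[OF S_L2] by measurable
      show "AE z in M. (\<Sum>n. ?f n z) = of_real (v z - S 0 z) * wave (- k) z"
        using AE_w
      proof eventually_elim
        case (elim z)
        have "(\<lambda>n. w n z) sums (v z - S 0 z)"
          using summable_rabs_cancel[OF elim] by (simp add: v_def summable_sums)
        then have "(\<lambda>n. ?f n z) sums (of_real (v z - S 0 z) * wave (- k) z)"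
          by (intro sums_mult2 sums_of_real)
        then show ?case by (simp add: sums_iff)
      qed
    qed
    finally have "(\<lambda>n. of_real (L\<^sup>2) * fc (w n) k) sums (of_real (L\<^sup>2) * fc (\<lambda>z. v z - S 0 z) k)"
      by (simp only: integral_times_wave minus_minus)
    then have "(\<lambda>n. fc (w n) k) sums fc (\<lambda>z. v z - S 0 z) k"
      using L_pos by (simp add: sums_mult_iff)
    then have "(\<lambda>n. \<Sum>i<n. fc (w i) k) \<longlonglongrightarrow> fc v k - fc (S 0) k"
      by (simp add: sums_def fc_diff v_L2 S_L2)
    moreover have "(\<Sum>i<n. fc (w i) k) = fc (S n) k - fc (S 0) k" for n
      by (induction n) (simp_all add: S_Suc fc_add S_L2 w_L2)
    ultimately have "(\<lambda>n. fc (S n) k) \<longlonglongrightarrow> fc v k"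
      using tendsto_add[of "\<lambda>n. fc (S n) k - fc (S 0) k" _ sequentially "\<lambda>n. fc (S 0) k"] by force
    moreover have "(\<lambda>n. fc (S n) k) \<longlonglongrightarrow> c k"
    proof (rule tendsto_eventually)
      \<comment> \<open>The sets \<open>F n\<close> need not be symmetric, so both \<open>k\<close>
        and \<open>- k\<close> must have been reached before the coefficient is complete.\<close>
      obtain N1 N2 where "\<forall>n\<ge>N1. k \<in> F n" "\<forall>n\<ge>N2. - k \<in> F n" using Fex by meson
      then have "\<forall>n\<ge>max N1 N2. fc (S n) k = c k"
        unfolding S_def by (simp add: fc_trig_sum[OF herm finF])
      then show "\<forall>\<^sub>F n in sequentially. fc (S n) k = c k"
        unfolding eventually_sequentially by blast
    qed
    ultimately show ?thesis by (rule LIMSEQ_unique)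
  qed
  have v_bd: "AE z in M. \<bar>v z\<bar> \<le> A" if A: "\<And>F. finite F \<Longrightarrow> (\<Sum>k\<in>F. cmod (c k)) \<le> A" for A
    using S_lim
  proof eventually_elim
    case (elim z)
    have "\<bar>S n z\<bar> \<le> A" for n
    proof -
      have "\<bar>re_wave (c k) k z\<bar> \<le> cmod (c k)" for k
        using abs_Re_le_cmod[of "c k * wave k z"] by (simp add: re_wave_def norm_mult)
      then have "\<bar>S n z\<bar> \<le> (\<Sum>k\<in>F n. cmod (c k))"
        unfolding S_def trig_sum_def by (intro order_trans[OF sum_abs] sum_mono)
      then show ?thesis using A[OF finF[of n]] by simp
    qed
    then show ?case
      using tendsto_rabs[OF elim] by (intro LIMSEQ_le_const2) auto
  qed
  show ?thesis
    using that[OF v_L2 _ v_sq v_bd] v_fc by blast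
qed

section \<open>Parseval's identity and coefficients of products\<close>

lemma parseval_le:
  assumes u: "in_L2 L u" and bound: "\<And>F. finite F \<Longrightarrow> (\<Sum>k\<in>F. (cmod (fc u k))\<^sup>2) \<le> B"
  shows "(\<integral>z. (u z)\<^sup>2 \<partial>M) \<le> L\<^sup>2 * B"
proof -
  \<comment> \<open>Riesz-Fischer rebuilds a function from the coefficients of \<open>u\<close> with
    the desired norm; uniqueness of coefficients identifies it with \<open>u\<close>.\<close>
  obtain v where v: "in_L2 L v" "fc v = fc u" "(\<integral>z. (v z)\<^sup>2 \<partial>M) \<le> L\<^sup>2 * B"
    using riesz_fischer[OF hermitian_fc bound] by blast
  have "AE z in M. v z = u z"
    using fc_inject[OF v(1) u v(2)] by (simp add: eq_ae_def)
  then have "(\<integral>z. (v z)\<^sup>2 \<partial>M) = (\<integral>z. (u z)\<^sup>2 \<partial>M)"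
    using in_L2_D(2)[OF u] in_L2_D(2)[OF v(1)] by (intro integral_cong_AE) auto
  then show ?thesis using v(3) by simp
qed

text \<open>The function rebuilt from the coefficients inherits the uniform bound of its partial
  sums and equals \<open>u\<close> almost everywhere.\<close>

lemma AE_bound_of_fc:
  assumes u: "in_L2 L u" and bound: "\<And>F. finite F \<Longrightarrow> (\<Sum>k\<in>F. cmod (fc u k)) \<le> A"
  shows "AE z in M. \<bar>u z\<bar> \<le> A"
proof -
  have bdd: "(\<Sum>k\<in>F. (cmod (fc u k))\<^sup>2) \<le> (\<integral>z. (u z)\<^sup>2 \<partial>M) / L\<^sup>2" if "finite F" for F
    using bessel[OF u that] L_pos by (simp add: field_simps)
  obtain v where v: "in_L2 L v" "fc v = fc u" "AE z in M. \<bar>v z\<bar> \<le> A"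
    using riesz_fischer[OF hermitian_fc bdd] bound by metis
  have "AE z in M. v z = u z"
    using fc_inject[OF v(1) u v(2)] by (simp add: eq_ae_def)
  with v(3) show ?thesis by eventually_elim simp
qed

lemma parseval:
  assumes u: "in_L2 L u"
  shows "((\<lambda>k. (cmod (fc u k))\<^sup>2) has_sum (\<integral>z. (u z)\<^sup>2 \<partial>M) / L\<^sup>2) UNIV"
proof -
  let ?f = "\<lambda>k. (cmod (fc u k))\<^sup>2" and ?I = "(\<integral>z. (u z)\<^sup>2 \<partial>M) / L\<^sup>2"
  have bdd: "sum ?f F \<le> ?I" if "finite F" for F
    using bessel[OF u that] L_pos by (simp add: field_simps)
  have s: "?f summable_on UNIV"
    using bdd by (intro nonneg_bdd_above_summable_on) (auto simp: bdd_above_def)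
  have "infsum ?f UNIV \<le> ?I"
    using bdd by (intro infsum_le_finite_sums s)
  moreover have "sum ?f F \<le> infsum ?f UNIV" if "finite F" for F
    using that by (intro finite_sum_le_infsum s) auto
  then have "(\<integral>z. (u z)\<^sup>2 \<partial>M) \<le> L\<^sup>2 * infsum ?f UNIV"
    by (rule parseval_le[OF u])
  then have "?I \<le> infsum ?f UNIV"
    using L_pos by (simp add: field_simps)
  ultimately show ?thesis
    using s by (metis antisym has_sum_infsum)
qed

text \<open>Polarization settles the real part. The imaginary part is odd in \<open>k\<close>,
  because the functions are real, so its sum equals its own negative once it is known to
  exist.\<close>

lemma parseval_bilinear:
  assumes u: "in_L2 L u" and v: "in_L2 L v"
  shows "((\<lambda>k. fc u k * cnj (fc v k)) has_sum of_real ((\<integral>z. u z * v z \<partial>M) / L\<^sup>2)) UNIV"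
proof -
  let ?g = "\<lambda>k. fc u k * cnj (fc v k)" and ?I = "(\<integral>z. u z * v z \<partial>M) / L\<^sup>2"
  have p: "((\<lambda>k. (cmod (fc u k + fc v k))\<^sup>2) has_sum (\<integral>z. (u z + v z)\<^sup>2 \<partial>M) / L\<^sup>2) UNIV"
    using parseval[OF in_L2_add[OF u v]] by (simp only: fc_add[OF u v])
  have m: "((\<lambda>k. (cmod (fc u k - fc v k))\<^sup>2) has_sum (\<integral>z. (u z - v z)\<^sup>2 \<partial>M) / L\<^sup>2) UNIV"
    using parseval[OF in_L2_diff[OF u v]] by (simp only: fc_diff[OF u v])
  have polar: "(cmod (a + b))\<^sup>2 - (cmod (a - b))\<^sup>2 = 4 * Re (a * cnj b)" for a b
    unfolding cmod_power2 by (simp add: power2_eq_square algebra_simps)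
  have "(\<integral>z. (u z + v z)\<^sup>2 \<partial>M) - (\<integral>z. (u z - v z)\<^sup>2 \<partial>M) = (\<integral>z. (u z + v z)\<^sup>2 - (u z - v z)\<^sup>2 \<partial>M)"
    using in_L2_D(3)[OF in_L2_add[OF u v]] in_L2_D(3)[OF in_L2_diff[OF u v]] by simp
  also have "\<dots> = (\<integral>z. 4 * (u z * v z) \<partial>M)"
    by (simp add: power2_eq_square algebra_simps)
  finally have I: "(\<integral>z. (u z + v z)\<^sup>2 \<partial>M) / L\<^sup>2 - (\<integral>z. (u z - v z)\<^sup>2 \<partial>M) / L\<^sup>2 = 4 * ?I"
    by (simp add: diff_divide_distrib[symmetric])
  have "((\<lambda>k. 4 * Re (?g k)) has_sum 4 * ?I) UNIV"
    using has_sum_add[OF p has_sum_uminusI[OF m]] by (simp only: polar I add_uminus_conv_diff)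
  then have "((\<lambda>k. 1 / 4 * (4 * Re (?g k))) has_sum 1 / 4 * (4 * ?I)) UNIV"
    by (rule has_sum_cmult_right)
  moreover have "1 / 4 * (4 * x) = x" for x :: real by simp
  ultimately have re: "((\<lambda>k. Re (?g k)) has_sum ?I) UNIV" by (simp only:)
  have sq: "(\<lambda>k. (cmod (fc u k))\<^sup>2 + (cmod (fc v k))\<^sup>2) summable_on UNIV"
    using has_sum_add[OF parseval[OF u] parseval[OF v]] by (rule has_sum_imp_summable)
  have le: "norm (Im (?g k)) \<le> (cmod (fc u k))\<^sup>2 + (cmod (fc v k))\<^sup>2" for k
  proof -
    have "norm (Im (?g k)) \<le> cmod (fc u k) * cmod (fc v k)"
      using abs_Im_le_cmod[of "?g k"] by (simp add: norm_mult)
    also have "\<dots> \<le> 2 * cmod (fc u k) * cmod (fc v k)"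
      by (simp add: mult_right_mono)
    finally show ?thesis
      using sum_squares_bound[of "cmod (fc u k)" "cmod (fc v k)"] by simp
  qed
  have "(\<lambda>k. norm (Im (?g k))) summable_on UNIV"
    by (rule Infinite_Sum.abs_summable_on_comparison_test'[OF sq le])
  then have "(\<lambda>k. Im (?g k)) summable_on UNIV"
    by (rule abs_summable_summable)
  then obtain J where J: "((\<lambda>k. Im (?g k)) has_sum J) UNIV"
    by (auto simp: summable_on_def)
  have "bij (uminus :: int \<times> int \<Rightarrow> int \<times> int)"
    by (rule bij_uminus)
  then have "((\<lambda>k. Im (?g (- k))) has_sum J) UNIV"
    using has_sum_reindex_bij_betw[of uminus UNIV UNIV "\<lambda>k. Im (?g k)" J] J by simp
  then have "((\<lambda>k. - Im (?g k)) has_sum J) UNIV"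
    by (simp add: fc_uminus)
  with J have "J = - J"
    by (metis has_sum_uminus has_sum_unique)
  then have "((\<lambda>k. Im (?g k)) has_sum 0) UNIV" using J by simp
  then have "((\<lambda>k. of_real (Re (?g k)) + \<i> * of_real (Im (?g k))) has_sum (of_real ?I + \<i> * of_real 0)) UNIV"
    by (intro has_sum_add has_sum_cmult_right has_sum_of_real re)
  moreover have "of_real (Re x) + \<i> * of_real (Im x) = x" for x
    by (simp add: complex_eq_iff)
  ultimately show ?thesis by (simp only: of_real_0 mult_zero_right add_0_right)
qed

text \<open>Parseval applied to \<open>u\<close> and to the two real functions whose complex combination is
  \<open>w\<close> times a character.\<close>

lemma fc_mult_has_sum:
  assumes u: "in_L2 L u" and w: "in_L2 L w"
  shows "((\<lambda>j. fc u j * fc w (k - j)) has_sum fc (\<lambda>z. u z * w z) k) UNIV"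
proof -
  let ?w1 = "\<lambda>z. w z * re_wave 1 (- k) z" and ?w2 = "\<lambda>z. w z * re_wave (- \<i>) (- k) z"
  have w1: "in_L2 L ?w1" and w2: "in_L2 L ?w2"
    by (intro in_L2_mult_re_wave w)+
  have split: "of_real (u z * w z) * wave (- k) z = of_real (u z * ?w1 z) + \<i> * of_real (u z * ?w2 z)" for z
    by (simp add: re_wave_def complex_eq_iff)
  have "(\<integral>z. of_real (u z * w z) * wave (- k) z \<partial>M) =
      of_real (\<integral>z. u z * ?w1 z \<partial>M) + \<i> * of_real (\<integral>z. u z * ?w2 z \<partial>M)"
    unfolding split using in_L2_integrable_mult[OF u w1] in_L2_integrable_mult[OF u w2]
    by (subst Bochner_Integration.integral_add) (auto simp del: of_real_mult)
  then have F: "fc (\<lambda>z. u z * w z) k = of_real ((\<integral>z. u z * ?w1 z \<partial>M) / L\<^sup>2)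
      + \<i> * of_real ((\<integral>z. u z * ?w2 z \<partial>M) / L\<^sup>2)"
    by (simp add: fc_def add_divide_distrib)
  have "fc u j * cnj (fc ?w1 j) + \<i> * (fc u j * cnj (fc ?w2 j)) = fc u j * fc w (k - j)" for j
  proof -
    have n: "fc w (j - - k) = cnj (fc w (- k - j))" "fc w (j + - k) = cnj (fc w (k - j))"
      using fc_uminus[of w "- k - j"] fc_uminus[of w "k - j"] by (simp_all add: algebra_simps)
    show ?thesis
      by (simp only: fc_mult_re_wave[OF w] n) (simp add: algebra_simps add_divide_distrib diff_divide_distrib)
  qed
  then show ?thesis
    unfolding F using has_sum_add[OF parseval_bilinear[OF u w1]
        has_sum_cmult_right[OF parseval_bilinear[OF u w2], of \<i>]]
    by simp
qed

end

section \<open>Weighted coefficient norms\<close>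

text \<open>Equivalent to the usual weight \<open>(1 + |k|^2)^(1/2)\<close>. In this form it is at
  least 1 and subadditive without constants.\<close>

definition rho :: "int \<times> int \<Rightarrow> real" where
  "rho k = 1 + \<bar>of_int (fst k)\<bar> + \<bar>of_int (snd k)\<bar>"

text \<open>The weighted \<open>\<ell>\<^sup>2\<close> norm of order \<open>r\<close> is only ever bounded from above, through its
  finite partial sums; this avoids all summability side conditions.\<close>

definition hb :: "nat \<Rightarrow> (int \<times> int \<Rightarrow> complex) \<Rightarrow> real \<Rightarrow> bool" where
  "hb r c B \<longleftrightarrow> (\<forall>F. finite F \<longrightarrow> L2_set (\<lambda>k. rho k ^ r * cmod (c k)) F \<le> B)"

lemma rho_ge_1: "1 \<le> rho k"
  by (simp add: rho_def)

lemma rho_pos [simp]: "0 < rho k" "0 \<le> rho k"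
  by (simp_all add: rho_def add_pos_nonneg)

lemma rho_0 [simp]: "rho 0 = 1"
  by (simp add: rho_def)

lemma rho_triangle: "rho (j + k) \<le> rho j + rho k"
  by (simp add: rho_def)

text \<open>One of \<open>j\<close> and \<open>k - j\<close> carries at least half of the weight of
  \<open>k\<close>. In coefficient form this is the principle that all derivatives of a product may
  be put on one factor.\<close>

lemma rho_power_split: "rho k ^ r \<le> 2 ^ r * (rho j ^ r + rho (k - j) ^ r)"
proof -
  let ?m = "max (rho j) (rho (k - j))"
  have "rho k \<le> 2 * ?m"
    using rho_triangle[of j "k - j"] by simp
  then have "rho k ^ r \<le> 2 ^ r * ?m ^ r"
    by (metis power_mono power_mult_distrib rho_pos(2))
  also have "?m ^ r \<le> rho j ^ r + rho (k - j) ^ r"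
    by (simp add: max_def)
  finally show ?thesis by simp
qed

lemma hb_D: "hb r c B \<Longrightarrow> finite F \<Longrightarrow> L2_set (\<lambda>k. rho k ^ r * cmod (c k)) F \<le> B"
  by (simp add: hb_def)

lemma hb_nonneg: "hb r c B \<Longrightarrow> 0 \<le> B"
  using hb_D[of r c B "{}"] by simp

lemma hb_mono: "hb r c B \<Longrightarrow> B \<le> B' \<Longrightarrow> hb r c B'"
  unfolding hb_def by (meson order_trans)

text \<open>Changes of order, Fourier multipliers and constant factors all act on the coefficient
  norms through such a pointwise comparison.\<close>

lemma hb_dominated:
  assumes "hb r c B" "0 \<le> K" "\<And>k. rho k ^ q * cmod (d k) \<le> K * (rho k ^ r * cmod (c k))"
  shows "hb q d (K * B)"
  unfolding hb_def
proof (intro allI impI)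
  fix F :: "(int \<times> int) set" assume F: "finite F"
  have "L2_set (\<lambda>k. rho k ^ q * cmod (d k)) F \<le> L2_set (\<lambda>k. K * (rho k ^ r * cmod (c k))) F"
    by (intro L2_set_mono assms(3)) simp
  also have "\<dots> = K * L2_set (\<lambda>k. rho k ^ r * cmod (c k)) F"
    by (rule L2_set_right_distrib[OF assms(2), symmetric])
  also have "\<dots> \<le> K * B"
    by (intro mult_left_mono hb_D[OF assms(1) F] assms(2))
  finally show "L2_set (\<lambda>k. rho k ^ q * cmod (d k)) F \<le> K * B" .
qed

lemma hb_exponent_mono: "hb r c B \<Longrightarrow> q \<le> r \<Longrightarrow> hb q c B"
  using hb_dominated[of r c B 1 q c] by (simp add: mult_right_mono power_increasing rho_ge_1)

lemma hb_smaller: "hb r c B \<Longrightarrow> (\<And>k. cmod (d k) \<le> cmod (c k)) \<Longrightarrow> hb r d B"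
  using hb_dominated[of r c B 1 r d] by (simp add: mult_left_mono)

lemma hb_cmult: "hb r c B \<Longrightarrow> hb r (\<lambda>k. a * c k) (cmod a * B)"
  using hb_dominated[of r c B "cmod a" r "\<lambda>k. a * c k"] by (simp add: norm_mult mult.left_commute)

lemma hb_cmod: "hb r c B \<Longrightarrow> hb r (\<lambda>k. of_real (cmod (c k))) B"
  by (rule hb_smaller) auto

lemma hb_add:
  assumes "hb r c B" "hb r d D"
  shows "hb r (\<lambda>k. c k + d k) (B + D)"
  unfolding hb_def
proof (intro allI impI)
  fix F :: "(int \<times> int) set" assume F: "finite F"
  have "L2_set (\<lambda>k. rho k ^ r * cmod (c k + d k)) F
      \<le> L2_set (\<lambda>k. rho k ^ r * cmod (c k) + rho k ^ r * cmod (d k)) F"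
    by (intro L2_set_mono) (simp_all add: norm_triangle_ineq mult_left_mono flip: distrib_left)
  also have "\<dots> \<le> L2_set (\<lambda>k. rho k ^ r * cmod (c k)) F + L2_set (\<lambda>k. rho k ^ r * cmod (d k)) F"
    by (rule L2_set_triangle_ineq)
  also have "\<dots> \<le> B + D"
    by (intro add_mono hb_D[OF _ F] assms)
  finally show "L2_set (\<lambda>k. rho k ^ r * cmod (c k + d k)) F \<le> B + D" .
qed

lemma hb_diff: "hb r c B \<Longrightarrow> hb r d D \<Longrightarrow> hb r (\<lambda>k. c k - d k) (B + D)"
  using hb_add[of r c B "\<lambda>k. - 1 * d k" D] hb_cmult[of r d D "- 1"] by simp

lemma hb_zero: "hb r (\<lambda>k. 0) 0"
  by (simp add: hb_def L2_set_def)

lemma hb_sum: "(\<And>i. i \<in> I \<Longrightarrow> hb r (c i) (B i)) \<Longrightarrow> hb r (\<lambda>k. \<Sum>i\<in>I. c i k) (\<Sum>i\<in>I. B i)"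
  by (induction I rule: infinite_finite_induct) (simp_all add: hb_zero hb_add)

lemma hb_iff_sum_squares:
  assumes "0 \<le> B"
  shows "hb r c B \<longleftrightarrow> (\<forall>F. finite F \<longrightarrow> (\<Sum>k\<in>F. (rho k ^ r * cmod (c k))\<^sup>2) \<le> B\<^sup>2)"
  unfolding hb_def L2_set_def using assms
  by (simp add: real_sqrt_le_iff' sum_nonneg)

section \<open>Lattice sums and convolutions\<close>

lemma sum_inverse_squares_le: "(\<Sum>n<N. 1 / (1 + real n)\<^sup>2) \<le> 2"
proof -
  have "(\<Sum>n<Suc N. 1 / (1 + real n)\<^sup>2) \<le> 2 - 1 / (1 + real N)" for N
  proof (induction N)
    case (Suc N)
    have "1 / (1 + real (Suc N))\<^sup>2 \<le> 1 / (1 + real N) - 1 / (1 + real (Suc N))"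
    proof -
      have "1 / (1 + real (Suc N))\<^sup>2 \<le> 1 / ((1 + real N) * (1 + real (Suc N)))"
        unfolding power2_eq_square by (intro frac_le mult_mono mult_pos_pos) auto
      also have "\<dots> = 1 / (1 + real N) - 1 / (1 + real (Suc N))"
        by (simp add: field_simps)
      finally show ?thesis .
    qed
    then show ?case using Suc by simp
  qed simp
  from this[of "N"] have "(\<Sum>n<Suc N. 1 / (1 + real n)\<^sup>2) \<le> 2"
    by (rule order_trans) simp
  moreover have "(\<Sum>n<N. 1 / (1 + real n)\<^sup>2) \<le> (\<Sum>n<Suc N. 1 / (1 + real n)\<^sup>2)"
    by simp
  ultimately show ?thesis by linarith
qed

lemma sum_inverse_squares_int_le:
  fixes A :: "int set"
  assumes "finite A"
  shows "(\<Sum>n\<in>A. 1 / (1 + \<bar>real_of_int n\<bar>)\<^sup>2) \<le> 4"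
proof -
  let ?g = "\<lambda>n::int. 1 / (1 + \<bar>real_of_int n\<bar>)\<^sup>2"
  have half: "(\<Sum>n\<in>B. ?g n) \<le> 2" if B: "finite B" "inj_on (\<lambda>n. nat \<bar>n\<bar>) B" for B :: "int set"
  proof -
    let ?N = "Suc (Max (insert 0 ((\<lambda>n. nat \<bar>n\<bar>) ` B)))"
    have "(\<Sum>n\<in>B. ?g n) = (\<Sum>n\<in>(\<lambda>n. nat \<bar>n\<bar>) ` B. 1 / (1 + real n)\<^sup>2)"
      by (simp add: sum.reindex[OF B(2)])
    also have "\<dots> \<le> (\<Sum>n<?N. 1 / (1 + real n)\<^sup>2)"
      using B(1) by (intro sum_mono2) (auto simp: less_Suc_eq_le)
    also have "\<dots> \<le> 2" by (rule sum_inverse_squares_le)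
    finally show ?thesis .
  qed
  have "(\<Sum>n\<in>A. ?g n) = (\<Sum>n\<in>A \<inter> {n. 0 \<le> n}. ?g n) + (\<Sum>n\<in>A - {n. 0 \<le> n}. ?g n)"
    by (rule sum.Int_Diff[OF assms])
  also have "\<dots> \<le> 2 + 2"
    by (intro add_mono half) (auto simp: assms inj_on_def)
  finally show ?thesis by simp
qed

text \<open>The square of \<open>rho k\<close> dominates the product of the one-dimensional weights
  of the two components. The lattice sum therefore factors into two sums of inverse squares, each at
  most 4.\<close>

lemma sum_rho_power_le:
  assumes "finite F"
  shows "(\<Sum>k\<in>F. 1 / rho k ^ 4) \<le> 16"
proof -
  let ?g = "\<lambda>n::int. 1 / (1 + \<bar>real_of_int n\<bar>)\<^sup>2"
  have "1 / rho k ^ 4 \<le> ?g (fst k) * ?g (snd k)" for k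
  proof -
    have "((1 + \<bar>real_of_int (fst k)\<bar>) * (1 + \<bar>real_of_int (snd k)\<bar>))\<^sup>2 \<le> (rho k * rho k)\<^sup>2"
      by (intro power_mono mult_mono) (auto simp: rho_def)
    also have "\<dots> = rho k ^ 4" by (simp add: power_mult_distrib flip: power_add)
    finally have "1 / rho k ^ 4 \<le> 1 / ((1 + \<bar>real_of_int (fst k)\<bar>) * (1 + \<bar>real_of_int (snd k)\<bar>))\<^sup>2"
      by (intro frac_le zero_less_power mult_pos_pos) (auto simp: add_pos_nonneg)
    then show ?thesis by (simp add: power_mult_distrib)
  qed
  then have "(\<Sum>k\<in>F. 1 / rho k ^ 4) \<le> (\<Sum>k\<in>F. ?g (fst k) * ?g (snd k))"
    by (rule sum_mono)
  also have "\<dots> \<le> (\<Sum>k\<in>fst ` F \<times> snd ` F. ?g (fst k) * ?g (snd k))"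
    using assms by (intro sum_mono2) (force+)
  also have "\<dots> = (\<Sum>m\<in>fst ` F. ?g m) * (\<Sum>n\<in>snd ` F. ?g n)"
    by (simp add: sum_product sum.cartesian_product case_prod_unfold)
  also have "\<dots> \<le> 4 * 4"
    using assms by (intro mult_mono sum_inverse_squares_int_le sum_nonneg) auto
  finally show ?thesis by simp
qed

text \<open>The Sobolev embedding of order two in dimension two, by the Cauchy-Schwarz inequality
  against \<open>1 / rho k ^ 2\<close>. The factor 4 is the square root of the bound 16 for the
  lattice sum.\<close>

lemma hb_imp_absolutely_bounded:
  assumes "hb 2 c B" "finite F"
  shows "(\<Sum>k\<in>F. cmod (c k)) \<le> 4 * B"
proof -
  have "(\<Sum>k\<in>F. cmod (c k)) = (\<Sum>k\<in>F. \<bar>1 / rho k ^ 2\<bar> * \<bar>rho k ^ 2 * cmod (c k)\<bar>)"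
    using rho_pos by (intro sum.cong refl) (simp add: less_imp_neq[symmetric])
  also have "\<dots> \<le> L2_set (\<lambda>k. 1 / rho k ^ 2) F * L2_set (\<lambda>k. rho k ^ 2 * cmod (c k)) F"
    by (rule L2_set_mult_ineq)
  also have "\<dots> \<le> 4 * B"
  proof (intro mult_mono hb_D[OF assms] L2_set_nonneg)
    have "L2_set (\<lambda>k. 1 / rho k ^ 2) F = sqrt (\<Sum>k\<in>F. 1 / rho k ^ 4)"
      by (simp add: L2_set_def power_divide flip: power_mult)
    also have "\<dots> \<le> sqrt 16"
      by (intro real_sqrt_le_mono sum_rho_power_le assms)
    finally show "L2_set (\<lambda>k. 1 / rho k ^ 2) F \<le> 4"
      by (simp add: real_sqrt_eq_iff[of 16 "4\<^sup>2", simplified])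
  qed simp
  finally show ?thesis .
qed

lemma L2_set_sum_le:
  assumes "finite G"
  shows "L2_set (\<lambda>k. \<Sum>j\<in>G. f j k) F \<le> (\<Sum>j\<in>G. L2_set (f j) F)"
  using assms
proof (induction G)
  case (insert x G)
  have "L2_set (\<lambda>k. f x k + (\<Sum>j\<in>G. f j k)) F \<le> L2_set (f x) F + L2_set (\<lambda>k. \<Sum>j\<in>G. f j k) F"
    by (rule L2_set_triangle_ineq)
  then show ?case using insert by simp
qed (simp add: L2_set_def)

text \<open>Young's inequality \<open>\<ell>\<^sup>1 * \<ell>\<^sup>2 \<subseteq> \<ell>\<^sup>2\<close>, by Minkowski's inequality applied to
  the translates of \<open>b\<close>.\<close>

lemma young_finite:
  fixes a b :: "int \<times> int \<Rightarrow> real"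
  assumes "finite F" "finite G" "\<And>j. 0 \<le> a j"
    and a: "(\<Sum>j\<in>G. a j) \<le> A" and b: "\<And>F. finite F \<Longrightarrow> L2_set b F \<le> B"
  shows "L2_set (\<lambda>k. \<Sum>j\<in>G. a j * b (k - j)) F \<le> A * B"
proof -
  have shift: "L2_set (\<lambda>k. b (k - j)) F \<le> B" for j
  proof -
    have "L2_set (\<lambda>k. b (k - j)) F = L2_set b ((\<lambda>k. k - j) ` F)"
      unfolding L2_set_def by (subst sum.reindex) (auto simp: inj_on_def)
    then show ?thesis using b assms(1) by simp
  qed
  have "L2_set (\<lambda>k. \<Sum>j\<in>G. a j * b (k - j)) F \<le> (\<Sum>j\<in>G. L2_set (\<lambda>k. a j * b (k - j)) F)"
    by (rule L2_set_sum_le[OF assms(2)])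
  also have "\<dots> = (\<Sum>j\<in>G. a j * L2_set (\<lambda>k. b (k - j)) F)"
    by (simp add: L2_set_right_distrib assms(3))
  also have "\<dots> \<le> (\<Sum>j\<in>G. a j * B)"
    by (intro sum_mono mult_left_mono shift assms(3))
  also have "\<dots> = (\<Sum>j\<in>G. a j) * B" by (simp add: sum_distrib_right)
  also have "\<dots> \<le> A * B"
    using b[of "{}"] by (intro mult_right_mono a) simp
  finally show ?thesis .
qed

text \<open>After splitting the weight, each half is a summable sequence convolved with a weighted
  square summable one, and Young's inequality applies. The result is tame: each norm of order
  \<open>r\<close> is multiplied only by an absolute sum of the other factor.\<close>

lemma hb_convolution:
  assumes conv: "\<And>k. ((\<lambda>j. a j * b (k - j)) has_sum c k) UNIV"
    and a1: "\<And>F. finite F \<Longrightarrow> (\<Sum>k\<in>F. cmod (a k)) \<le> A1"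
    and b1: "\<And>F. finite F \<Longrightarrow> (\<Sum>k\<in>F. cmod (b k)) \<le> B1"
    and ha: "hb r a A" and hb: "hb r b B"
  shows "hb r c (2 ^ r * (A1 * B + B1 * A))"
  unfolding hb_def
proof (intro allI impI)
  fix F :: "(int \<times> int) set" assume F: "finite F"
  let ?K = "2 ^ r * (A1 * B + B1 * A)"
  have fin: "L2_set (\<lambda>k. rho k ^ r * cmod (\<Sum>j\<in>G. a j * b (k - j))) F \<le> ?K" if G: "finite G" for G
  proof -
    let ?al = "\<lambda>j. rho j ^ r * cmod (a j)" and ?be = "\<lambda>j. rho j ^ r * cmod (b j)"
    \<comment> \<open>In the second half the roles of the factors are exchanged by substituting
      \<open>k - j\<close> for the summation index; \<open>G'\<close> collects the new indices for
      all \<open>k\<close> in \<open>F\<close>.\<close>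
    define G' where "G' = (\<Union>k\<in>F. (\<lambda>j. k - j) ` G)"
    have G': "finite G'" using F G by (simp add: G'_def)
    have le: "rho k ^ r * cmod (\<Sum>j\<in>G. a j * b (k - j))
        \<le> 2 ^ r * ((\<Sum>j\<in>G. cmod (a j) * ?be (k - j)) + (\<Sum>j\<in>G'. cmod (b j) * ?al (k - j)))"
      if k: "k \<in> F" for k
    proof -
      have "rho k ^ r * cmod (\<Sum>j\<in>G. a j * b (k - j)) \<le> rho k ^ r * (\<Sum>j\<in>G. cmod (a j) * cmod (b (k - j)))"
        by (intro mult_left_mono) (simp_all add: sum_norm_le norm_mult)
      also have "\<dots> = (\<Sum>j\<in>G. rho k ^ r * (cmod (a j) * cmod (b (k - j))))"
        by (rule sum_distrib_left)
      also have "\<dots> \<le> (\<Sum>j\<in>G. 2 ^ r * (rho j ^ r + rho (k - j) ^ r) * (cmod (a j) * cmod (b (k - j))))"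
        by (intro sum_mono mult_right_mono rho_power_split) simp
      also have "\<dots> = 2 ^ r * ((\<Sum>j\<in>G. cmod (a j) * ?be (k - j)) + (\<Sum>j\<in>G. cmod (b (k - j)) * ?al j))"
        by (simp add: sum_distrib_left algebra_simps flip: sum.distrib)
      also have "(\<Sum>j\<in>G. cmod (b (k - j)) * ?al j) = (\<Sum>j\<in>(\<lambda>j. k - j) ` G. cmod (b j) * ?al (k - j))"
        by (subst sum.reindex) (auto simp: inj_on_def)
      also have "\<dots> \<le> (\<Sum>j\<in>G'. cmod (b j) * ?al (k - j))"
        using G' k by (intro sum_mono2) (auto simp: G'_def)
      finally show ?thesis by simp
    qed
    have "L2_set (\<lambda>k. rho k ^ r * cmod (\<Sum>j\<in>G. a j * b (k - j))) F
        \<le> L2_set (\<lambda>k. 2 ^ r * ((\<Sum>j\<in>G. cmod (a j) * ?be (k - j)) + (\<Sum>j\<in>G'. cmod (b j) * ?al (k - j)))) F"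
      by (intro L2_set_mono le) auto
    also have "\<dots> = 2 ^ r * L2_set (\<lambda>k. (\<Sum>j\<in>G. cmod (a j) * ?be (k - j)) + (\<Sum>j\<in>G'. cmod (b j) * ?al (k - j))) F"
      by (rule L2_set_right_distrib[symmetric]) simp
    also have "\<dots> \<le> 2 ^ r * (L2_set (\<lambda>k. \<Sum>j\<in>G. cmod (a j) * ?be (k - j)) F
        + L2_set (\<lambda>k. \<Sum>j\<in>G'. cmod (b j) * ?al (k - j)) F)"
      by (intro mult_left_mono L2_set_triangle_ineq) simp
    also have "\<dots> \<le> ?K"
      by (intro mult_left_mono add_mono young_finite F G G' a1 b1 hb_D[OF ha] hb_D[OF hb]) auto
    finally show ?thesis .
  qed
  \<comment> \<open>For fixed finite \<open>F\<close> the norm depends continuously on finitely many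
    convolution sums, so the bound for partial sums passes to the limit.\<close>
  have "((\<lambda>G. L2_set (\<lambda>k. rho k ^ r * cmod (\<Sum>j\<in>G. a j * b (k - j))) F)
      \<longlongrightarrow> L2_set (\<lambda>k. rho k ^ r * cmod (c k)) F) (finite_subsets_at_top UNIV)"
    unfolding L2_set_def using conv by (intro tendsto_intros) (simp add: has_sum_def)
  moreover have "\<forall>\<^sub>F G in finite_subsets_at_top UNIV.
      L2_set (\<lambda>k. rho k ^ r * cmod (\<Sum>j\<in>G. a j * b (k - j))) F \<le> ?K"
    using fin by (intro eventually_finite_subsets_at_top_weakI)
  ultimately show "L2_set (\<lambda>k. rho k ^ r * cmod (c k)) F \<le> ?K"
    by (intro tendsto_upperbound) auto
qed

section \<open>Sobolev norms\<close>

context torus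
begin

lemma in_L2_product:
  assumes u: "in_L2 L u" "hb 2 (fc u) A2" and w: "in_L2 L w"
  shows "in_L2 L (\<lambda>z. u z * w z)"
proof -
  have "AE z in M. \<bar>u z\<bar> \<le> 4 * A2"
    by (rule AE_bound_of_fc[OF u(1) hb_imp_absolutely_bounded[OF u(2)]])
  from in_L2_mult_bounded[OF w in_L2_D(1,2)[OF u(1)] this] show ?thesis
    by (simp add: mult.commute)
qed

text \<open>The tame product estimate. The numbers \<open>4 * A2\<close> and \<open>4 * B2\<close>
  bound the absolute sums of the coefficients, which is how the algebra property of order two
  enters.\<close>

lemma hb_product:
  assumes u: "in_L2 L u" "hb 2 (fc u) A2" "hb r (fc u) A"
    and w: "in_L2 L w" "hb 2 (fc w) B2" "hb r (fc w) B"
  shows "hb r (fc (\<lambda>z. u z * w z)) (2 ^ r * 4 * (A2 * B + B2 * A))"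
  using hb_convolution[OF fc_mult_has_sum[OF u(1) w(1)] hb_imp_absolutely_bounded[OF u(2)]
      hb_imp_absolutely_bounded[OF w(2)] u(3) w(3)]
  by (simp add: algebra_simps)

lemma integral_square: "in_L2 L u \<Longrightarrow> (\<integral>z. (u z)\<^sup>2 \<partial>M) = (L2_norm L u)\<^sup>2"
  by (simp add: L2_norm_def)

lemma L2_norm_nonneg: "0 \<le> L2_norm L u"
  by (simp add: L2_norm_def)

lemma hb_0_L2_norm:
  assumes "in_L2 L u"
  shows "hb 0 (fc u) (L2_norm L u / L)"
proof -
  have "(\<Sum>k\<in>F. (cmod (fc u k))\<^sup>2) \<le> (L2_norm L u / L)\<^sup>2" if "finite F" for F
    using bessel[OF assms that] L_pos
    by (simp add: integral_square[OF assms] power_divide field_simps)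
  then show ?thesis
    using L_pos by (simp add: hb_iff_sum_squares L2_norm_nonneg)
qed

lemma L2_norm_le_hb:
  assumes "in_L2 L u" "hb 0 (fc u) B"
  shows "L2_norm L u \<le> L * B"
proof -
  have "(\<integral>z. (u z)\<^sup>2 \<partial>M) \<le> L\<^sup>2 * B\<^sup>2"
    using assms hb_nonneg[OF assms(2)] by (intro parseval_le) (simp_all add: hb_iff_sum_squares)
  then have "(L2_norm L u)\<^sup>2 \<le> (L * B)\<^sup>2"
    by (simp add: integral_square[OF assms(1)] power_mult_distrib)
  then show ?thesis
    using L_pos hb_nonneg[OF assms(2)] by (intro power2_le_imp_le[of "L2_norm L u"]) auto
qed

section \<open>Smooth test functions and integration by parts\<close>

lemma test_fun_D:
  assumes "test_fun L \<phi>"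
  shows "periodic2 L \<phi>" "Ck_fun n \<phi>" "\<phi> differentiable (at z)" "in_L2 L \<phi>"
    "continuous_on UNIV (pd1 \<phi>)" "continuous_on UNIV (pd2 \<phi>)" "continuous_on UNIV \<phi>"
proof -
  show per: "periodic2 L \<phi>" and "Ck_fun n \<phi>" using assms by (auto simp: test_fun_def)
  have "Ck_fun (Suc 0) \<phi>" using assms unfolding test_fun_def by blast
  then show "\<phi> differentiable (at z)" "continuous_on UNIV (pd1 \<phi>)" "continuous_on UNIV (pd2 \<phi>)"
    by (cases z, auto)
  have cont: "continuous_on UNIV \<phi>"
    using \<open>Ck_fun (Suc 0) \<phi>\<close> by (rule Ck_fun_imp_continuous)
  then show "continuous_on UNIV \<phi>" .
  obtain B where "\<And>z. z \<in> square L \<Longrightarrow> norm (\<phi> z) \<le> B"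
    using continuous_bounded_M[OF cont] by blast
  then show "in_L2 L \<phi>"
    by (intro in_L2_bounded[where B = B] per continuous_measurable_M cont AE_I2) auto
qed

lemma test_fun_pd1:
  assumes "test_fun L \<phi>"
  shows "test_fun L (pd1 \<phi>)"
  unfolding test_fun_def
proof
  have per: "\<phi> (x + L, y) = \<phi> (x, y)" "\<phi> (x, y + L) = \<phi> (x, y)" for x y
    using test_fun_D(1)[OF assms] by (auto simp: periodic2_def)
  have d: "((\<lambda>r. \<phi> (r, y)) has_real_derivative pd1 \<phi> (x, y)) (at x)" for x y
    by (rule pd1_has_derivative[OF test_fun_D(3)[OF assms]])
  have "pd1 \<phi> (x + L, y) = pd1 \<phi> (x, y)" for x y
  proof -
    have "((\<lambda>r. \<phi> (r + L, y)) has_real_derivative pd1 \<phi> (x + L, y)) (at x)"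
      using d[of y "x + L"] by (simp add: DERIV_shift)
    then show ?thesis
      using DERIV_unique[OF d[of y x]] by (simp add: per)
  qed
  moreover have "pd1 \<phi> (x, y + L) = pd1 \<phi> (x, y)" for x y
    by (simp add: pd1_def per)
  ultimately show "periodic2 L (pd1 \<phi>)"
    by (simp add: periodic2_def)
  show "\<forall>n. Ck_fun n (pd1 \<phi>)"
  proof
    fix n
    have "Ck_fun (Suc n) \<phi>" by (rule test_fun_D(2)[OF assms])
    then show "Ck_fun n (pd1 \<phi>)" by simp
  qed
qed

lemma test_fun_pd2:
  assumes "test_fun L \<phi>"
  shows "test_fun L (pd2 \<phi>)"
  unfolding test_fun_def
proof
  have per: "\<phi> (x + L, y) = \<phi> (x, y)" "\<phi> (x, y + L) = \<phi> (x, y)" for x y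
    using test_fun_D(1)[OF assms] by (auto simp: periodic2_def)
  have d: "((\<lambda>r. \<phi> (x, r)) has_real_derivative pd2 \<phi> (x, y)) (at y)" for x y
    by (rule pd2_has_derivative[OF test_fun_D(3)[OF assms]])
  have "pd2 \<phi> (x, y + L) = pd2 \<phi> (x, y)" for x y
  proof -
    have "((\<lambda>r. \<phi> (x, r + L)) has_real_derivative pd2 \<phi> (x, y + L)) (at y)"
      using d[of x "y + L"] by (simp add: DERIV_shift)
    then show ?thesis
      using DERIV_unique[OF d[of x y]] by (simp add: per)
  qed
  moreover have "pd2 \<phi> (x + L, y) = pd2 \<phi> (x, y)" for x y
    by (simp add: pd2_def per)
  ultimately show "periodic2 L (pd2 \<phi>)"
    by (simp add: periodic2_def)
  show "\<forall>n. Ck_fun n (pd2 \<phi>)"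
  proof
    fix n
    have "Ck_fun (Suc n) \<phi>" by (rule test_fun_D(2)[OF assms])
    then show "Ck_fun n (pd2 \<phi>)" by simp
  qed
qed

lemma Re_mult_eq_imp_eq:
  assumes "\<And>c. Re (c * x) = Re (c * y)"
  shows "x = y"
  using assms[of 1] assms[of "\<i>"] by (simp add: complex_eq_iff)

lemma integral_by_parts_pd1:
  assumes \<phi>: "test_fun L \<phi>" and \<psi>: "test_fun L \<psi>"
  shows "(\<integral>z. pd1 \<phi> z * \<psi> z \<partial>M) = - (\<integral>z. \<phi> z * pd1 \<psi> z \<partial>M)"
proof -
  let ?\<chi> = "\<lambda>z. \<phi> z * \<psi> z"
  have eq: "pd1 ?\<chi> = (\<lambda>z. pd1 \<phi> z * \<psi> z + \<phi> z * pd1 \<psi> z)"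
  proof (rule ext, clarify)
    fix x y
    have "((\<lambda>r. \<phi> (r, y) * \<psi> (r, y)) has_real_derivative
        pd1 \<phi> (x, y) * \<psi> (x, y) + \<phi> (x, y) * pd1 \<psi> (x, y)) (at x)"
      using DERIV_mult[OF pd1_has_derivative[of \<phi> y x, OF test_fun_D(3)[OF \<phi>]]
          pd1_has_derivative[of \<psi> y x, OF test_fun_D(3)[OF \<psi>]]]
      by (simp add: algebra_simps)
    then show "pd1 ?\<chi> (x, y) = pd1 \<phi> (x, y) * \<psi> (x, y) + \<phi> (x, y) * pd1 \<psi> (x, y)"
      by (simp add: pd1_def DERIV_imp_deriv)
  qed
  have "(\<integral>z. pd1 ?\<chi> z \<partial>M) = 0"
  proof (rule integral_pd1_zero)
    show "periodic2 L ?\<chi>"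
      using test_fun_D(1)[OF \<phi>] test_fun_D(1)[OF \<psi>] by (simp add: periodic2_def)
    show "?\<chi> differentiable (at z)" for z
      by (intro differentiable_mult test_fun_D(3) assms)
    show "continuous_on UNIV (pd1 ?\<chi>)"
      unfolding eq by (intro continuous_intros test_fun_D assms)
  qed
  moreover have "integrable M (\<lambda>z. pd1 \<phi> z * \<psi> z)" "integrable M (\<lambda>z. \<phi> z * pd1 \<psi> z)"
    by (intro in_L2_integrable_mult test_fun_D(4) test_fun_pd1 assms)+
  ultimately show ?thesis
    unfolding eq by simp
qed

lemma integral_by_parts_pd2:
  assumes \<phi>: "test_fun L \<phi>" and \<psi>: "test_fun L \<psi>"
  shows "(\<integral>z. pd2 \<phi> z * \<psi> z \<partial>M) = - (\<integral>z. \<phi> z * pd2 \<psi> z \<partial>M)"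
proof -
  let ?\<chi> = "\<lambda>z. \<phi> z * \<psi> z"
  have eq: "pd2 ?\<chi> = (\<lambda>z. pd2 \<phi> z * \<psi> z + \<phi> z * pd2 \<psi> z)"
  proof (rule ext, clarify)
    fix x y
    have "((\<lambda>r. \<phi> (x, r) * \<psi> (x, r)) has_real_derivative
        pd2 \<phi> (x, y) * \<psi> (x, y) + \<phi> (x, y) * pd2 \<psi> (x, y)) (at y)"
      using DERIV_mult[OF pd2_has_derivative[of \<phi> x y, OF test_fun_D(3)[OF \<phi>]]
          pd2_has_derivative[of \<psi> x y, OF test_fun_D(3)[OF \<psi>]]]
      by (simp add: algebra_simps)
    then show "pd2 ?\<chi> (x, y) = pd2 \<phi> (x, y) * \<psi> (x, y) + \<phi> (x, y) * pd2 \<psi> (x, y)"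
      by (simp add: pd2_def DERIV_imp_deriv)
  qed
  have "(\<integral>z. pd2 ?\<chi> z \<partial>M) = 0"
  proof (rule integral_pd2_zero)
    show "periodic2 L ?\<chi>"
      using test_fun_D(1)[OF \<phi>] test_fun_D(1)[OF \<psi>] by (simp add: periodic2_def)
    show "?\<chi> differentiable (at z)" for z
      by (intro differentiable_mult test_fun_D(3) assms)
    show "continuous_on UNIV (pd2 ?\<chi>)"
      unfolding eq by (intro continuous_intros test_fun_D assms)
  qed
  moreover have "integrable M (\<lambda>z. pd2 \<phi> z * \<psi> z)" "integrable M (\<lambda>z. \<phi> z * pd2 \<psi> z)"
    by (intro in_L2_integrable_mult test_fun_D(4) test_fun_pd2 assms)+
  ultimately show ?thesis
    unfolding eq by simp
qed

lemma fc_pd1: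
  assumes "test_fun L \<phi>"
  shows "fc (pd1 \<phi>) k = freq * of_int (fst k) * \<i> * fc \<phi> k"
proof -
  have "L\<^sup>2 * Re (c * cnj (fc (pd1 \<phi>) k)) = L\<^sup>2 * Re (c * cnj (freq * of_int (fst k) * \<i> * fc \<phi> k))" for c
    using integral_by_parts_pd1[OF assms test_fun_re_wave, of c k]
    by (simp add: pd1_re_wave integral_mult_re_wave test_fun_D(4) test_fun_pd1 assms algebra_simps)
  then have "cnj (fc (pd1 \<phi>) k) = cnj (freq * of_int (fst k) * \<i> * fc \<phi> k)"
    using L_pos by (intro Re_mult_eq_imp_eq) simp
  then show ?thesis by (simp only: complex_cnj_cancel_iff)
qed

lemma fc_pd2:
  assumes "test_fun L \<phi>"
  shows "fc (pd2 \<phi>) k = freq * of_int (snd k) * \<i> * fc \<phi> k"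
proof -
  have "L\<^sup>2 * Re (c * cnj (fc (pd2 \<phi>) k)) = L\<^sup>2 * Re (c * cnj (freq * of_int (snd k) * \<i> * fc \<phi> k))" for c
    using integral_by_parts_pd2[OF assms test_fun_re_wave, of c k]
    by (simp add: pd2_re_wave integral_mult_re_wave test_fun_D(4) test_fun_pd2 assms algebra_simps)
  then have "cnj (fc (pd2 \<phi>) k) = cnj (freq * of_int (snd k) * \<i> * fc \<phi> k)"
    using L_pos by (intro Re_mult_eq_imp_eq) simp
  then show ?thesis by (simp only: complex_cnj_cancel_iff)
qed

lemma test_fun_pd:
  assumes "test_fun L \<phi>"
  shows "test_fun L (pd i j \<phi>)" and "fc (pd i j \<phi>) k = dsym i j k * fc \<phi> k"
proof -
  have 2: "test_fun L ((pd2 ^^ j) \<phi>) \<and>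
      fc ((pd2 ^^ j) \<phi>) k = (freq * of_int (snd k) * \<i>) ^ j * fc \<phi> k"
    by (induction j) (simp_all add: assms test_fun_pd2 fc_pd2)
  have "test_fun L ((pd1 ^^ i) ((pd2 ^^ j) \<phi>)) \<and>
      fc ((pd1 ^^ i) ((pd2 ^^ j) \<phi>)) k = (freq * of_int (fst k) * \<i>) ^ i * fc ((pd2 ^^ j) \<phi>) k"
    by (induction i) (simp_all add: 2 test_fun_pd1 fc_pd1)
  with 2 show "test_fun L (pd i j \<phi>)" "fc (pd i j \<phi>) k = dsym i j k * fc \<phi> k"
    by (simp_all add: pd_def dsym_def)
qed

section \<open>Weak derivatives as multipliers\<close>

lemma cnj_dsym: "cnj (dsym i j k) = (- 1) ^ (i + j) * dsym i j k"
proof -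
  have "cnj (dsym i j k) = (- 1 * (freq * of_int (fst k) * \<i>)) ^ i * (- 1 * (freq * of_int (snd k) * \<i>)) ^ j"
    by (simp add: dsym_def)
  also have "\<dots> = (- 1) ^ (i + j) * dsym i j k"
    unfolding power_mult_distrib power_add dsym_def by (simp only: ac_simps)
  finally show ?thesis .
qed

lemma dsym_uminus: "dsym i j (- k) = cnj (dsym i j k)"
  by (simp add: dsym_def)

text \<open>In one direction, real waves are admissible test functions and detect every coefficient.
  In the other, Parseval's identity turns both integrals with a given test function into sums over
  modes, which agree term by term because conjugating the symbol produces the sign of the
  integration by parts.\<close>

lemma has_weak_deriv_iff:
  "has_weak_deriv L i j u v \<longleftrightarrow> in_L2 L u \<and> in_L2 L v \<and> (\<forall>k. fc v k = dsym i j k * fc u k)"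
proof (intro iffI; (elim conjE)?)
  assume *: "has_weak_deriv L i j u v"
  then have u: "in_L2 L u" and v: "in_L2 L v" by (auto simp: has_weak_deriv_def)
  have "fc v k = dsym i j k * fc u k" for k
  proof -
    have "Re (c * cnj (fc v k)) = Re (c * cnj (dsym i j k * fc u k))" for c
    proof -
      have "L\<^sup>2 * Re (dsym i j k * c * cnj (fc u k)) = (- 1) ^ (i + j) * (L\<^sup>2 * Re (c * cnj (fc v k)))"
      proof -
        have "(\<integral>z. u z * pd i j (re_wave c k) z \<partial>M) = (- 1) ^ (i + j) * (\<integral>z. v z * re_wave c k z \<partial>M)"
          using * test_fun_re_wave[of c k] unfolding has_weak_deriv_def by blast
        then show ?thesis
          by (simp only: pd_re_wave integral_mult_re_wave[OF u] integral_mult_re_wave[OF v])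
      qed
      then have "Re (dsym i j k * c * cnj (fc u k)) = (- 1) ^ (i + j) * Re (c * cnj (fc v k))"
        using L_pos by simp
      then have "(- 1) ^ (i + j) * Re (dsym i j k * c * cnj (fc u k)) = Re (c * cnj (fc v k))"
        by (simp add: minus_one_power_iff)
      moreover have "(- 1) ^ (i + j) * Re x = Re ((- 1) ^ (i + j) * x)" for x
        by (simp add: minus_one_power_iff)
      moreover have "c * cnj (dsym i j k * fc u k) = (- 1) ^ (i + j) * (dsym i j k * c * cnj (fc u k))"
        unfolding complex_cnj_mult cnj_dsym by (simp only: ac_simps)
      ultimately show ?thesis by (simp only:)
    qed
    then have "cnj (fc v k) = cnj (dsym i j k * fc u k)" by (rule Re_mult_eq_imp_eq)
    then show ?thesis by (simp only: complex_cnj_cancel_iff)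
  qed
  with u v show "in_L2 L u \<and> in_L2 L v \<and> (\<forall>k. fc v k = dsym i j k * fc u k)" by blast
next
  assume u: "in_L2 L u" and v: "in_L2 L v" and eq: "\<forall>k. fc v k = dsym i j k * fc u k"
  show "has_weak_deriv L i j u v"
    unfolding has_weak_deriv_def
  proof (intro conjI u v allI impI)
    fix \<phi> assume \<phi>: "test_fun L \<phi>"
    have "fc u k * cnj (fc (pd i j \<phi>) k) = (- 1) ^ (i + j) * (fc v k * cnj (fc \<phi> k))" for k
      using eq unfolding test_fun_pd(2)[OF \<phi>] complex_cnj_mult cnj_dsym by (simp only: ac_simps)
    then have "((\<lambda>k. (- 1) ^ (i + j) * (fc v k * cnj (fc \<phi> k))) has_sum
        of_real ((\<integral>z. u z * pd i j \<phi> z \<partial>M) / L\<^sup>2)) UNIV"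
      using parseval_bilinear[OF u test_fun_D(4)[OF test_fun_pd(1)[OF \<phi>, of i j]]] by (simp only:)
    moreover have "((\<lambda>k. (- 1) ^ (i + j) * (fc v k * cnj (fc \<phi> k))) has_sum
        (- 1) ^ (i + j) * of_real ((\<integral>z. v z * \<phi> z \<partial>M) / L\<^sup>2)) UNIV"
      by (intro has_sum_cmult_right parseval_bilinear v test_fun_D(4)[OF \<phi>])
    ultimately have "complex_of_real ((\<integral>z. u z * pd i j \<phi> z \<partial>M) / L\<^sup>2) =
        (- 1) ^ (i + j) * of_real ((\<integral>z. v z * \<phi> z \<partial>M) / L\<^sup>2)"
      by (rule has_sum_unique)
    then have "complex_of_real ((\<integral>z. u z * pd i j \<phi> z \<partial>M) / L\<^sup>2) =
        of_real ((- 1) ^ (i + j) * ((\<integral>z. v z * \<phi> z \<partial>M) / L\<^sup>2))"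
      by simp
    then have "(\<integral>z. u z * pd i j \<phi> z \<partial>M) / L\<^sup>2 = (- 1) ^ (i + j) * ((\<integral>z. v z * \<phi> z \<partial>M) / L\<^sup>2)"
      by (simp only: of_real_eq_iff)
    then show "(\<integral>z. u z * pd i j \<phi> z \<partial>M) = (- 1) ^ (i + j) * (\<integral>z. v z * \<phi> z \<partial>M)"
      using L_pos by (simp add: field_simps)
  qed
qed

lemma weak_deriv_props:
  assumes "has_weak_deriv L i j u v"
  shows "in_L2 L (weak_deriv L i j u)" "fc (weak_deriv L i j u) k = dsym i j k * fc u k"
proof -
  have "has_weak_deriv L i j u (weak_deriv L i j u)"
    unfolding weak_deriv_def by (rule someI[of "has_weak_deriv L i j u", OF assms])
  then show "in_L2 L (weak_deriv L i j u)" "fc (weak_deriv L i j u) k = dsym i j k * fc u k"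
    unfolding has_weak_deriv_iff by blast+
qed

lemma in_H_imp_in_L2:
  assumes "in_H L q u"
  shows "in_L2 L u"
proof -
  have "(0::nat) + 0 \<le> q" by simp
  then obtain v where "has_weak_deriv L 0 0 u v" using assms unfolding in_H_def by blast
  then show ?thesis by (simp add: has_weak_deriv_def)
qed

lemma norm_dsym_le:
  assumes "i + j \<le> q"
  shows "cmod (dsym i j k) \<le> (1 + freq) ^ q * rho k ^ q"
proof -
  have "cmod (dsym i j k) = (freq * \<bar>of_int (fst k)\<bar>) ^ i * (freq * \<bar>of_int (snd k)\<bar>) ^ j"
    using freq_pos by (simp add: dsym_def norm_mult norm_power)
  also have "\<dots> \<le> ((1 + freq) * rho k) ^ i * ((1 + freq) * rho k) ^ j"
    using freq_pos by (intro mult_mono power_mono) (auto simp: rho_def)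
  also have "\<dots> = ((1 + freq) * rho k) ^ (i + j)" by (simp add: power_add)
  also have "\<dots> \<le> ((1 + freq) * rho k) ^ q"
  proof (rule power_increasing[OF assms])
    have "1 * 1 \<le> (1 + freq) * rho k"
      using freq_pos rho_ge_1[of k] by (intro mult_mono) auto
    then show "1 \<le> (1 + freq) * rho k" by simp
  qed
  finally show ?thesis by (simp add: power_mult_distrib)
qed

lemma finite_multi_indices: "finite {(i, j). i + j \<le> (q::nat)}"
  by (rule finite_subset[of _ "{..q} \<times> {..q}"]) auto

lemma L2_norm_weak_deriv_le_H_norm:
  assumes "i + j \<le> q"
  shows "L2_norm L (weak_deriv L i j u) \<le> H_norm L q u"
proof -
  let ?f = "\<lambda>(i, j). (L2_norm L (weak_deriv L i j u))\<^sup>2"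
  have "?f (i, j) \<le> sum ?f {(i, j). i + j \<le> q}"
    using assms by (intro member_le_sum finite_multi_indices) auto
  then show ?thesis
    unfolding H_norm_def by (intro real_le_rsqrt) simp
qed

definition sob_const :: "nat \<Rightarrow> real" where
  "sob_const q = 3 ^ q * (1 + 2 / freq ^ q) / L"

text \<open>The function and its two pure derivatives of order \<open>q\<close> already control the
  weight, because \<open>rho k\<close> is at most three times the maximum of 1 and the moduli of the
  two frequencies.\<close>

lemma hb_of_in_H:
  assumes "in_H L q u"
  shows "hb q (fc u) (sob_const q * H_norm L q u)"
proof -
  have wd: "hb 0 (\<lambda>k. dsym i j k * fc u k) (H_norm L q u / L)" if "i + j \<le> q" for i j
  proof -
    obtain v where v: "has_weak_deriv L i j u v" using assms \<open>i + j \<le> q\<close> unfolding in_H_def by blast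
    have "hb 0 (fc (weak_deriv L i j u)) (L2_norm L (weak_deriv L i j u) / L)"
      by (rule hb_0_L2_norm[OF weak_deriv_props(1)[OF v]])
    then show ?thesis
      using L2_norm_weak_deriv_le_H_norm[OF \<open>i + j \<le> q\<close>, of u] L_pos
      by (auto simp: weak_deriv_props(2)[OF v, abs_def] divide_right_mono elim: hb_mono)
  qed
  let ?H = "H_norm L q u / L"
  \<comment> \<open>Moduli are taken so that the three contributions add up without
    cancellation.\<close>
  let ?d = "\<lambda>k. of_real (cmod (dsym 0 0 k * fc u k)) +
      (of_real (1 / freq ^ q) * of_real (cmod (dsym q 0 k * fc u k)) +
       of_real (1 / freq ^ q) * of_real (cmod (dsym 0 q k * fc u k))) :: complex"
  have d: "hb 0 ?d (?H + (cmod (of_real (1 / freq ^ q)) * ?H + cmod (of_real (1 / freq ^ q)) * ?H))"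
    by (intro hb_add hb_cmult hb_cmod wd) auto
  have "hb q (fc u) (3 ^ q * (?H + (cmod (of_real (1 / freq ^ q)) * ?H + cmod (of_real (1 / freq ^ q)) * ?H)))"
  proof (rule hb_dominated[OF d])
    fix k
    let ?x = "\<bar>real_of_int (fst k)\<bar>" and ?y = "\<bar>real_of_int (snd k)\<bar>"
    let ?m = "max 1 (max ?x ?y)"
    have "rho k ^ q \<le> (3 * ?m) ^ q"
      by (intro power_mono) (auto simp: rho_def)
    also have "\<dots> = 3 ^ q * ?m ^ q" by (simp add: power_mult_distrib)
    also have "?m ^ q \<le> 1 + (?x ^ q + ?y ^ q)"
      by (simp add: max_def)
    finally have "rho k ^ q \<le> 3 ^ q * (1 + (?x ^ q + ?y ^ q))" by simp
    then have "rho k ^ q * cmod (fc u k) \<le> 3 ^ q * (1 + (?x ^ q + ?y ^ q)) * cmod (fc u k)"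
      by (intro mult_right_mono) auto
    also have "\<dots> = 3 ^ q * (rho k ^ 0 * cmod (?d k))"
    proof -
      have "?d k = of_real ((1 + (?x ^ q + ?y ^ q)) * cmod (fc u k))"
        using freq_pos by (simp add: dsym_def norm_mult norm_power power_mult_distrib distrib_right)
      then have "cmod (?d k) = (1 + (?x ^ q + ?y ^ q)) * cmod (fc u k)"
        by (simp only: norm_of_real) (simp add: abs_mult)
      then show ?thesis by simp
    qed
    finally show "rho k ^ q * cmod (fc u k) \<le> 3 ^ q * (rho k ^ 0 * cmod (?d k))" .
  qed simp
  moreover have "3 ^ q * (?H + (cmod (of_real (1 / freq ^ q)) * ?H + cmod (of_real (1 / freq ^ q)) * ?H))
      = sob_const q * H_norm L q u"
    using freq_pos L_pos by (simp add: sob_const_def norm_divide norm_power field_simps)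
  ultimately show ?thesis by simp
qed

lemma hb_deriv:
  assumes "hb q c B" "i + j \<le> q"
  shows "hb 0 (\<lambda>k. dsym i j k * c k) ((1 + freq) ^ q * B)"
proof (rule hb_dominated[OF assms(1)])
  fix k
  show "rho k ^ 0 * cmod (dsym i j k * c k) \<le> (1 + freq) ^ q * (rho k ^ q * cmod (c k))"
    using mult_right_mono[OF norm_dsym_le[OF assms(2), of k], of "cmod (c k)"]
    by (simp add: norm_mult mult.assoc)
qed (use freq_pos in simp)

text \<open>Multiplied by the symbol, the coefficients stay square summable and hermitian, so by
  Riesz-Fischer they belong to a real function.\<close>

lemma has_weak_deriv_of_hb:
  assumes u: "in_L2 L u" and hb: "hb q (fc u) B" and ij: "i + j \<le> q"
  shows "\<exists>v. has_weak_deriv L i j u v"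
proof -
  let ?c = "\<lambda>k. dsym i j k * fc u k"
  have herm: "hermitian ?c"
    by (simp add: hermitian_def dsym_uminus fc_uminus del: split_paired_All)
  have "\<And>F. finite F \<Longrightarrow> (\<Sum>k\<in>F. (cmod (?c k))\<^sup>2) \<le> ((1 + freq) ^ q * B)\<^sup>2"
    using hb_deriv[OF hb ij] hb_nonneg[OF hb_deriv[OF hb ij]] by (simp add: hb_iff_sum_squares)
  from riesz_fischer[OF herm this] obtain v where "in_L2 L v" "fc v = ?c"
    by blast
  then have "has_weak_deriv L i j u v" using u by (simp add: has_weak_deriv_iff)
  then show ?thesis by blast
qed

definition sob_const' :: "nat \<Rightarrow> real" where
  "sob_const' q = sqrt (card {(i, j). i + j \<le> q}) * (L * (1 + freq) ^ q)"

lemma in_H_of_hb: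
  assumes u: "in_L2 L u" and hb: "hb q (fc u) B"
  shows "in_H L q u" and "H_norm L q u \<le> sob_const' q * B"
proof -
  show "in_H L q u"
    unfolding in_H_def using has_weak_deriv_of_hb[OF u hb] by blast
  let ?K = "L * ((1 + freq) ^ q * B)"
  have K: "0 \<le> ?K" using L_pos freq_pos hb_nonneg[OF hb] by simp
  have "(L2_norm L (weak_deriv L i j u))\<^sup>2 \<le> ?K\<^sup>2" if ij: "i + j \<le> q" for i j
  proof -
    obtain v where v: "has_weak_deriv L i j u v" using has_weak_deriv_of_hb[OF u hb ij] by blast
    have "hb 0 (fc (weak_deriv L i j u)) ((1 + freq) ^ q * B)"
      using hb_deriv[OF hb ij] by (simp add: weak_deriv_props(2)[OF v, abs_def])
    from L2_norm_le_hb[OF weak_deriv_props(1)[OF v] this] show ?thesis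
      by (intro power_mono L2_norm_nonneg)
  qed
  then have "(\<Sum>(i, j)\<in>{(i, j). i + j \<le> q}. (L2_norm L (weak_deriv L i j u))\<^sup>2)
      \<le> of_nat (card {(i, j). i + j \<le> q}) * ?K\<^sup>2"
    by (intro sum_bounded_above) auto
  then have "H_norm L q u \<le> sqrt (of_nat (card {(i, j). i + j \<le> q}) * ?K\<^sup>2)"
    unfolding H_norm_def by (rule real_sqrt_le_mono)
  also have "\<dots> = sob_const' q * B"
    using K by (simp add: real_sqrt_mult sob_const'_def)
  finally show "H_norm L q u \<le> sob_const' q * B" .
qed

text \<open>Eigenvalues of minus the Laplacian.\<close>

definition lam :: "int \<times> int \<Rightarrow> real" where
  "lam k = freq\<^sup>2 * ((of_int (fst k))\<^sup>2 + (of_int (snd k))\<^sup>2)"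

lemma laplace_props:
  assumes "in_H L 2 u"
  shows "in_L2 L (laplace L u)" "fc (laplace L u) k = - of_real (lam k) * fc u k"
proof -
  obtain v w where v: "has_weak_deriv L 2 0 u v" and w: "has_weak_deriv L 0 2 u w"
    using assms unfolding in_H_def by (metis add.left_neutral add.right_neutral order_refl)
  show "in_L2 L (laplace L u)"
    unfolding laplace_def by (intro in_L2_add weak_deriv_props(1)[OF v] weak_deriv_props(1)[OF w])
  have "fc (laplace L u) k = dsym 2 0 k * fc u k + dsym 0 2 k * fc u k"
    unfolding laplace_def
    by (simp add: fc_add weak_deriv_props(1)[OF v] weak_deriv_props(1)[OF w]
        weak_deriv_props(2)[OF v] weak_deriv_props(2)[OF w])
  also have "\<dots> = - of_real (lam k) * fc u k"
    by (simp add: dsym_def lam_def power_mult_distrib algebra_simps)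
  finally show "fc (laplace L u) k = - of_real (lam k) * fc u k" .
qed

end

section \<open>The method on a single mode\<close>

text \<open>The constant is the minimum of the form on the unit sphere, which is attained by
  compactness and positive by assumption; homogeneity extends the bound to all vectors.\<close>

lemma quadratic_form_coercive:
  fixes D :: "nat \<Rightarrow> nat \<Rightarrow> real"
  assumes pos: "\<And>x :: nat \<Rightarrow> real. \<exists>i<n. x i \<noteq> 0 \<Longrightarrow> 0 < (\<Sum>i<n. \<Sum>j<n. x i * D i j * x j)"
  obtains c where "0 < c" "\<And>x :: nat \<Rightarrow> real. c * (\<Sum>i<n. (x i)\<^sup>2) \<le> (\<Sum>i<n. \<Sum>j<n. x i * D i j * x j)"
proof (cases "n = 0")
  case True
  then show ?thesis by (intro that[of 1]) auto
next
  case False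
  define Q where "Q x = (\<Sum>i<n. \<Sum>j<n. x i * D i j * x j)" for x :: "nat \<Rightarrow> real"
  define S where "S x = (\<Sum>i<n. (x i)\<^sup>2)" for x :: "nat \<Rightarrow> real"
  \<comment> \<open>Vectors are functions on all naturals. Freezing the coordinates from
    \<open>n\<close> on at zero puts the sphere into a product of compact sets.\<close>
  define P where "P = (\<Pi>\<^sub>E i\<in>UNIV. if i < n then {- 1..1::real} else {0})"
  define K where "K = P \<inter> {x. S x = 1}"
  have coord: "continuous_on A (\<lambda>x::nat \<Rightarrow> real. x i)" for A i
    by (rule continuous_on_subset[OF continuous_on_product_coordinates]) simp
  have "compactin (product_topology (\<lambda>i. euclidean) UNIV) P"
    unfolding P_def by (subst compactin_PiE) auto
  then have "compact P"
    by (simp add: euclidean_product_topology)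
  moreover have "closed {x. S x = 1}"
    unfolding S_def by (intro closed_Collect_eq continuous_intros coord)
  ultimately have "compact K"
    unfolding K_def by (rule compact_Int_closed)
  have memK: "x \<in> K" if "S x = 1" "\<And>i. \<not> i < n \<Longrightarrow> x i = 0" for x
  proof -
    have "\<bar>x i\<bar> \<le> 1" if "i < n" for i
    proof -
      have "(x i)\<^sup>2 \<le> S x" unfolding S_def using that by (intro member_le_sum) auto
      then show ?thesis using \<open>S x = 1\<close> by (simp add: abs_square_le_1)
    qed
    then show ?thesis using that by (auto simp: K_def P_def abs_le_iff)
  qed
  have "(\<lambda>i. if i = 0 then 1 else 0) \<in> K"
    using False by (intro memK) (auto simp: S_def if_distrib[of "\<lambda>x. x\<^sup>2"] cong: if_cong)
  then have "K \<noteq> {}" by blast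
  have "continuous_on K Q"
    unfolding Q_def by (intro continuous_intros coord)
  then obtain x0 where x0: "x0 \<in> K" "\<And>x. x \<in> K \<Longrightarrow> Q x0 \<le> Q x"
    using continuous_attains_inf[OF \<open>compact K\<close> \<open>K \<noteq> {}\<close>] by blast
  have "S x0 = 1" using x0 by (simp add: K_def)
  then have "\<exists>i<n. x0 i \<noteq> 0"
    unfolding S_def by (metis (no_types, lifting) lessThan_iff power_zero_numeral sum.neutral zero_neq_one)
  then have "0 < Q x0" unfolding Q_def by (rule pos)
  moreover have "Q x0 * S x \<le> Q x" for x
  proof (cases "S x = 0")
    case True
    then have "\<And>i. i < n \<Longrightarrow> x i = 0" unfolding S_def by (simp add: sum_nonneg_eq_0_iff)
    then have "Q x = 0" by (simp add: Q_def)
    then show ?thesis using True by simp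
  next
    case False
    have S0: "0 < S x" using False unfolding S_def by (simp add: sum_nonneg order_less_le)
    define y where "y i = (if i < n then x i / sqrt (S x) else 0)" for i
    have "S y = (\<Sum>i<n. (x i)\<^sup>2 / S x)"
      unfolding S_def[of y] y_def using S0 by (intro sum.cong) (auto simp: power_divide)
    also have "\<dots> = 1" using S0 by (simp add: S_def flip: sum_divide_distrib)
    finally have "y \<in> K" by (intro memK) (auto simp: y_def)
    then have "Q x0 \<le> Q y" by (rule x0)
    also have "Q y = (\<Sum>i<n. \<Sum>j<n. (x i * D i j * x j) / S x)"
      unfolding Q_def y_def using S0 by (intro sum.cong refl) auto
    also have "\<dots> = Q x / S x" by (simp add: Q_def sum_divide_distrib)
    finally show ?thesis using S0 by (simp add: field_simps)
  qed
  ultimately show ?thesis using that[of "Q x0"] by (simp add: Q_def S_def)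
qed

text \<open>The skew part of \<open>D\<close> contributes nothing to the quadratic form, so the form
  of the symmetric part is that of \<open>D\<close> itself.\<close>

lemma pos_def_sum:
  assumes D: "D \<in> carrier_mat n n" and pd: "pos_def D" and x: "\<exists>i<n. x i \<noteq> 0"
  shows "0 < (\<Sum>i<n. \<Sum>j<n. x i * D $$ (i, j) * x j)"
proof -
  define S where "S = (1 / 2) \<cdot>\<^sub>m (D + transpose_mat D)"
  define v where "v = Matrix.vec n x"
  have v: "v \<in> carrier_vec n" "v \<noteq> 0\<^sub>v n"
  proof -
    show "v \<in> carrier_vec n" by (simp add: v_def)
    obtain i where i: "i < n" "x i \<noteq> 0" using x by blast
    then have "vec_index v i \<noteq> vec_index (0\<^sub>v n) i" by (simp add: v_def)
    then show "v \<noteq> 0\<^sub>v n" by blast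
  qed
  have "0 < scalar_prod v (mult_mat_vec S v)"
    using pd v D unfolding pos_def_def S_def by (simp add: Let_def)
  also have "scalar_prod v (mult_mat_vec S v) = (\<Sum>i<n. x i * (\<Sum>j<n. (D $$ (i, j) + D $$ (j, i)) / 2 * x j))"
    using D unfolding S_def v_def
    by (simp add: scalar_prod_def atLeast0LessThan)
  also have "\<dots> = ((\<Sum>i<n. \<Sum>j<n. x i * D $$ (i, j) * x j) + (\<Sum>i<n. \<Sum>j<n. x i * D $$ (j, i) * x j)) / 2"
    by (simp add: sum_distrib_left sum_divide_distrib sum.distrib[symmetric] add_divide_distrib algebra_simps)
  also have "(\<Sum>i<n. \<Sum>j<n. x i * D $$ (j, i) * x j) = (\<Sum>i<n. \<Sum>j<n. x i * D $$ (i, j) * x j)"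
    by (subst sum.swap) (simp add: ac_simps)
  finally show ?thesis by simp
qed

text \<open>A nonzero determinant excludes the value \<open>None\<close>, so that \<open>the\<close>
  denotes a genuine inverse.\<close>

lemma mat_inverse_exists:
  assumes "A \<in> carrier_mat n n" "Determinant.det A \<noteq> (0::real)"
  shows "the (mat_inverse A) \<in> carrier_mat n n" "A * the (mat_inverse A) = 1\<^sub>m n"
    "the (mat_inverse A) * A = 1\<^sub>m n"
proof -
  have "mat_inverse A \<noteq> None"
    using mat_inverse(1)[OF assms(1), where b = "()"] det_non_zero_imp_unit[OF assms, where b = "()"] by blast
  then obtain B where "mat_inverse A = Some B" by blast
  with mat_inverse(2)[OF assms(1) this]
  show "the (mat_inverse A) \<in> carrier_mat n n" "A * the (mat_inverse A) = 1\<^sub>m n"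
    "the (mat_inverse A) * A = 1\<^sub>m n" by auto
qed

lemma mult_mat_index:
  assumes "A \<in> carrier_mat n n" "B \<in> carrier_mat n n" "i < n" "j < n"
  shows "(A * B) $$ (i, j) = (\<Sum>l<n. A $$ (i, l) * B $$ (l, j))"
  using assms by (simp add: scalar_prod_def atLeast0LessThan)

text \<open>\<open>D\<close> is the product of \<open>B\<close>, the inverse of \<open>?A\<close>,
  with \<open>?E\<close>, and its inverse \<open>X\<close> satisfies \<open>?E * X = ?A\<close>.
  Coercivity comes from \<open>D\<close>. The positive diagonal coefficients, needed to solve each
  stage, come from \<open>X\<close>, since a positive definite matrix has a positive
  diagonal.\<close>

lemma method_matrices:
  assumes meth: "RIERK_method s a" and pd: "pos_def (D_R s a)" "pos_def (the (mat_inverse (D_R s a)))"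
  obtains B :: "nat \<Rightarrow> nat \<Rightarrow> real" and D c where
    "0 < c"
    "\<forall>x :: nat \<Rightarrow> real. c * (\<Sum>i<s - 1. (x i)\<^sup>2) \<le> (\<Sum>i<s - 1. \<Sum>j<s - 1. x i * D i j * x j)"
    "\<forall>i<s - 1. \<forall>j<s - 1. D i j = (\<Sum>l<s - 1. B i l * (if j \<le> l then 1 else 0))"
    "\<forall>i<s - 1. \<forall>j<s - 1.
      (\<Sum>l<s - 1. B i l * (if j \<le> l then a (l + 2) (j + 1) else 0)) = (if i = j then 1 else 0)"
    "\<forall>i<s - 1. 0 < a (i + 2) (i + 1)"
proof -
  define n where "n = s - 1"
  let ?A = "A_E s a" and ?E = "E_mat n"
  define B where "B = the (mat_inverse ?A)"
  define D where "D = D_R s a"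
  define X where "X = the (mat_inverse D)"
  have A: "?A \<in> carrier_mat n n" and E: "?E \<in> carrier_mat n n"
    by (simp_all add: A_E_def E_mat_def n_def)
  have Aij: "?A $$ (i, j) = (if j \<le> i then a (i + 2) (j + 1) else 0)" if "i < n" "j < n" for i j
    using that by (simp add: A_E_def n_def)
  have Eij: "?E $$ (i, j) = (if j \<le> i then 1 else 0)" if "i < n" "j < n" for i j
    using that by (simp add: E_mat_def)
  have "a (i + 2) (i + 1) \<noteq> 0" if "i < n" for i
  proof -
    have "i + 1 \<in> {1..s - 1}" using that by (auto simp: n_def)
    then have "a (i + 1 + 1) (i + 1) \<noteq> 0" using meth unfolding RIERK_method_def by blast
    then show ?thesis by simp
  qed
  then have "prod_list (diag_mat ?A) \<noteq> 0"
    using A by (auto simp: prod_list_zero_iff diag_mat_def Aij)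
  then have detA: "Determinant.det ?A \<noteq> 0"
    by (subst det_lower_triangular[OF _ A]) (auto simp: Aij)
  have "prod_list (diag_mat ?E) \<noteq> 0"
    using E by (auto simp: prod_list_zero_iff diag_mat_def Eij)
  then have detE: "Determinant.det ?E \<noteq> 0"
    by (subst det_lower_triangular[OF _ E]) (auto simp: Eij)
  note Bp = mat_inverse_exists[OF A detA, folded B_def]
  have D_eq: "D = B * ?E" by (simp add: D_def D_R_def B_def n_def)
  have D: "D \<in> carrier_mat n n" using Bp(1) E by (simp add: D_eq)
  have "Determinant.det ?A * Determinant.det B = Determinant.det (1\<^sub>m n)"
    using det_mult[OF A Bp(1)] Bp(2) by simp
  then have "Determinant.det B \<noteq> 0" by auto
  then have detD: "Determinant.det D \<noteq> 0"
    using det_mult[OF Bp(1) E] detE by (simp add: D_eq)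
  note Xp = mat_inverse_exists[OF D detD, folded X_def]
  have "?A * D = ?A * B * ?E"
    unfolding D_eq using A Bp(1) E by (intro assoc_mult_mat[symmetric])
  also have "\<dots> = ?E" using Bp(2) E by simp
  finally have AD: "?A * D = ?E" .
  have "?E * X = ?A * (D * X)"
    unfolding AD[symmetric] using A D Xp(1) by (intro assoc_mult_mat)
  also have "\<dots> = ?A" using Xp(2) A by simp
  finally have EX: "?E * X = ?A" .
  from quadratic_form_coercive[of n "\<lambda>i j. D $$ (i, j)", OF pos_def_sum[OF D pd(1)[folded D_def]]]
  obtain c where c: "0 < c" "\<And>x :: nat \<Rightarrow> real. c * (\<Sum>i<n. (x i)\<^sup>2) \<le> (\<Sum>i<n. \<Sum>j<n. x i * D $$ (i, j) * x j)"
    by blast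
  have Xdiag: "0 < a (i + 2) (i + 1)" if i: "i < n" for i
  proof -
    \<comment> \<open>Multiplication by \<open>?E\<close> from the left forms partial sums down the
      columns. A diagonal entry of \<open>X\<close> is thus the difference of two entries of
      \<open>?A\<close>, of which the one above the diagonal is zero; in the first row there is
      nothing to subtract.\<close>
    have cum: "(\<Sum>l\<le>m. X $$ (l, i)) = ?A $$ (m, i)" if "m < n" for m
    proof -
      have "?A $$ (m, i) = (\<Sum>l<n. (if l \<le> m then 1 else 0) * X $$ (l, i))"
        unfolding EX[symmetric] mult_mat_index[OF E Xp(1) that i]
        using that by (intro sum.cong) (auto simp: Eij)
      also have "\<dots> = (\<Sum>l\<in>{..<n} \<inter> {..m}. X $$ (l, i))"
        by (subst sum.inter_restrict) (auto intro!: sum.cong)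
      also have "{..<n} \<inter> {..m} = {..m}" using that by auto
      finally show ?thesis by simp
    qed
    let ?e = "\<lambda>j. if j = i then 1 else 0 :: real"
    have inner: "(\<Sum>j<n. ?e k * X $$ (k, j) * ?e j) = (if k = i then X $$ (i, i) else 0)" for k
    proof -
      have "(\<Sum>j<n. ?e k * X $$ (k, j) * ?e j) = (\<Sum>j<n. if j = i then ?e k * X $$ (k, i) else 0)"
        by (intro sum.cong) auto
      then show ?thesis using i by simp
    qed
    have "\<exists>j<n. ?e j \<noteq> 0" using i by auto
    from pos_def_sum[OF Xp(1) pd(2)[folded D_def, folded X_def] this]
    have "0 < X $$ (i, i)" unfolding inner using i by simp
    also have "X $$ (i, i) = a (i + 2) (i + 1)"
    proof (cases i)
      case 0
      then show ?thesis using cum[OF i] Aij[OF i i] by simp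
    next
      case (Suc m)
      then have "(\<Sum>l\<le>m. X $$ (l, i)) = 0" "(\<Sum>l\<le>m. X $$ (l, i)) + X $$ (i, i) = a (i + 2) (i + 1)"
        using cum[of m] cum[OF i] Aij[of m i] Aij[OF i i] i by simp_all
      then show ?thesis by simp
    qed
    finally show ?thesis .
  qed
  show ?thesis
  proof (rule that[of c "\<lambda>i j. D $$ (i, j)" "\<lambda>i j. B $$ (i, j)"])
    show "0 < c" by (rule c)
    show "\<forall>x :: nat \<Rightarrow> real. c * (\<Sum>i<s - 1. (x i)\<^sup>2) \<le> (\<Sum>i<s - 1. \<Sum>j<s - 1. x i * D $$ (i, j) * x j)"
      using c(2) by (simp add: n_def)
    show "\<forall>i<s - 1. \<forall>j<s - 1. D $$ (i, j) = (\<Sum>l<s - 1. B $$ (i, l) * (if j \<le> l then 1 else 0))"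
      unfolding D_eq using mult_mat_index[OF Bp(1) E] by (simp add: n_def E_mat_def)
    show "\<forall>i<s - 1. \<forall>j<s - 1.
      (\<Sum>l<s - 1. B $$ (i, l) * (if j \<le> l then a (l + 2) (j + 1) else 0)) = (if i = j then 1 else 0)"
    proof (intro allI impI)
      fix i j assume ij: "i < s - 1" "j < s - 1"
      have "(B * ?A) $$ (i, j) = (\<Sum>l<n. B $$ (i, l) * (if j \<le> l then a (l + 2) (j + 1) else 0))"
        using ij mult_mat_index[OF Bp(1) A, of i j] by (simp add: n_def A_E_def)
      then show "(\<Sum>l<s - 1. B $$ (i, l) * (if j \<le> l then a (l + 2) (j + 1) else 0)) = (if i = j then 1 else 0)"
        using Bp(3) ij by (simp add: n_def)
    qed
    show "\<forall>i<s - 1. 0 < a (i + 2) (i + 1)"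
      using Xdiag by (simp add: n_def)
  qed
qed

section \<open>The scheme for one Fourier mode\<close>

locale rierk = torus +
  fixes \<epsilon> \<kappa> :: real and s :: nat and a :: "nat \<Rightarrow> nat \<Rightarrow> real"
  assumes eps_pos: "0 < \<epsilon>" and kappa_nonneg: "0 \<le> \<kappa>" and s_ge_2: "2 \<le> s"
    and rk_method: "RIERK_method s a"
    and pos_def_D: "pos_def (D_R s a)" and pos_def_D_inv: "pos_def (the (mat_inverse (D_R s a)))"
begin

text \<open>The scheme for a single Fourier mode: \<open>G\<close> stands for the nonlinear term, \<open>Z\<close> for
  the defects.\<close>

definition mode_sys :: "real \<Rightarrow> real \<Rightarrow> (nat \<Rightarrow> complex) \<Rightarrow> (nat \<Rightarrow> complex) \<Rightarrow> (nat \<Rightarrow> complex) \<Rightarrow> bool" where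
  "mode_sys \<tau> l V G Z \<longleftrightarrow> (\<forall>i\<in>{1..s-1}. V (i + 1) = V 1
     + of_real \<tau> * (\<Sum>j=1..i. of_real (a (i + 1) j) *
         (of_real (- l) * (of_real (\<epsilon>\<^sup>2 * l + \<kappa>) * ((V j + V (j + 1)) / 2) - G j)))
     + of_real \<tau> * Z i)"

lemma lam_nonneg: "0 \<le> lam k"
  using freq_pos by (simp add: lam_def)

lemma lam_le_rho: "lam k \<le> freq\<^sup>2 * rho k ^ 2"
proof -
  have "(of_int (fst k))\<^sup>2 + (of_int (snd k))\<^sup>2 \<le> (\<bar>of_int (fst k)\<bar> + \<bar>of_int (snd k)\<bar> :: real)\<^sup>2"
    by (simp add: power2_sum)
  also have "\<dots> \<le> rho k ^ 2"
    by (intro power_mono) (auto simp: rho_def)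
  finally show ?thesis unfolding lam_def by (intro mult_left_mono) auto
qed

lemma rho_sq_le: "rho k ^ 2 \<le> 3 * (1 + lam k / freq\<^sup>2)"
proof -
  have "(1 + x + y)\<^sup>2 \<le> 3 * (1 + (x\<^sup>2 + y\<^sup>2))" for x y :: real
  proof -
    have "0 \<le> (1 - x)\<^sup>2 + (1 - y)\<^sup>2 + (x - y)\<^sup>2" by simp
    then show ?thesis by (simp add: power2_eq_square algebra_simps)
  qed
  from this[of "\<bar>of_int (fst k)\<bar>" "\<bar>of_int (snd k)\<bar>"] show ?thesis
    using freq_pos by (simp add: rho_def lam_def)
qed

text \<open>The spectral gap: away from the constant mode the eigenvalue is at least
  \<open>freq\<^sup>2\<close> and may be divided by.\<close>

lemma one_le_lam:
  assumes "k \<noteq> 0"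
  shows "1 \<le> lam k / freq\<^sup>2"
proof -
  have "1 \<le> (fst k)\<^sup>2 + (snd k)\<^sup>2"
    using assms sum_power2_gt_zero_iff[of "fst k" "snd k"] by (auto simp: prod_eq_iff)
  then have "(1::real) \<le> of_int ((fst k)\<^sup>2 + (snd k)\<^sup>2)"
    by linarith
  then show ?thesis using freq_pos by (simp add: lam_def)
qed

end

context rierk
begin

text \<open>Solving for the implicit part of a stage divides by \<open>P = 1 + \<alpha> z / 2\<close>, where \<open>\<alpha> > 0\<close> is a
  diagonal entry of the inverse of \<^term>\<open>D_R s a\<close>; this dominates \<open>\<tau> * lam k\<close> and
  \<open>\<tau> * rho k ^ 2\<close>.\<close>

lemma stage_mode_bound:
  obtains C where "1 \<le> C"
    "\<And>\<tau> k V G Z i. 0 < \<tau> \<Longrightarrow> \<tau> \<le> 1 \<Longrightarrow> mode_sys \<tau> (lam k) V G Z \<Longrightarrow> i \<in> {1..s-1} \<Longrightarrow>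
      cmod (V (i + 1)) \<le> C * ((\<Sum>j=1..i. cmod (V j) + cmod (G j)) + cmod (Z i) / rho k ^ 2)"
proof -
  have diag': "0 < a (i + 2) (i + 1)" if "i < s - 1" for i
    using method_matrices[OF rk_method pos_def_D pos_def_D_inv] that by blast
  have diag: "0 < a (i + 1) i" if i: "i \<in> {1..s-1}" for i
  proof -
    obtain p where "i = Suc p" using i by (cases i) auto
    then show ?thesis using diag'[of p] i by simp
  qed
  define \<alpha>0 where "\<alpha>0 = Min ((\<lambda>i. a (i + 1) i) ` {1..s-1})"
  have ne: "{1..s-1} \<noteq> {}" using s_ge_2 by simp
  have \<alpha>0: "0 < \<alpha>0" and \<alpha>0_le: "\<And>i. i \<in> {1..s-1} \<Longrightarrow> \<alpha>0 \<le> a (i + 1) i"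
    using diag ne by (auto simp: \<alpha>0_def)
  define A0 where "A0 = (\<Sum>i=1..s-1. \<Sum>j=1..i. \<bar>a (i + 1) j\<bar>)"
  have A0: "\<bar>a (i + 1) j\<bar> \<le> A0" if "i \<in> {1..s-1}" "j \<in> {1..i}" for i j
  proof -
    have "\<bar>a (i + 1) j\<bar> \<le> (\<Sum>j=1..i. \<bar>a (i + 1) j\<bar>)"
      using that by (intro member_le_sum) auto
    also have "\<dots> \<le> A0"
      unfolding A0_def using that by (intro member_le_sum[of _ _ "\<lambda>i. \<Sum>j=1..i. \<bar>a (i + 1) j\<bar>"] sum_nonneg) auto
    finally show ?thesis .
  qed
  have A0_nonneg: "0 \<le> A0" unfolding A0_def by (intro sum_nonneg) auto
  \<comment> \<open>These constants bound \<open>z\<close>, \<open>\<tau> * l\<close> and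
    \<open>\<tau> * rho k ^ 2\<close>, in this order, by multiples of \<open>P\<close>.\<close>
  define K1 K2 K3 where "K1 = 2 / \<alpha>0" and "K2 = 1 + 2 / (\<alpha>0 * \<epsilon>\<^sup>2)" and "K3 = 3 * (1 + K2 / freq\<^sup>2)"
  have K: "0 \<le> K1" "0 \<le> K2" "0 \<le> K3"
    using \<alpha>0 by (simp_all add: K1_def K2_def K3_def)
  define C where "C = 1 + 2 * A0 * K1 + A0 * K2 + K3"
  show ?thesis
  proof (rule that[of C])
    show "1 \<le> C" unfolding C_def using K A0_nonneg by simp
    fix \<tau> k V G Z i
    assume \<tau>: "0 < \<tau>" "\<tau> \<le> (1::real)" and sys: "mode_sys \<tau> (lam k) V G Z" and i: "i \<in> {1..s-1}"
    define l where "l = lam k"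
    have l: "0 \<le> l" by (simp add: l_def lam_nonneg)
    define \<alpha> where "\<alpha> = a (i + 1) i"
    define z where "z = \<tau> * (l * (\<epsilon>\<^sup>2 * l + \<kappa>))"
    define P where "P = 1 + \<alpha> * z / 2"
    have \<alpha>: "\<alpha>0 \<le> \<alpha>" "\<alpha> \<le> A0" "0 < \<alpha>"
      using \<alpha>0_le[OF i] A0[OF i, of i] i \<alpha>0 by (auto simp: \<alpha>_def)
    have z0: "0 \<le> z" unfolding z_def using \<tau> l kappa_nonneg by simp
    have P1: "1 \<le> P" using \<alpha> z0 by (simp add: P_def)
    have "\<alpha>0 * z \<le> \<alpha> * z" using \<alpha> z0 by (intro mult_right_mono)
    also have "\<dots> \<le> 2 * P" by (simp add: P_def)
    finally have zP: "z \<le> K1 * P"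
      using \<alpha>0 by (simp add: K1_def field_simps)
    have "\<epsilon>\<^sup>2 * (\<tau> * l\<^sup>2) \<le> z"
      unfolding z_def using \<tau> l kappa_nonneg
      by (simp add: power2_eq_square algebra_simps)
    then have "\<alpha>0 * (\<epsilon>\<^sup>2 * (\<tau> * l\<^sup>2)) \<le> \<alpha>0 * z"
      using \<alpha>0 by (intro mult_left_mono) auto
    with \<open>\<alpha>0 * z \<le> \<alpha> * z\<close> \<open>\<alpha> * z \<le> 2 * P\<close> have "\<alpha>0 * \<epsilon>\<^sup>2 * (\<tau> * l\<^sup>2) \<le> 2 * P" by simp
    then have t2: "\<tau> * l\<^sup>2 \<le> 2 / (\<alpha>0 * \<epsilon>\<^sup>2) * P"
      using \<alpha>0 eps_pos by (simp add: field_simps)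
    \<comment> \<open>The first power of \<open>l\<close> is interpolated between 1 and its square.
      The lower end is bounded by \<open>P\<close> because \<open>\<tau> \<le> 1\<close>.\<close>
    have "2 * (\<tau> * l) \<le> \<tau> * (1 + l\<^sup>2)"
      using sum_squares_bound[of 1 l] \<tau> by (simp add: mult_left_mono mult.left_commute)
    also have "\<dots> \<le> P + 2 / (\<alpha>0 * \<epsilon>\<^sup>2) * P"
      using t2 \<tau> P1 by (simp add: distrib_left)
    finally have tl2: "2 * (\<tau> * l) \<le> K2 * P" by (simp add: K2_def distrib_right)
    then have tl: "\<tau> * l \<le> K2 * P" using \<tau> l by (smt (verit) mult_nonneg_nonneg)
    have "\<tau> * rho k ^ 2 \<le> \<tau> * (3 * (1 + l / freq\<^sup>2))"
      unfolding l_def using rho_sq_le \<tau> by (intro mult_left_mono) auto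
    also have "\<dots> = 3 * (\<tau> + \<tau> * l / freq\<^sup>2)" by (simp add: algebra_simps)
    also have "\<dots> \<le> 3 * (P + K2 * P / freq\<^sup>2)"
      using \<tau> P1 tl by (intro mult_left_mono add_mono divide_right_mono) auto
    also have "\<dots> = K3 * P" by (simp add: K3_def algebra_simps)
    finally have tr: "\<tau> * rho k ^ 2 \<le> K3 * P" .
    define SV where "SV = (\<Sum>j=1..i. cmod (V j))"
    define SG where "SG = (\<Sum>j=1..i. cmod (G j))"
    obtain m where m: "i = Suc m" using i by (cases i) auto
    \<comment> \<open>The sum stops at \<open>m = i - 1\<close>: the last midpoint contains the
      unknown \<open>V (i + 1)\<close> and is split off, to be solved for through
      \<open>P\<close>.\<close>
    define S1 where "S1 = (\<Sum>j=1..m. of_real (a (i + 1) j) * ((V j + V (j + 1)) / 2))"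
    define S2 where "S2 = (\<Sum>j=1..i. of_real (a (i + 1) j) * G j)"
    have S1: "cmod S1 \<le> A0 * SV"
    proof -
      have "cmod S1 \<le> (\<Sum>j=1..m. A0 * ((cmod (V j) + cmod (V (j + 1))) / 2))"
        unfolding S1_def
      proof (rule sum_norm_le)
        fix j assume "j \<in> {1..m}"
        then have "cmod (of_real (a (i + 1) j) * ((V j + V (j + 1)) / 2)) \<le> A0 * (cmod (V j + V (j + 1)) / 2)"
          using A0[OF i, of j] m by (simp add: norm_mult norm_divide mult_right_mono divide_right_mono)
        also have "\<dots> \<le> A0 * ((cmod (V j) + cmod (V (j + 1))) / 2)"
          using A0_nonneg by (intro mult_left_mono divide_right_mono norm_triangle_ineq) auto
        finally show "cmod (of_real (a (i + 1) j) * ((V j + V (j + 1)) / 2))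
            \<le> A0 * ((cmod (V j) + cmod (V (j + 1))) / 2)" .
      qed
      also have "\<dots> = A0 * (((\<Sum>j=1..m. cmod (V j)) + (\<Sum>j=1..m. cmod (V (j + 1)))) / 2)"
        by (simp only: sum_distrib_left[symmetric] sum_divide_distrib[symmetric] sum.distrib)
      also have "(\<Sum>j=1..m. cmod (V (j + 1))) = (\<Sum>j=2..i. cmod (V j))"
        unfolding m using sum.shift_bounds_cl_Suc_ivl[of "\<lambda>j. cmod (V j)" 1 m] by (simp add: numeral_2_eq_2)
      also have "A0 * (((\<Sum>j=1..m. cmod (V j)) + (\<Sum>j=2..i. cmod (V j))) / 2) \<le> A0 * ((SV + SV) / 2)"
        unfolding SV_def m using A0_nonneg
        by (intro mult_left_mono divide_right_mono add_mono sum_mono2) auto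
      finally show ?thesis by simp
    qed
    have S2: "cmod S2 \<le> A0 * SG"
    proof -
      have "cmod S2 \<le> (\<Sum>j=1..i. A0 * cmod (G j))"
        unfolding S2_def using A0[OF i]
        by (intro sum_norm_le) (simp add: norm_mult mult_right_mono)
      then show ?thesis by (simp add: SG_def sum_distrib_left)
    qed
    have V1: "cmod (V 1) \<le> SV" and Vi: "cmod (V i) \<le> SV"
      unfolding SV_def using i by (auto intro!: member_le_sum)
    have "V (i + 1) = V 1 + of_real \<tau> * (\<Sum>j=1..i. of_real (a (i + 1) j) *
         (of_real (- l) * (of_real (\<epsilon>\<^sup>2 * l + \<kappa>) * ((V j + V (j + 1)) / 2) - G j))) + of_real \<tau> * Z i"
      using sys i unfolding mode_sys_def l_def by blast
    also have "(\<Sum>j=1..i. of_real (a (i + 1) j) *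
         (of_real (- l) * (of_real (\<epsilon>\<^sup>2 * l + \<kappa>) * ((V j + V (j + 1)) / 2) - G j))) =
       of_real (- l * (\<epsilon>\<^sup>2 * l + \<kappa>)) * (\<Sum>j=1..i. of_real (a (i + 1) j) * ((V j + V (j + 1)) / 2))
       + of_real l * S2"
    proof -
      have "A * (- x * (y * q - g)) = - x * y * (A * q) + x * (A * g)" for A x y q g :: complex
        by (simp add: algebra_simps)
      then show ?thesis
        unfolding S2_def sum_distrib_left sum.distrib[symmetric]
        by (intro sum.cong refl) (simp only: of_real_mult of_real_minus)
    qed
    also have "(\<Sum>j=1..i. of_real (a (i + 1) j) * ((V j + V (j + 1)) / 2)) =
        S1 + of_real \<alpha> * ((V i + V (i + 1)) / 2)"
      by (simp add: S1_def \<alpha>_def m)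
    finally have eq: "V (i + 1) = V 1 + of_real \<tau> * (of_real (- l * (\<epsilon>\<^sup>2 * l + \<kappa>)) *
        (S1 + of_real \<alpha> * ((V i + V (i + 1)) / 2)) + of_real l * S2) + of_real \<tau> * Z i" .
    have "of_real P * V (i + 1) - (V 1 - of_real z * S1 - of_real (\<alpha> * z / 2) * V i
        + of_real (\<tau> * l) * S2 + of_real \<tau> * Z i) =
        V (i + 1) - (V 1 + of_real \<tau> * (of_real (- l * (\<epsilon>\<^sup>2 * l + \<kappa>)) *
        (S1 + of_real \<alpha> * ((V i + V (i + 1)) / 2)) + of_real l * S2) + of_real \<tau> * Z i)"
      by (simp add: P_def z_def field_simps)
    also have "\<dots> = 0"
      unfolding right_minus_eq by (rule eq)
    finally have "of_real P * V (i + 1) = V 1 - of_real z * S1 - of_real (\<alpha> * z / 2) * V i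
        + of_real (\<tau> * l) * S2 + of_real \<tau> * Z i"
      by simp
    then have "P * cmod (V (i + 1)) = cmod (V 1 - of_real z * S1 - of_real (\<alpha> * z / 2) * V i
        + of_real (\<tau> * l) * S2 + of_real \<tau> * Z i)"
      using P1 by (metis abs_of_nonneg norm_mult norm_of_real order_trans zero_le_one)
    also have "\<dots> \<le> cmod (V 1) + cmod (of_real z * S1) + cmod (of_real (\<alpha> * z / 2) * V i)
        + cmod (of_real (\<tau> * l) * S2) + cmod (of_real \<tau> * Z i)"
      by (intro order_trans[OF norm_triangle_ineq] add_mono order_trans[OF norm_triangle_ineq4] order_refl)
    also have "\<dots> = cmod (V 1) + z * cmod S1 + \<alpha> * z / 2 * cmod (V i) + \<tau> * l * cmod S2 + \<tau> * cmod (Z i)"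
      using z0 \<alpha> \<tau> l by (simp add: norm_mult)
    also have "\<dots> \<le> SV * P + K1 * P * (A0 * SV) + A0 * (K1 * P) * SV + K2 * P * (A0 * SG) + K3 * P * (cmod (Z i) / rho k ^ 2)"
    proof (intro add_mono)
      have SV0: "0 \<le> SV" and SG0: "0 \<le> SG" by (auto simp: SV_def SG_def sum_nonneg)
      show "cmod (V 1) \<le> SV * P" using V1 P1 SV0 by (metis mult.right_neutral mult_left_mono order_trans)
      show "z * cmod S1 \<le> K1 * P * (A0 * SV)" using zP S1 z0 K P1 by (intro mult_mono) auto
      have "\<alpha> * z / 2 \<le> \<alpha> * z" using \<alpha> z0 by simp
      also have "\<dots> \<le> A0 * (K1 * P)" using \<alpha> z0 zP A0_nonneg by (intro mult_mono) auto
      finally show "\<alpha> * z / 2 * cmod (V i) \<le> A0 * (K1 * P) * SV"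
        using Vi A0_nonneg K P1 by (intro mult_mono) auto
      show "\<tau> * l * cmod S2 \<le> K2 * P * (A0 * SG)" using K P1 by (intro mult_mono[OF tl S2]) auto
      have "\<tau> * cmod (Z i) = \<tau> * rho k ^ 2 * (cmod (Z i) / rho k ^ 2)"
        using rho_ge_1[of k] by simp
      also have "\<dots> \<le> K3 * P * (cmod (Z i) / rho k ^ 2)"
        by (intro mult_right_mono tr) auto
      finally show "\<tau> * cmod (Z i) \<le> K3 * P * (cmod (Z i) / rho k ^ 2)" .
    qed
    also have "\<dots> = P * ((1 + 2 * A0 * K1) * SV + A0 * K2 * SG + K3 * (cmod (Z i) / rho k ^ 2))"
      by (simp add: algebra_simps)
    also have "\<dots> \<le> P * (C * SV + C * SG + C * (cmod (Z i) / rho k ^ 2))"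
      using P1 K A0_nonneg
      by (intro mult_left_mono add_mono mult_right_mono) (auto simp: C_def SV_def SG_def sum_nonneg)
    finally have "cmod (V (i + 1)) \<le> C * SV + C * SG + C * (cmod (Z i) / rho k ^ 2)"
      using P1 by simp
    then show "cmod (V (i + 1)) \<le> C * ((\<Sum>j=1..i. cmod (V j) + cmod (G j)) + cmod (Z i) / rho k ^ 2)"
      by (simp add: SV_def SG_def sum.distrib distrib_left)
  qed
qed

text \<open>In differential form the stages satisfy \<open>D \<delta> = \<tau> (w + \<xi>)\<close> for the increments
  \<open>\<delta> j = V (j + 1) - V j\<close>. Testing with \<open>\<delta>\<close> telescopes the implicit midpoint terms, and
  coercivity of \<open>D\<close> absorbs the increments. Dividing by the square of the eigenvalue then
  costs no derivative of \<open>G\<close> and gains two derivatives for the defects.\<close>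

lemma energy_mode_bound:
  obtains C where "0 \<le> C"
    "\<And>\<tau> k V G Z. 0 < \<tau> \<Longrightarrow> \<tau> \<le> 1 \<Longrightarrow> mode_sys \<tau> (lam k) V G Z \<Longrightarrow>
      (cmod (V s))\<^sup>2 \<le> (1 + \<tau>) * (cmod (V 1))\<^sup>2
        + C * \<tau> * (\<Sum>j=1..s-1. (cmod (G j))\<^sup>2 + (cmod (Z j) / rho k ^ 2)\<^sup>2)"
proof -
  obtain B D c where c: "0 < c"
    and coer: "\<forall>x :: nat \<Rightarrow> real. c * (\<Sum>i<s - 1. (x i)\<^sup>2) \<le> (\<Sum>i<s - 1. \<Sum>j<s - 1. x i * D i j * x j)"
    and D: "\<forall>i<s - 1. \<forall>j<s - 1. D i j = (\<Sum>l<s - 1. B i l * (if j \<le> l then 1 else 0))"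
    and BA: "\<forall>i<s - 1. \<forall>j<s - 1.
      (\<Sum>l<s - 1. B i l * (if j \<le> l then a (l + 2) (j + 1) else 0)) = (if i = j then 1 else 0)"
    by (rule method_matrices[OF rk_method pos_def_D pos_def_D_inv], rule that)
  define n where "n = s - 1"
  have s: "s = n + 1" using s_ge_2 by (simp add: n_def)
  note coer = coer[folded n_def, rule_format] and D = D[folded n_def] and BA = BA[folded n_def]
  define b where "b = (\<Sum>i<n. \<Sum>l<n. (B i l)\<^sup>2)"
  have b: "0 \<le> b" by (simp add: b_def sum_nonneg)
  \<comment> \<open>The first two summands serve the modes with positive eigenvalue, the last one
    serves the constant mode.\<close>
  define C where "C = 1 / (c * \<epsilon>\<^sup>2) + 36 * b / (freq ^ 4 * c * \<epsilon>\<^sup>2) + 2 * real n * b / c\<^sup>2"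
  show ?thesis
  proof (rule that[of C])
    show "0 \<le> C" unfolding C_def using c b freq_pos by simp
    fix \<tau> k V G Z
    assume \<tau>: "0 < \<tau>" "\<tau> \<le> (1::real)" and sys: "mode_sys \<tau> (lam k) V G Z"
    define l where "l = lam k"
    have l: "0 \<le> l" by (simp add: l_def lam_nonneg)
    define \<beta> where "\<beta> = \<epsilon>\<^sup>2 * l + \<kappa>"
    \<comment> \<open>Matrix rows are numbered from 0 and stages from 1, so
      \<open>\<delta> j\<close> is the increment leaving stage \<open>j + 1\<close>.\<close>
    define \<delta> where "\<delta> j = V (j + 2) - V (j + 1)" for j
    define w where "w j = of_real (- l) * (of_real \<beta> * ((V (j + 1) + V (j + 2)) / 2) - G (j + 1))" for j
    define \<xi> where "\<xi> i = (\<Sum>p<n. of_real (B i p) * Z (p + 1))" for i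
    have part: "(\<Sum>j\<le>i. \<delta> j) = V (i + 2) - V 1" for i
      by (induction i) (simp_all add: \<delta>_def numeral_2_eq_2)
    \<comment> \<open>Each row of \<open>E_mat n\<close> sums increments and telescopes to the
      left-hand side of a stage equation. Applying \<open>B\<close>, the inverse of
      \<open>A_E s a\<close>, therefore produces \<open>D\<close> on the left and isolates a single
      \<open>w i\<close> on the right.\<close>
    have Dd: "(\<Sum>j<n. of_real (D i j) * \<delta> j) = of_real \<tau> * w i + of_real \<tau> * \<xi> i" if i: "i < n" for i
    proof -
      have row: "(\<Sum>j<n. (if j \<le> p then 1 else 0) * \<delta> j) =
          of_real \<tau> * (\<Sum>j<n. of_real (if j \<le> p then a (p + 2) (j + 1) else 0) * w j) + of_real \<tau> * Z (p + 1)"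
        if p: "p < n" for p
      proof -
        have sub: "{..<n} \<inter> {..p} = {..p}" using p by auto
        have "(\<Sum>j<n. (if j \<le> p then 1 else 0) * \<delta> j) = (\<Sum>j<n. if j \<in> {..p} then \<delta> j else 0)"
          by (intro sum.cong) auto
        also have "\<dots> = (\<Sum>j\<le>p. \<delta> j)"
          by (subst sum.inter_restrict[symmetric]) (simp_all only: sub finite_lessThan)
        also have "\<dots> = V (p + 1 + 1) - V 1" by (simp add: part)
        also have "\<dots> = of_real \<tau> * (\<Sum>j=1..p+1. of_real (a (p + 1 + 1) j) *
           (of_real (- l) * (of_real \<beta> * ((V j + V (j + 1)) / 2) - G j))) + of_real \<tau> * Z (p + 1)"
        proof -
          have "p + 1 \<in> {1..s-1}" using p by (simp add: n_def)
          note sysp = sys[unfolded mode_sys_def, rule_format, OF this, folded l_def, folded \<beta>_def]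
          show ?thesis
            by (subst sysp) (simp only: add.assoc add_diff_cancel_left')
        qed
        also have "(\<Sum>j=1..p+1. of_real (a (p + 1 + 1) j) *
           (of_real (- l) * (of_real \<beta> * ((V j + V (j + 1)) / 2) - G j))) =
           (\<Sum>j\<le>p. of_real (a (p + 2) (j + 1)) * w j)"
          by (rule sum.reindex_bij_witness[of _ Suc "\<lambda>j. j - 1"]) (auto simp: w_def numeral_2_eq_2)
        also have "\<dots> = (\<Sum>j<n. if j \<in> {..p} then of_real (a (p + 2) (j + 1)) * w j else 0)"
          by (subst sum.inter_restrict[symmetric]) (simp_all only: sub finite_lessThan)
        also have "\<dots> = (\<Sum>j<n. of_real (if j \<le> p then a (p + 2) (j + 1) else 0) * w j)"
          by (intro sum.cong) auto
        finally show ?thesis .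
      qed
      have "(\<Sum>j<n. of_real (D i j) * \<delta> j) = (\<Sum>j<n. \<Sum>p<n. of_real (B i p) * ((if j \<le> p then 1 else 0) * \<delta> j))"
        using i by (intro sum.cong refl) (auto simp: D sum_distrib_right mult.assoc intro!: sum.cong)
      also have "\<dots> = (\<Sum>p<n. of_real (B i p) * (\<Sum>j<n. (if j \<le> p then 1 else 0) * \<delta> j))"
        unfolding sum_distrib_left by (rule sum.swap)
      also have "\<dots> = (\<Sum>p<n. of_real (B i p) *
          (of_real \<tau> * (\<Sum>j<n. of_real (if j \<le> p then a (p + 2) (j + 1) else 0) * w j) + of_real \<tau> * Z (p + 1)))"
        by (intro sum.cong refl) (simp only: row lessThan_iff)
      also have "\<dots> = of_real \<tau> * (\<Sum>p<n. \<Sum>j<n. of_real (B i p * (if j \<le> p then a (p + 2) (j + 1) else 0)) * w j)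
          + of_real \<tau> * \<xi> i"
        unfolding \<xi>_def
        by (simp add: sum_distrib_left sum.distrib distrib_left algebra_simps)
      also have "(\<Sum>p<n. \<Sum>j<n. of_real (B i p * (if j \<le> p then a (p + 2) (j + 1) else 0)) * w j) =
          (\<Sum>j<n. of_real (\<Sum>p<n. B i p * (if j \<le> p then a (p + 2) (j + 1) else 0)) * w j)"
        by (subst sum.swap) (simp only: of_real_sum sum_distrib_right)
      also have "\<dots> = (\<Sum>j<n. if j = i then w j else 0)"
        using i by (intro sum.cong refl) (simp add: BA)
      also have "\<dots> = w i" using i by simp
      finally show ?thesis .
    qed
    define sd where "sd = (\<Sum>i<n. (cmod (\<delta> i))\<^sup>2)"
    define sg where "sg = (\<Sum>i<n. (cmod (G (i + 1)))\<^sup>2)"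
    define sx where "sx = (\<Sum>i<n. (cmod (\<xi> i))\<^sup>2)"
    define sz where "sz = (\<Sum>i<n. (cmod (Z (i + 1)))\<^sup>2)"
    have nn: "0 \<le> sd" "0 \<le> sg" "0 \<le> sx" "0 \<le> sz"
      by (simp_all add: sd_def sg_def sx_def sz_def sum_nonneg)
    \<comment> \<open>The real quadratic form acts on real and imaginary parts separately; their
      mixed products are purely imaginary and drop out.\<close>
    have lower: "c * sd \<le> Re (\<Sum>i<n. cnj (\<delta> i) * (\<Sum>j<n. of_real (D i j) * \<delta> j))"
    proof -
      have "sd = (\<Sum>i<n. (Re (\<delta> i))\<^sup>2) + (\<Sum>i<n. (Im (\<delta> i))\<^sup>2)"
        by (simp add: sd_def cmod_power2 sum.distrib)
      then have "c * sd \<le> (\<Sum>i<n. \<Sum>j<n. Re (\<delta> i) * D i j * Re (\<delta> j)) + (\<Sum>i<n. \<Sum>j<n. Im (\<delta> i) * D i j * Im (\<delta> j))"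
        using coer[of "\<lambda>i. Re (\<delta> i)"] coer[of "\<lambda>i. Im (\<delta> i)"] by (simp add: distrib_left)
      also have "\<dots> = Re (\<Sum>i<n. cnj (\<delta> i) * (\<Sum>j<n. of_real (D i j) * \<delta> j))"
        by (simp add: sum_distrib_left sum.distrib algebra_simps)
      finally show ?thesis .
    qed
    have tm: "Re (cnj (\<delta> i) * (of_real \<tau> * w i + of_real \<tau> * \<xi> i)) \<le>
        - (\<tau> * l * \<beta> / 2) * ((cmod (V (Suc i + 1)))\<^sup>2 - (cmod (V (i + 1)))\<^sup>2)
        + \<tau> * (cmod (\<delta> i) * (l * cmod (G (i + 1)) + cmod (\<xi> i)))" for i
    proof -
      have g: "Re (cnj (\<delta> i) * G (i + 1)) \<le> cmod (\<delta> i) * cmod (G (i + 1))"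
        using complex_Re_le_cmod[of "cnj (\<delta> i) * G (i + 1)"] by (simp add: norm_mult)
      have x: "Re (cnj (\<delta> i) * \<xi> i) \<le> cmod (\<delta> i) * cmod (\<xi> i)"
        using complex_Re_le_cmod[of "cnj (\<delta> i) * \<xi> i"] by (simp add: norm_mult)
      have e: "Re (cnj (\<delta> i) * ((V (i + 1) + V (i + 2)) / 2)) = ((cmod (V (Suc i + 1)))\<^sup>2 - (cmod (V (i + 1)))\<^sup>2) / 2"
        unfolding cmod_power2 \<delta>_def by (simp add: power2_eq_square field_simps)
      have "cnj (\<delta> i) * (of_real \<tau> * w i + of_real \<tau> * \<xi> i) =
          of_real (- (\<tau> * l * \<beta>)) * (cnj (\<delta> i) * ((V (i + 1) + V (i + 2)) / 2))
          + of_real (\<tau> * l) * (cnj (\<delta> i) * G (i + 1)) + of_real \<tau> * (cnj (\<delta> i) * \<xi> i)"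
        unfolding w_def by (simp add: algebra_simps)
      moreover have "Re (of_real r * x) = r * Re x" for r x by simp
      ultimately have "Re (cnj (\<delta> i) * (of_real \<tau> * w i + of_real \<tau> * \<xi> i)) =
          - (\<tau> * l * \<beta>) * (((cmod (V (Suc i + 1)))\<^sup>2 - (cmod (V (i + 1)))\<^sup>2) / 2)
          + \<tau> * l * Re (cnj (\<delta> i) * G (i + 1)) + \<tau> * Re (cnj (\<delta> i) * \<xi> i)"
        by (simp only: plus_complex.sel e)
      also have "\<dots> \<le> - (\<tau> * l * \<beta>) * (((cmod (V (Suc i + 1)))\<^sup>2 - (cmod (V (i + 1)))\<^sup>2) / 2)
          + \<tau> * l * (cmod (\<delta> i) * cmod (G (i + 1))) + \<tau> * (cmod (\<delta> i) * cmod (\<xi> i))"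
        using \<tau> l by (intro add_mono mult_left_mono g x order_refl) auto
      finally show ?thesis by (simp add: algebra_simps diff_divide_distrib)
    qed
    define df where "df = (cmod (V s))\<^sup>2 - (cmod (V 1))\<^sup>2"
    have "Re (\<Sum>i<n. cnj (\<delta> i) * (\<Sum>j<n. of_real (D i j) * \<delta> j)) =
        (\<Sum>i<n. Re (cnj (\<delta> i) * (of_real \<tau> * w i + of_real \<tau> * \<xi> i)))"
      unfolding Re_sum by (intro sum.cong refl) (simp only: Dd lessThan_iff)
    also have "\<dots> \<le> (\<Sum>i<n. - (\<tau> * l * \<beta> / 2) * ((cmod (V (Suc i + 1)))\<^sup>2 - (cmod (V (i + 1)))\<^sup>2)
        + \<tau> * (cmod (\<delta> i) * (l * cmod (G (i + 1)) + cmod (\<xi> i))))"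
      by (intro sum_mono tm)
    also have "\<dots> = - (\<tau> * l * \<beta> / 2) * df + \<tau> * (\<Sum>i<n. cmod (\<delta> i) * (l * cmod (G (i + 1)) + cmod (\<xi> i)))"
    proof -
      have "(\<Sum>i<n. (cmod (V (Suc i + 1)))\<^sup>2 - (cmod (V (i + 1)))\<^sup>2) = df"
        using sum_lessThan_telescope[of "\<lambda>i. (cmod (V (i + 1)))\<^sup>2" n] by (simp add: df_def s)
      then show ?thesis
        by (simp only: sum.distrib sum_distrib_left[symmetric])
    qed
    finally have energy: "c * sd + \<tau> * l * \<beta> / 2 * df \<le>
        \<tau> * (\<Sum>i<n. cmod (\<delta> i) * (l * cmod (G (i + 1)) + cmod (\<xi> i)))"
      using lower by simp
    have sx_le: "sx \<le> b * sz"
    proof -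
      have "(cmod (\<xi> i))\<^sup>2 \<le> (\<Sum>p<n. (B i p)\<^sup>2) * sz" for i
      proof -
        have "cmod (\<xi> i) \<le> (\<Sum>p<n. \<bar>B i p\<bar> * \<bar>cmod (Z (p + 1))\<bar>)"
          unfolding \<xi>_def by (intro sum_norm_le) (simp add: norm_mult)
        also have "\<dots> \<le> L2_set (B i) {..<n} * L2_set (\<lambda>p. cmod (Z (p + 1))) {..<n}"
          by (rule L2_set_mult_ineq)
        finally have "(cmod (\<xi> i))\<^sup>2 \<le> (L2_set (B i) {..<n} * L2_set (\<lambda>p. cmod (Z (p + 1))) {..<n})\<^sup>2"
          by (intro power_mono) auto
        then show ?thesis
          by (simp add: L2_set_def power_mult_distrib sum_nonneg sz_def)
      qed
      then show ?thesis
        unfolding sx_def b_def sum_distrib_right by (rule sum_mono)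
    qed
    have young: "\<tau> * (x * y) \<le> e * x\<^sup>2 + \<tau>\<^sup>2 / (4 * e) * y\<^sup>2" if "0 < e" for x y e :: real
    proof -
      have "0 \<le> (2 * e * x - \<tau> * y)\<^sup>2 / (4 * e)" using that by simp
      also have "\<dots> = e * x\<^sup>2 + \<tau>\<^sup>2 / (4 * e) * y\<^sup>2 - \<tau> * (x * y)"
        using that by (simp add: field_simps power2_eq_square)
      finally show ?thesis by simp
    qed
    define R where "R = (\<Sum>j=1..s-1. (cmod (G j))\<^sup>2 + (cmod (Z j) / rho k ^ 2)\<^sup>2)"
    have R: "R = sg + sz / rho k ^ 4"
    proof -
      have "R = (\<Sum>i<n. (cmod (G (i + 1)))\<^sup>2 + (cmod (Z (i + 1)) / rho k ^ 2)\<^sup>2)"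
        unfolding R_def n_def
        by (rule sum.reindex_bij_witness[of _ Suc "\<lambda>j. j - 1"]) auto
      then show ?thesis
        by (simp add: sg_def sz_def sum.distrib power_divide sum_divide_distrib flip: power_mult)
    qed
    have R0: "0 \<le> R" unfolding R_def by (intro sum_nonneg) auto
    have "df \<le> \<tau> * (cmod (V 1))\<^sup>2 + C * \<tau> * R"
    \<comment> \<open>For the constant mode the energy inequality says only that the increments are
      of size \<open>\<tau>\<close> times the defects; summing them up bounds the last stage
      directly.\<close>
    proof (cases "k = 0")
      case True
      then have l0: "l = 0" and rho1: "rho k = 1" by (simp_all add: l_def lam_def)
      have "c * sd \<le> (\<Sum>i<n. \<tau> * (cmod (\<delta> i) * cmod (\<xi> i)))"
        using energy by (simp add: l0 sum_distrib_left)
      also have "\<dots> \<le> (\<Sum>i<n. c / 2 * (cmod (\<delta> i))\<^sup>2 + \<tau>\<^sup>2 / (4 * (c / 2)) * (cmod (\<xi> i))\<^sup>2)"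
        using c by (intro sum_mono young) simp
      also have "\<dots> = c / 2 * sd + \<tau>\<^sup>2 / (2 * c) * sx"
        by (simp add: sum.distrib sd_def sx_def sum_distrib_left)
      finally have "sd \<le> \<tau>\<^sup>2 / c\<^sup>2 * sx"
        using c by (simp add: field_simps power2_eq_square)
      also have "\<dots> \<le> \<tau>\<^sup>2 / c\<^sup>2 * (b * sz)"
        by (intro mult_left_mono sx_le) simp
      finally have sd: "sd \<le> \<tau>\<^sup>2 / c\<^sup>2 * (b * sz)" .
      define d where "d = (\<Sum>i<n. \<delta> i)"
      obtain n' where n': "n = Suc n'" using s_ge_2 by (cases n) (auto simp: n_def)
      have "V s - V 1 = d"
        using part[of n'] unfolding d_def s n' by (simp add: lessThan_Suc_atMost)
      then have Vs: "V s = V 1 + d" by (simp add: algebra_simps)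
      have "cmod d \<le> (\<Sum>i<n. \<bar>1\<bar> * \<bar>cmod (\<delta> i)\<bar>)"
        unfolding d_def by (intro sum_norm_le) simp
      also have "\<dots> \<le> L2_set (\<lambda>i. 1) {..<n} * L2_set (\<lambda>i. cmod (\<delta> i)) {..<n}"
        by (rule L2_set_mult_ineq)
      finally have "(cmod d)\<^sup>2 \<le> (L2_set (\<lambda>i. 1) {..<n} * L2_set (\<lambda>i. cmod (\<delta> i)) {..<n})\<^sup>2"
        by (intro power_mono) auto
      then have d: "(cmod d)\<^sup>2 \<le> real n * sd"
        by (simp add: L2_set_def power_mult_distrib sum_nonneg sd_def)
      have "(cmod (V s))\<^sup>2 \<le> (cmod (V 1) + cmod d)\<^sup>2"
        unfolding Vs by (intro power_mono norm_triangle_ineq) simp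
      \<comment> \<open>Young's inequality with weight \<open>\<tau>\<close> keeps the factor of
        \<open>V 1\<close> at \<open>1 + \<tau>\<close>. The loss \<open>1 / \<tau>\<close> is
        affordable because the square of \<open>d\<close> is of order
        \<open>\<tau>\<^sup>2\<close>.\<close>
      also have "\<dots> \<le> (1 + \<tau>) * (cmod (V 1))\<^sup>2 + (1 + 1 / \<tau>) * (cmod d)\<^sup>2"
      proof -
        have "0 \<le> (\<tau> * cmod (V 1) - cmod d)\<^sup>2 / \<tau>" using \<tau> by simp
        also have "\<dots> = (1 + \<tau>) * (cmod (V 1))\<^sup>2 + (1 + 1 / \<tau>) * (cmod d)\<^sup>2 - (cmod (V 1) + cmod d)\<^sup>2"
          using \<tau> by (simp add: field_simps power2_eq_square)
        finally show ?thesis by simp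
      qed
      finally have "df \<le> \<tau> * (cmod (V 1))\<^sup>2 + (1 + 1 / \<tau>) * (cmod d)\<^sup>2"
        by (simp add: df_def distrib_right)
      also have "(1 + 1 / \<tau>) * (cmod d)\<^sup>2 \<le> (1 + 1 / \<tau>) * (real n * (\<tau>\<^sup>2 / c\<^sup>2 * (b * sz)))"
        using d sd \<tau> by (intro mult_left_mono order_trans[OF d]) auto
      also have "\<dots> = (\<tau> + 1) * \<tau> * (real n * b / c\<^sup>2 * sz)"
        using \<tau> c by (simp add: field_simps power2_eq_square)
      also have "\<dots> \<le> 2 * \<tau> * (real n * b / c\<^sup>2 * sz)"
        using \<tau> nn b by (intro mult_right_mono) auto
      also have "\<dots> = (2 * real n * b / c\<^sup>2) * (\<tau> * sz)" by simp
      also have "\<dots> \<le> C * (\<tau> * R)"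
        unfolding R rho1 C_def using \<tau> nn b c freq_pos by (intro mult_mono) auto
      finally show ?thesis by (simp add: mult.assoc)
    next
      case False
      have l1: "freq\<^sup>2 \<le> l" using one_le_lam[OF False] freq_pos by (simp add: l_def field_simps)
      then have lpos: "0 < l" using freq_pos by (smt (verit) zero_less_power)
      have "rho k ^ 2 \<le> 3 * (l / freq\<^sup>2 + l / freq\<^sup>2)"
        using rho_sq_le[of k] one_le_lam[OF False] by (simp add: l_def)
      then have rl: "rho k ^ 2 \<le> 6 * l / freq\<^sup>2" by simp
      have "(rho k ^ 2)\<^sup>2 \<le> (6 * l / freq\<^sup>2)\<^sup>2"
        by (intro power_mono rl) simp
      then have "rho k ^ 4 \<le> 36 * l\<^sup>2 / freq ^ 4"
        by (simp add: power_divide power_mult_distrib flip: power_mult)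
      then have "freq ^ 4 * rho k ^ 4 \<le> 36 * l\<^sup>2"
        using freq_pos by (simp add: field_simps)
      then have "36 / (36 * l\<^sup>2) \<le> 36 / (freq ^ 4 * rho k ^ 4)"
        using freq_pos by (intro frac_le mult_pos_pos zero_less_power) auto
      then have rz: "1 / l\<^sup>2 \<le> 36 / freq ^ 4 * (1 / rho k ^ 4)"
        by simp
      have "\<tau> * (\<Sum>i<n. cmod (\<delta> i) * (l * cmod (G (i + 1)) + cmod (\<xi> i)))
          = (\<Sum>i<n. \<tau> * (cmod (\<delta> i) * (l * cmod (G (i + 1)) + cmod (\<xi> i))))"
        by (rule sum_distrib_left)
      also have "\<dots> \<le> (\<Sum>i<n. c * (cmod (\<delta> i))\<^sup>2 + \<tau>\<^sup>2 / (4 * c) * (l * cmod (G (i + 1)) + cmod (\<xi> i))\<^sup>2)"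
        by (intro sum_mono young c)
      also have "\<dots> \<le> (\<Sum>i<n. c * (cmod (\<delta> i))\<^sup>2 + \<tau>\<^sup>2 / (4 * c) * (2 * (l\<^sup>2 * (cmod (G (i + 1)))\<^sup>2 + (cmod (\<xi> i))\<^sup>2)))"
      proof (intro sum_mono add_left_mono mult_left_mono)
        fix i
        have "(x + y)\<^sup>2 \<le> 2 * (x\<^sup>2 + y\<^sup>2)" for x y :: real
          using sum_squares_bound[of x y] by (simp add: power2_sum)
        from this[of "l * cmod (G (i + 1))" "cmod (\<xi> i)"]
        show "(l * cmod (G (i + 1)) + cmod (\<xi> i))\<^sup>2 \<le> 2 * (l\<^sup>2 * (cmod (G (i + 1)))\<^sup>2 + (cmod (\<xi> i))\<^sup>2)"
          by (simp add: power_mult_distrib)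
      qed (use c in auto)
      also have "\<dots> = c * sd + \<tau>\<^sup>2 / (2 * c) * (l\<^sup>2 * sg + sx)"
        by (simp add: sd_def sg_def sx_def sum.distrib sum_distrib_left sum_divide_distrib algebra_simps)
      finally have "\<tau> * l * \<beta> / 2 * df \<le> \<tau>\<^sup>2 / (2 * c) * (l\<^sup>2 * sg + sx)"
        using energy by simp
      then have "\<tau> * (l * \<beta> * df) \<le> \<tau> * (\<tau> / c * (l\<^sup>2 * sg + sx))"
        by (simp add: power2_eq_square)
      then have main: "l * \<beta> * df \<le> \<tau> / c * (l\<^sup>2 * sg + sx)"
        using \<tau>(1) by (simp only: mult_le_cancel_left_pos)
      show ?thesis
      \<comment> \<open>Replacing \<open>\<beta>\<close> by its lower bound
        \<open>\<epsilon>\<^sup>2 * l\<close> preserves the inequality for positive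
        \<open>df\<close>; otherwise the claim holds by sign.\<close>
      proof (cases "df \<le> 0")
        case True
        have "0 \<le> C * \<tau> * R" using \<open>0 \<le> C\<close> \<tau> R0 by simp
        then show ?thesis using True \<tau> by (smt (verit) mult_nonneg_nonneg zero_le_power2)
      next
        case False
        have "l * (\<epsilon>\<^sup>2 * l) * df \<le> l * \<beta> * df"
          using False l kappa_nonneg by (intro mult_right_mono mult_left_mono) (auto simp: \<beta>_def)
        also note main
        finally have "\<epsilon>\<^sup>2 * l\<^sup>2 * df \<le> \<tau> / c * (l\<^sup>2 * sg + sx)"
          by (simp add: power2_eq_square ac_simps)
        then have "df \<le> (\<tau> / c * (l\<^sup>2 * sg + sx)) / (\<epsilon>\<^sup>2 * l\<^sup>2)"
          using eps_pos lpos by (subst pos_le_divide_eq) (auto simp: ac_simps)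
        also have "\<dots> = \<tau> * (1 / (c * \<epsilon>\<^sup>2) * sg + 1 / (c * \<epsilon>\<^sup>2) * (1 / l\<^sup>2 * sx))"
          using eps_pos lpos c by (simp add: field_simps)
        also have "\<dots> \<le> \<tau> * (1 / (c * \<epsilon>\<^sup>2) * sg + 1 / (c * \<epsilon>\<^sup>2) * (36 / freq ^ 4 * (1 / rho k ^ 4) * (b * sz)))"
          using \<tau> c nn b freq_pos by (intro mult_left_mono add_left_mono mult_mono rz sx_le) auto
        also have "\<dots> = \<tau> * (1 / (c * \<epsilon>\<^sup>2) * sg + 36 * b / (freq ^ 4 * c * \<epsilon>\<^sup>2) * (sz / rho k ^ 4))"
          using c eps_pos freq_pos by (simp add: field_simps)
        also have "\<dots> \<le> \<tau> * (C * sg + C * (sz / rho k ^ 4))"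
          using \<tau> c nn b freq_pos by (intro mult_left_mono add_mono mult_right_mono) (auto simp: C_def)
        also have "\<dots> = C * \<tau> * R" by (simp add: R algebra_simps)
        finally show ?thesis using \<tau> by (smt (verit) mult_nonneg_nonneg zero_le_power2)
      qed
    qed
    then show "(cmod (V s))\<^sup>2 \<le> (1 + \<tau>) * (cmod (V 1))\<^sup>2
        + C * \<tau> * (\<Sum>j=1..s-1. (cmod (G j))\<^sup>2 + (cmod (Z j) / rho k ^ 2)\<^sup>2)"
      by (simp add: df_def R_def distrib_right)
  qed
qed

end

section \<open>Growth over one step\<close>

lemma f_nl_cubic: "f_nl \<kappa> v = (\<kappa> + 1) * v - v * (v * v)"
proof -
  have "(double_well has_real_derivative v * (v * v) - v) (at v)"
    unfolding double_well_def
    by (auto intro!: derivative_eq_intros simp: power2_eq_square field_simps)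
  then show ?thesis
    by (simp add: f_nl_def DERIV_imp_deriv algebra_simps)
qed

context torus
begin

lemma in_H_iff: "in_H L q u \<longleftrightarrow> in_L2 L u \<and> (\<exists>B. hb q (fc u) B)"
  using hb_of_in_H in_H_imp_in_L2 in_H_of_hb(1) by blast

text \<open>Two applications of \<open>hb_product\<close> to the cube give the numbers. The argument
  \<open>A\<close> bounds the norm of order two only, which makes the growth linear in the norm of
  order \<open>r\<close>.\<close>

definition nl_const :: "real \<Rightarrow> nat \<Rightarrow> real \<Rightarrow> real" where
  "nl_const \<kappa> r A = \<kappa> + 1 + 2 ^ r * 4 * (2 ^ r * 8 + 32) * A\<^sup>2"

lemma f_nl_bound:
  assumes \<kappa>: "0 \<le> \<kappa>" and V: "in_L2 L V" "hb 2 (fc V) A" "hb r (fc V) B"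
  shows "in_L2 L (\<lambda>z. f_nl \<kappa> (V z))" "hb r (fc (\<lambda>z. f_nl \<kappa> (V z))) (nl_const \<kappa> r A * B)"
proof -
  have L2: "in_L2 L (\<lambda>z. V z * V z)"
    by (rule in_L2_product[OF V(1,2,1)])
  have h2: "hb 2 (fc (\<lambda>z. V z * V z)) (32 * A\<^sup>2)"
    using hb_product[OF V(1,2,2) V(1,2,2)] by (simp add: power2_eq_square)
  have hr: "hb r (fc (\<lambda>z. V z * V z)) (2 ^ r * 4 * (A * B + A * B))"
    by (rule hb_product[OF V V])
  have L3: "in_L2 L (\<lambda>z. V z * (V z * V z))"
    by (rule in_L2_product[OF V(1,2) L2])
  have h3: "hb r (fc (\<lambda>z. V z * (V z * V z))) (2 ^ r * 4 * (A * (2 ^ r * 4 * (A * B + A * B)) + 32 * A\<^sup>2 * B))"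
    by (rule hb_product[OF V L2 h2 hr])
  show "in_L2 L (\<lambda>z. f_nl \<kappa> (V z))"
    unfolding f_nl_cubic by (intro in_L2_diff in_L2_cmult V L3)
  have "fc (\<lambda>z. f_nl \<kappa> (V z)) = (\<lambda>k. of_real (\<kappa> + 1) * fc V k - fc (\<lambda>z. V z * (V z * V z)) k)"
    unfolding f_nl_cubic by (rule ext) (simp only: fc_diff in_L2_cmult V L3 fc_cmult)
  moreover have "hb r (\<lambda>k. of_real (\<kappa> + 1) * fc V k - fc (\<lambda>z. V z * (V z * V z)) k)
      (cmod (of_real (\<kappa> + 1)) * B + 2 ^ r * 4 * (A * (2 ^ r * 4 * (A * B + A * B)) + 32 * A\<^sup>2 * B))"
    by (intro hb_diff hb_cmult V h3)
  moreover have "cmod (of_real (\<kappa> + 1)) * B + 2 ^ r * 4 * (A * (2 ^ r * 4 * (A * B + A * B)) + 32 * A\<^sup>2 * B)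
      = nl_const \<kappa> r A * B"
    using \<kappa> unfolding norm_of_real by (simp add: nl_const_def power2_eq_square algebra_simps)
  ultimately show "hb r (fc (\<lambda>z. f_nl \<kappa> (V z))) (nl_const \<kappa> r A * B)"
    by (simp only:)
qed

text \<open>The difference of the cubes is \<open>V - W\<close> times a quadratic expression of norm
  at most \<open>3 * 32 * A\<^sup>2\<close>; the product estimate of order two multiplies this by
  32, which gives 3072.\<close>

definition lip_const :: "real \<Rightarrow> real \<Rightarrow> real" where
  "lip_const \<kappa> A = \<kappa> + 1 + 3072 * A\<^sup>2"

lemma f_nl_lipschitz:
  assumes \<kappa>: "0 \<le> \<kappa>" and V: "in_L2 L V" "hb 2 (fc V) A" and W: "in_L2 L W" "hb 2 (fc W) A"
    and E: "hb 2 (\<lambda>k. fc V k - fc W k) E"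
  shows "hb 2 (\<lambda>k. fc (\<lambda>z. f_nl \<kappa> (V z)) k - fc (\<lambda>z. f_nl \<kappa> (W z)) k) (lip_const \<kappa> A * E)"
proof -
  let ?e = "\<lambda>z. V z - W z"
  let ?q = "\<lambda>z. V z * V z + (V z * W z + W z * W z)"
  have e: "in_L2 L ?e" by (intro in_L2_diff V W)
  have fce: "fc ?e = (\<lambda>k. fc V k - fc W k)" by (rule ext) (rule fc_diff[OF V(1) W(1)])
  have e2: "hb 2 (fc ?e) E" unfolding fce by (rule E)
  have vv: "in_L2 L (\<lambda>z. V z * V z)" "in_L2 L (\<lambda>z. V z * W z)" "in_L2 L (\<lambda>z. W z * W z)"
    by (rule in_L2_product[OF V V(1)] in_L2_product[OF V W(1)] in_L2_product[OF W W(1)])+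
  have q: "in_L2 L ?q" by (intro in_L2_add vv)
  have "fc ?q = (\<lambda>k. fc (\<lambda>z. V z * V z) k + (fc (\<lambda>z. V z * W z) k + fc (\<lambda>z. W z * W z) k))"
    by (rule ext) (simp only: fc_add in_L2_add vv)
  moreover have "hb 2 (fc (\<lambda>z. V z * V z)) (32 * A\<^sup>2)" "hb 2 (fc (\<lambda>z. V z * W z)) (32 * A\<^sup>2)"
      "hb 2 (fc (\<lambda>z. W z * W z)) (32 * A\<^sup>2)"
    using hb_product[OF V(1,2,2) V(1,2,2)] hb_product[OF V(1,2,2) W(1,2,2)] hb_product[OF W(1,2,2) W(1,2,2)]
    by (simp_all add: power2_eq_square)
  ultimately have q2: "hb 2 (fc ?q) (32 * A\<^sup>2 + (32 * A\<^sup>2 + 32 * A\<^sup>2))"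
    by (simp only: hb_add)
  have eq: "in_L2 L (\<lambda>z. ?e z * ?q z)" by (rule in_L2_product[OF e e2 q])
  have "f_nl \<kappa> (V z) - f_nl \<kappa> (W z) = (\<kappa> + 1) * ?e z - ?e z * ?q z" for z
    by (simp add: f_nl_cubic algebra_simps)
  then have "fc (\<lambda>z. f_nl \<kappa> (V z) - f_nl \<kappa> (W z)) k = of_real (\<kappa> + 1) * fc ?e k - fc (\<lambda>z. ?e z * ?q z) k" for k
    by (simp only: fc_diff in_L2_cmult e eq fc_cmult)
  moreover have "fc (\<lambda>z. f_nl \<kappa> (V z) - f_nl \<kappa> (W z)) k = fc (\<lambda>z. f_nl \<kappa> (V z)) k - fc (\<lambda>z. f_nl \<kappa> (W z)) k" for k
    by (intro fc_diff f_nl_bound(1)[OF \<kappa> V V(2)] f_nl_bound(1)[OF \<kappa> W W(2)])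
  ultimately have "(\<lambda>k. fc (\<lambda>z. f_nl \<kappa> (V z)) k - fc (\<lambda>z. f_nl \<kappa> (W z)) k) =
      (\<lambda>k. of_real (\<kappa> + 1) * fc ?e k - fc (\<lambda>z. ?e z * ?q z) k)"
    by (simp only:)
  moreover have "hb 2 (\<lambda>k. of_real (\<kappa> + 1) * fc ?e k - fc (\<lambda>z. ?e z * ?q z) k)
      (cmod (of_real (\<kappa> + 1)) * E + 2 ^ 2 * 4 * (E * (32 * A\<^sup>2 + (32 * A\<^sup>2 + 32 * A\<^sup>2)) + (32 * A\<^sup>2 + (32 * A\<^sup>2 + 32 * A\<^sup>2)) * E))"
    by (intro hb_diff hb_cmult e2 hb_product e q q2)
  moreover have "cmod (of_real (\<kappa> + 1)) * E + 2 ^ 2 * 4 * (E * (32 * A\<^sup>2 + (32 * A\<^sup>2 + 32 * A\<^sup>2)) + (32 * A\<^sup>2 + (32 * A\<^sup>2 + 32 * A\<^sup>2)) * E)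
      = lip_const \<kappa> A * E"
    using \<kappa> unfolding norm_of_real by (simp add: lip_const_def algebra_simps)
  ultimately show ?thesis by (simp only:)
qed

end

section \<open>From the scheme to its Fourier modes\<close>

context rierk
begin

lemma hb_lam:
  assumes "hb (q + 2) c B"
  shows "hb q (\<lambda>k. of_real (lam k) * c k) (freq\<^sup>2 * B)"
proof (rule hb_dominated[OF assms])
  fix k
  have "rho k ^ q * (lam k * cmod (c k)) \<le> rho k ^ q * (freq\<^sup>2 * rho k ^ 2 * cmod (c k))"
    by (intro mult_left_mono mult_right_mono lam_le_rho) auto
  then show "rho k ^ q * cmod (of_real (lam k) * c k) \<le> freq\<^sup>2 * (rho k ^ (q + 2) * cmod (c k))"
    using lam_nonneg[of k] by (simp add: norm_mult power_add power2_eq_square algebra_simps)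
qed simp

definition mode_term :: "(nat \<Rightarrow> field2) \<Rightarrow> nat \<Rightarrow> int \<times> int \<Rightarrow> complex" where
  "mode_term V j k = of_real (- lam k) * (of_real (\<epsilon>\<^sup>2 * lam k + \<kappa>) * ((fc (V j) k + fc (V (j + 1)) k) / 2)
      - fc (\<lambda>z. f_nl \<kappa> (V j z)) k)"

text \<open>The four orders of regularity pay for two Laplacians. The term \<open>h\<close> must be
  shown to have order two before the outer \<open>laplace\<close> is meaningful, since weak
  derivatives that do not exist are unspecified.\<close>

lemma stage_term:
  assumes j: "in_H L 4 (V j)" and j1: "in_H L 4 (V (j + 1))"
  defines "h \<equiv> \<lambda>y. L_op L \<epsilon> \<kappa> (\<lambda>w. (V j w + V (j + 1) w) / 2) y - f_nl \<kappa> (V j y)"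
  shows "in_L2 L (laplace L h)" "fc (laplace L h) k = mode_term V j k"
proof -
  let ?m = "\<lambda>w. (V j w + V (j + 1) w) / 2"
  obtain B B1 where B: "hb 4 (fc (V j)) B" and B1: "hb 4 (fc (V (j + 1))) B1"
    using j j1 by (auto simp: in_H_iff)
  have L2: "in_L2 L (V j)" "in_L2 L (V (j + 1))"
    using j j1 by (auto simp: in_H_iff)
  have m_eq: "?m = (\<lambda>w. (1 / 2) * (V j w + V (j + 1) w))" by (simp add: fun_eq_iff)
  have m: "in_L2 L ?m"
    unfolding m_eq by (intro in_L2_cmult in_L2_add L2)
  have m_fc: "fc ?m = (\<lambda>k. of_real (1 / 2) * (fc (V j) k + fc (V (j + 1)) k))"
    unfolding m_eq by (rule ext) (simp only: fc_cmult fc_add[OF L2])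
  have m_hb: "hb 4 (fc ?m) (cmod (of_real (1 / 2)) * (B + B1))"
    unfolding m_fc by (intro hb_cmult hb_add B B1)
  have m4: "hb (2 + 2) (fc ?m) (cmod (of_real (1 / 2)) * (B + B1))"
    and m2: "hb 2 (fc ?m) (cmod (of_real (1 / 2)) * (B + B1))"
    by (rule hb_exponent_mono[OF m_hb]; simp)+
  have "in_H L 2 ?m"
    using m m2 unfolding in_H_iff by blast
  note lap = laplace_props[OF this]
  have f2: "hb 2 (fc (V j)) B" by (rule hb_exponent_mono[OF B]) simp
  note f = f_nl_bound[OF kappa_nonneg L2(1) f2 f2]
  have Lop: "in_L2 L (L_op L \<epsilon> \<kappa> ?m)"
    unfolding L_op_def by (intro in_L2_add in_L2_cmult lap m)
  have Lop_fc: "fc (L_op L \<epsilon> \<kappa> ?m) k = of_real (\<epsilon>\<^sup>2) * (of_real (lam k) * fc ?m k) + of_real \<kappa> * fc ?m k" for k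
  proof -
    have "fc (L_op L \<epsilon> \<kappa> ?m) k = of_real (- \<epsilon>\<^sup>2) * fc (laplace L ?m) k + of_real \<kappa> * fc ?m k"
      unfolding L_op_def by (simp only: fc_add in_L2_cmult lap(1) m fc_cmult)
    then show ?thesis by (simp only: lap(2)) simp
  qed
  have h: "in_L2 L h" unfolding h_def by (intro in_L2_diff Lop f)
  have h_fc: "fc h = (\<lambda>k. of_real (\<epsilon>\<^sup>2) * (of_real (lam k) * fc ?m k) + of_real \<kappa> * fc ?m k
      - fc (\<lambda>z. f_nl \<kappa> (V j z)) k)"
    unfolding h_def by (rule ext) (simp only: fc_diff[OF Lop f(1)] Lop_fc)
  have "\<exists>C. hb 2 (fc h) C"
    unfolding h_fc
    using hb_diff[OF hb_add[OF hb_cmult[OF hb_lam[OF m4], of "of_real (\<epsilon>\<^sup>2)"]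
        hb_cmult[OF m2, of "of_real \<kappa>"]] f(2)] by (rule exI)
  then have "in_H L 2 h" using h unfolding in_H_iff by blast
  note lap_h = laplace_props[OF this]
  show "in_L2 L (laplace L h)" by (rule lap_h)
  show "fc (laplace L h) k = mode_term V j k"
    unfolding lap_h(2) h_fc m_fc mode_term_def by (simp add: field_simps)
qed

lemma stage_sum_props:
  assumes V: "\<And>j. j \<in> {1..s} \<Longrightarrow> in_H L 4 (V j)" and i: "i \<in> {1..s-1}"
  shows "in_L2 L (stage_sum L \<epsilon> \<kappa> a V i)"
    "fc (stage_sum L \<epsilon> \<kappa> a V i) k = (\<Sum>j=1..i. of_real (a (i + 1) j) * mode_term V j k)"
proof -
  have *: "in_H L 4 (V j)" "in_H L 4 (V (j + 1))" if "j \<in> {1..i}" for j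
    using V[of j] V[of "j + 1"] that i by auto
  have L2: "in_L2 L (\<lambda>z. a (i + 1) j * laplace L (\<lambda>y. L_op L \<epsilon> \<kappa> (\<lambda>w. (V j w + V (j + 1) w) / 2) y - f_nl \<kappa> (V j y)) z)"
    if "j \<in> {1..i}" for j
    by (intro in_L2_cmult stage_term(1) * that)
  then show "in_L2 L (stage_sum L \<epsilon> \<kappa> a V i)"
    unfolding stage_sum_def by (rule in_L2_sum)
  show "fc (stage_sum L \<epsilon> \<kappa> a V i) k = (\<Sum>j=1..i. of_real (a (i + 1) j) * mode_term V j k)"
    unfolding stage_sum_def
  proof (rule trans[OF fc_sum[OF L2] sum.cong[OF refl]])
    fix j assume "j \<in> {1..i}"
    then show "fc (\<lambda>z. a (i + 1) j * laplace L (\<lambda>y. L_op L \<epsilon> \<kappa> (\<lambda>w. (V j w + V (j + 1) w) / 2) y - f_nl \<kappa> (V j y)) z) k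
        = of_real (a (i + 1) j) * mode_term V j k"
      by (simp only: fc_cmult stage_term(2)[of V, OF *])
  qed
qed

text \<open>Serves the scheme, with zero defects, and the exact solution, with its temporal defects.
  Equality almost everywhere is enough, because coefficients ignore null sets.\<close>

lemma mode_sys_of_stages:
  assumes V: "\<And>j. j \<in> {1..s} \<Longrightarrow> in_H L 4 (V j)" and \<zeta>: "\<And>i. i \<in> {1..s-1} \<Longrightarrow> in_L2 L (\<zeta> i)"
    and eq: "\<And>i. i \<in> {1..s-1} \<Longrightarrow>
      eq_ae L (V (i + 1)) (\<lambda>z. V 1 z + \<tau> * stage_sum L \<epsilon> \<kappa> a V i z + \<tau> * \<zeta> i z)"
  shows "mode_sys \<tau> (lam k) (\<lambda>j. fc (V j) k) (\<lambda>j. fc (\<lambda>z. f_nl \<kappa> (V j z)) k) (\<lambda>i. fc (\<zeta> i) k)"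
  unfolding mode_sys_def
proof
  fix i assume i: "i \<in> {1..s-1}"
  have L2: "in_L2 L (V 1)" "in_L2 L (V (i + 1))"
    using V[of 1] V[of "i + 1"] i s_ge_2 by (auto simp: in_H_iff)
  note st = stage_sum_props[OF V i]
  have "fc (V (i + 1)) k = fc (\<lambda>z. V 1 z + \<tau> * stage_sum L \<epsilon> \<kappa> a V i z + \<tau> * \<zeta> i z) k"
    by (subst fc_cong_ae[OF L2(2) _ eq[OF i]]) (intro in_L2_add in_L2_cmult L2 st \<zeta> i, simp_all)
  also have "\<dots> = fc (V 1) k + of_real \<tau> * (\<Sum>j=1..i. of_real (a (i + 1) j) * mode_term V j k) + of_real \<tau> * fc (\<zeta> i) k"
    by (simp only: fc_add in_L2_add in_L2_cmult L2 st \<zeta>[OF i] fc_cmult)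
  finally show "fc (V (i + 1)) k = fc (V 1) k + of_real \<tau> * (\<Sum>j=1..i. of_real (a (i + 1) j) *
      (of_real (- lam k) * (of_real (\<epsilon>\<^sup>2 * lam k + \<kappa>) * ((fc (V j) k + fc (V (j + 1)) k) / 2)
        - fc (\<lambda>z. f_nl \<kappa> (V j z)) k))) + of_real \<tau> * fc (\<zeta> i) k"
    by (simp only: mode_term_def)
qed

text \<open>With the nonlinear term treated as a separate sequence \<open>G\<close> the system is
  linear, so the error satisfies it with the difference of the nonlinear terms as its data.\<close>

lemma mode_sys_diff:
  assumes "mode_sys \<tau> l V G Z" "mode_sys \<tau> l V' G' Z'"
  shows "mode_sys \<tau> l (\<lambda>j. V j - V' j) (\<lambda>j. G j - G' j) (\<lambda>j. Z j - Z' j)"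
  unfolding mode_sys_def
proof
  fix i assume i: "i \<in> {1..s-1}"
  let ?t = "\<lambda>V G j. of_real (a (i + 1) j) * (of_real (- l) * (of_real (\<epsilon>\<^sup>2 * l + \<kappa>) * ((V j + V (j + 1)) / 2) - G j))"
  have "?t (\<lambda>j. V j - V' j) (\<lambda>j. G j - G' j) j = ?t V G j - ?t V' G' j" for j
  proof -
    have "A * (x * (y * ((v - v' + (u - u')) / 2) - (g - g'))) =
        A * (x * (y * ((v + u) / 2) - g)) - A * (x * (y * ((v' + u') / 2) - g'))"
      for A x y v v' u u' g g' :: complex
      by (simp add: field_simps)
    then show ?thesis .
  qed
  then have "(\<Sum>j=1..i. ?t (\<lambda>j. V j - V' j) (\<lambda>j. G j - G' j) j) = (\<Sum>j=1..i. ?t V G j) - (\<Sum>j=1..i. ?t V' G' j)"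
    by (simp only: sum_subtractf)
  moreover have "V (i + 1) = V 1 + of_real \<tau> * (\<Sum>j=1..i. ?t V G j) + of_real \<tau> * Z i"
      "V' (i + 1) = V' 1 + of_real \<tau> * (\<Sum>j=1..i. ?t V' G' j) + of_real \<tau> * Z' i"
    using assms i unfolding mode_sys_def by blast+
  ultimately show "V (i + 1) - V' (i + 1) = V 1 - V' 1 +
      of_real \<tau> * (\<Sum>j=1..i. ?t (\<lambda>j. V j - V' j) (\<lambda>j. G j - G' j) j) + of_real \<tau> * (Z i - Z' i)"
    by (simp only: right_diff_distrib) simp
qed

text \<open>Stage solutions of one step whose nonlinear term grows at most linearly in the norm
  of order \<open>r\<close>; defects are measured two orders lower, which is the smoothing of one step.\<close>

definition lin_sys :: "nat \<Rightarrow> real \<Rightarrow> real \<Rightarrow> (nat \<Rightarrow> int \<times> int \<Rightarrow> complex) \<Rightarrow> (nat \<Rightarrow> int \<times> int \<Rightarrow> complex) \<Rightarrow>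
    (nat \<Rightarrow> int \<times> int \<Rightarrow> complex) \<Rightarrow> real \<Rightarrow> real \<Rightarrow> bool" where
  "lin_sys r Lf \<tau> V G \<zeta> X Z \<longleftrightarrow> 0 < \<tau> \<and> \<tau> \<le> 1 \<and>
     (\<forall>k. mode_sys \<tau> (lam k) (\<lambda>j. V j k) (\<lambda>j. G j k) (\<lambda>j. \<zeta> j k)) \<and> hb r (V 1) X \<and>
     (\<forall>j\<in>{1..s-1}. \<forall>Y. hb r (V j) Y \<longrightarrow> hb r (G j) (Lf * Y)) \<and>
     (\<forall>j\<in>{1..s-1}. hb (r - 2) (\<zeta> j) Z)"

section \<open>One-step estimates in weighted norms\<close>

lemma hb_smoothed:
  assumes "hb (r - 2) c Z" "2 \<le> r"
  shows "hb r (\<lambda>k. of_real (cmod (c k) / rho k ^ 2)) Z"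
proof -
  have "hb r (\<lambda>k. of_real (cmod (c k) / rho k ^ 2)) (1 * Z)"
  proof (rule hb_dominated[OF assms(1)])
    fix k
    have "rho k ^ r = rho k ^ (r - 2) * rho k ^ 2"
      using assms(2) by (metis le_add_diff_inverse2 power_add)
    then show "rho k ^ r * cmod (of_real (cmod (c k) / rho k ^ 2)) \<le> 1 * (rho k ^ (r - 2) * cmod (c k))"
      using rho_pos(1)[of k] unfolding norm_of_real by (simp add: abs_mult)
  qed simp
  then show ?thesis by simp
qed

text \<open>The mode-wise estimate does not involve the weight, so one constant \<open>C\<close>
  serves every order \<open>r\<close>. Its right-hand side, taken in moduli, is the majorant
  sequence \<open>?d\<close>.\<close>

lemma stage_hb:
  obtains C where "1 \<le> C"
    "\<And>r \<tau> V G \<zeta> Y Y' Z i. 2 \<le> r \<Longrightarrow> 0 < \<tau> \<Longrightarrow> \<tau> \<le> 1 \<Longrightarrow>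
      \<forall>k. mode_sys \<tau> (lam k) (\<lambda>j. V j k) (\<lambda>j. G j k) (\<lambda>j. \<zeta> j k) \<Longrightarrow> i \<in> {1..s-1} \<Longrightarrow>
      (\<forall>j\<in>{1..i}. hb r (V j) Y) \<Longrightarrow> (\<forall>j\<in>{1..i}. hb r (G j) Y') \<Longrightarrow> hb (r - 2) (\<zeta> i) Z \<Longrightarrow>
      hb r (V (i + 1)) (C * (real i * (Y + Y') + Z))"
proof -
  obtain C where C: "1 \<le> C"
    "\<And>\<tau> k V G Z i. 0 < \<tau> \<Longrightarrow> \<tau> \<le> 1 \<Longrightarrow> mode_sys \<tau> (lam k) V G Z \<Longrightarrow> i \<in> {1..s-1} \<Longrightarrow>
      cmod (V (i + 1)) \<le> C * ((\<Sum>j=1..i. cmod (V j) + cmod (G j)) + cmod (Z i) / rho k ^ 2)"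
    using stage_mode_bound by blast
  show ?thesis
  proof (rule that[OF C(1)])
    fix r \<tau> V G \<zeta> Y Y' Z i
    assume r: "2 \<le> (r::nat)" and \<tau>: "0 < \<tau>" "\<tau> \<le> 1"
      and sys: "\<forall>k. mode_sys \<tau> (lam k) (\<lambda>j. V j k) (\<lambda>j. G j k) (\<lambda>j. \<zeta> j k)" and i: "i \<in> {1..s-1}"
      and V: "\<forall>j\<in>{1..i}. hb r (V j) Y" and G: "\<forall>j\<in>{1..i}. hb r (G j) Y'" and Z: "hb (r - 2) (\<zeta> i) Z"
    let ?d = "\<lambda>k. of_real C * ((\<Sum>j=1..i. of_real (cmod (V j k)) + of_real (cmod (G j k)))
        + of_real (cmod (\<zeta> i k) / rho k ^ 2)) :: complex"
    have "hb r ?d (cmod (of_real C) * ((\<Sum>j=1..i. Y + Y') + Z))"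
      using V G by (intro hb_cmult hb_add hb_sum hb_cmod hb_smoothed Z r) auto
    moreover have "cmod (of_real C) * ((\<Sum>j=1..i. Y + Y') + Z) = C * (real i * (Y + Y') + Z)"
      using C(1) by simp
    moreover have "cmod (V (i + 1) k) \<le> cmod (?d k)" for k
    proof -
      have "?d k = of_real (C * ((\<Sum>j=1..i. cmod (V j k) + cmod (G j k)) + cmod (\<zeta> i k) / rho k ^ 2))"
        by simp
      then have "cmod (?d k) = C * ((\<Sum>j=1..i. cmod (V j k) + cmod (G j k)) + cmod (\<zeta> i k) / rho k ^ 2)"
        using C(1) by (simp only: norm_of_real) (simp add: sum_nonneg)
      then show ?thesis
        using C(2)[OF \<tau> sys[rule_format] i, of k] by simp
    qed
    ultimately show "hb r (V (i + 1)) (C * (real i * (Y + Y') + Z))"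
      by (metis (no_types, lifting) hb_smaller)
  qed
qed

text \<open>Each stage is bounded by the preceding ones, so the constant grows from stage to stage.
  This is harmless: the number of stages is fixed, and the estimate is not iterated in time.\<close>

lemma lin_sys_stages:
  assumes r: "2 \<le> r" and Lf: "0 \<le> Lf"
  obtains C where "1 \<le> C"
    "\<And>\<tau> V G \<zeta> X Z j. lin_sys r Lf \<tau> V G \<zeta> X Z \<Longrightarrow> j \<in> {1..s} \<Longrightarrow> hb r (V j) (C * (X + Z))"
proof -
  obtain C0 where C0: "1 \<le> C0"
    "\<And>r \<tau> V G \<zeta> Y Y' Z i. 2 \<le> r \<Longrightarrow> 0 < \<tau> \<Longrightarrow> \<tau> \<le> 1 \<Longrightarrow>
      \<forall>k. mode_sys \<tau> (lam k) (\<lambda>j. V j k) (\<lambda>j. G j k) (\<lambda>j. \<zeta> j k) \<Longrightarrow> i \<in> {1..s-1} \<Longrightarrow>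
      (\<forall>j\<in>{1..i}. hb r (V j) Y) \<Longrightarrow> (\<forall>j\<in>{1..i}. hb r (G j) Y') \<Longrightarrow> hb (r - 2) (\<zeta> i) Z \<Longrightarrow>
      hb r (V (i + 1)) (C0 * (real i * (Y + Y') + Z))"
    using stage_hb by blast
  have "\<exists>C\<ge>1. \<forall>\<tau> V G \<zeta> X Z. lin_sys r Lf \<tau> V G \<zeta> X Z \<longrightarrow> (\<forall>j\<in>{1..i}. hb r (V j) (C * (X + Z)))"
    if "1 \<le> i" "i \<le> s" for i
    using that
  proof (induction i rule: nat_induct_at_least)
    case base
    show ?case
    proof (intro exI[of _ 1] conjI allI impI ballI)
      fix \<tau> V G \<zeta> X Z j
      assume sys: "lin_sys r Lf \<tau> V G \<zeta> X Z" and "j \<in> {1..1::nat}"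
      then have "j = 1" "hb r (V 1) X" by (auto simp: lin_sys_def)
      moreover have "1 \<in> {1..s-1}" using s_ge_2 by simp
      then have "hb (r - 2) (\<zeta> 1) Z" using sys unfolding lin_sys_def by blast
      then have "0 \<le> Z" by (rule hb_nonneg)
      ultimately show "hb r (V j) (1 * (X + Z))" by (auto elim: hb_mono)
    qed simp
  next
    case (Suc i)
    then obtain C where C: "1 \<le> C"
      "\<And>\<tau> V G \<zeta> X Z. lin_sys r Lf \<tau> V G \<zeta> X Z \<Longrightarrow> \<forall>j\<in>{1..i}. hb r (V j) (C * (X + Z))"
      by auto
    define C' where "C' = C0 * (real i * ((1 + Lf) * C) + 1)"
    have C': "0 \<le> C'" using C C0(1) Lf by (simp add: C'_def)
    show ?case
    proof (intro exI[of _ "C + C'"] conjI allI impI ballI)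
      show "1 \<le> C + C'" using C C' by simp
      fix \<tau> V G \<zeta> X Z j
      assume sys: "lin_sys r Lf \<tau> V G \<zeta> X Z" and j: "j \<in> {1..Suc i}"
      have i: "i \<in> {1..s-1}" using Suc by auto
      have Z: "hb (r - 2) (\<zeta> i) Z" and X: "hb r (V 1) X" using sys i unfolding lin_sys_def by blast+
      have XZ: "0 \<le> X" "0 \<le> Z" using hb_nonneg[OF Z] hb_nonneg[OF X] by auto
      note V = C(2)[OF sys]
      have G: "\<forall>j\<in>{1..i}. hb r (G j) (Lf * (C * (X + Z)))"
      proof
        fix j assume j: "j \<in> {1..i}"
        then have "j \<in> {1..s-1}" using i by auto
        then show "hb r (G j) (Lf * (C * (X + Z)))" using sys V j unfolding lin_sys_def by blast
      qed
      show "hb r (V j) ((C + C') * (X + Z))"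
      proof (cases "j = Suc i")
        case True
        have "hb r (V (i + 1)) (C0 * (real i * (C * (X + Z) + Lf * (C * (X + Z))) + Z))"
          by (rule C0(2)[where V = V and G = G and \<zeta> = \<zeta>, OF r _ _ _ i V G Z]) (use sys in \<open>auto simp: lin_sys_def\<close>)
        moreover have "C0 * (real i * (C * (X + Z) + Lf * (C * (X + Z))) + Z) \<le> (C + C') * (X + Z)"
        proof -
          have "C0 * (real i * (C * (X + Z) + Lf * (C * (X + Z))) + Z)
              \<le> C0 * (real i * (C * (X + Z) + Lf * (C * (X + Z))) + (X + Z))"
            using C0(1) XZ by (intro mult_left_mono add_left_mono) auto
          also have "\<dots> = C' * (X + Z)" by (simp add: C'_def algebra_simps)
          also have "\<dots> \<le> (C + C') * (X + Z)"
            using C XZ by (intro mult_right_mono) auto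
          finally show ?thesis .
        qed
        ultimately show ?thesis using True by (auto elim: hb_mono)
      next
        case False
        then have "hb r (V j) (C * (X + Z))" using V j by auto
        moreover have "C * (X + Z) \<le> (C + C') * (X + Z)"
          using C' XZ by (intro mult_right_mono) auto
        ultimately show ?thesis by (rule hb_mono)
      qed
    qed
  qed
  from this[of s] s_ge_2 obtain C where "1 \<le> C"
    "\<forall>\<tau> V G \<zeta> X Z. lin_sys r Lf \<tau> V G \<zeta> X Z \<longrightarrow> (\<forall>j\<in>{1..s}. hb r (V j) (C * (X + Z)))"
    by auto
  then show ?thesis by (intro that[of C]) blast+
qed

text \<open>The first bound loses a fixed factor and is meant for intermediate stages. The second
  has a factor close to 1 and is fit for iteration; in it the stage bounds enter only through the
  nonlinear terms, which carry a factor \<open>\<tau>\<close>.\<close>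

lemma lin_sys_growth:
  assumes r: "2 \<le> r" and Lf: "0 \<le> Lf"
  obtains C where "1 \<le> C"
    "\<And>\<tau> V G \<zeta> X Z j. lin_sys r Lf \<tau> V G \<zeta> X Z \<Longrightarrow> j \<in> {1..s} \<Longrightarrow> hb r (V j) (C * (X + Z))"
    "\<And>\<tau> V G \<zeta> X Z. lin_sys r Lf \<tau> V G \<zeta> X Z \<Longrightarrow> hb r (V s) (sqrt ((1 + C * \<tau>) * X\<^sup>2 + C * \<tau> * Z\<^sup>2))"
proof -
  obtain C1 where C1: "1 \<le> C1"
    "\<And>\<tau> V G \<zeta> X Z j. lin_sys r Lf \<tau> V G \<zeta> X Z \<Longrightarrow> j \<in> {1..s} \<Longrightarrow> hb r (V j) (C1 * (X + Z))"
    using lin_sys_stages[OF r Lf] by blast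
  obtain Ce where Ce: "0 \<le> Ce"
    "\<And>\<tau> k V G Z. 0 < \<tau> \<Longrightarrow> \<tau> \<le> 1 \<Longrightarrow> mode_sys \<tau> (lam k) V G Z \<Longrightarrow>
      (cmod (V s))\<^sup>2 \<le> (1 + \<tau>) * (cmod (V 1))\<^sup>2
        + Ce * \<tau> * (\<Sum>j=1..s-1. (cmod (G j))\<^sup>2 + (cmod (Z j) / rho k ^ 2)\<^sup>2)"
    using energy_mode_bound by blast
  \<comment> \<open>The leading 1 absorbs the factor \<open>1 + \<tau>\<close> of the mode-wise
    estimate; the rest bounds nonlinear terms and defects of all stages by
    \<open>X\<^sup>2 + Z\<^sup>2\<close>.\<close>
  define C2 where "C2 = 1 + Ce * (real (s - 1) * (2 * (Lf * C1)\<^sup>2 + 1))"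
  have C2: "1 \<le> C2" using Ce by (simp add: C2_def)
  show ?thesis
  proof (rule that[of "C1 + C2"])
    show "1 \<le> C1 + C2" using C1 C2 by simp
  next
    fix \<tau> V G \<zeta> X Z j
    assume sys: "lin_sys r Lf \<tau> V G \<zeta> X Z" and j: "j \<in> {1..s}"
    have "1 \<in> {1..s-1}" using s_ge_2 by simp
    then have "hb (r - 2) (\<zeta> 1) Z" "hb r (V 1) X" using sys unfolding lin_sys_def by blast+
    then have "0 \<le> Z" "0 \<le> X" by (auto elim: hb_nonneg)
    then have "C1 * (X + Z) \<le> (C1 + C2) * (X + Z)"
      using C2 by (intro mult_right_mono) auto
    with C1(2)[OF sys j] show "hb r (V j) ((C1 + C2) * (X + Z))" by (rule hb_mono)
  next
    fix \<tau> V G \<zeta> X Z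
    assume sys: "lin_sys r Lf \<tau> V G \<zeta> X Z"
    have \<tau>: "0 < \<tau>" "\<tau> \<le> 1" and X: "hb r (V 1) X"
      and modes: "\<And>k. mode_sys \<tau> (lam k) (\<lambda>j. V j k) (\<lambda>j. G j k) (\<lambda>j. \<zeta> j k)"
      using sys unfolding lin_sys_def by blast+
    have Z: "hb (r - 2) (\<zeta> j) Z" if "j \<in> {1..s-1}" for j using sys that unfolding lin_sys_def by blast
    define Y where "Y = C1 * (X + Z)"
    have G: "hb r (G j) (Lf * Y)" if j: "j \<in> {1..s-1}" for j
    proof -
      have "j \<in> {1..s}" using j by auto
      from C1(2)[OF sys this] show ?thesis using sys j unfolding lin_sys_def Y_def by blast
    qed
    have X0: "0 \<le> X" using hb_nonneg[OF X] .
    have "1 \<in> {1..s-1}" using s_ge_2 by simp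
    then have Z0: "0 \<le> Z" using hb_nonneg[OF Z] by blast
    have Y0: "0 \<le> Lf * Y" using C1(1) X0 Z0 Lf by (simp add: Y_def)
    have YY: "(Lf * Y)\<^sup>2 \<le> 2 * (Lf * C1)\<^sup>2 * (X\<^sup>2 + Z\<^sup>2)"
    proof -
      have "(X + Z)\<^sup>2 \<le> 2 * (X\<^sup>2 + Z\<^sup>2)"
        using sum_squares_bound[of X Z] by (simp add: power2_sum)
      then have "(Lf * C1)\<^sup>2 * (X + Z)\<^sup>2 \<le> (Lf * C1)\<^sup>2 * (2 * (X\<^sup>2 + Z\<^sup>2))"
        by (intro mult_left_mono) auto
      also have "(Lf * C1)\<^sup>2 * (X + Z)\<^sup>2 = (Lf * Y)\<^sup>2"
        by (simp add: Y_def power_mult_distrib)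
      finally show ?thesis by (simp only: ac_simps)
    qed
    let ?R = "(1 + C2 * \<tau>) * X\<^sup>2 + C2 * \<tau> * Z\<^sup>2"
    have R0: "0 \<le> ?R" using C2 \<tau> by (intro add_nonneg_nonneg mult_nonneg_nonneg) auto
    have "hb r (V s) (sqrt ?R)"
      unfolding hb_iff_sum_squares[OF real_sqrt_ge_zero[OF R0]]
    proof (intro allI impI)
      fix F :: "(int \<times> int) set" assume F: "finite F"
      have sqs: "(\<Sum>k\<in>F. (rho k ^ r * cmod (c k))\<^sup>2) \<le> B\<^sup>2" if "hb r c B" for c B
        using that hb_nonneg[OF that] F by (simp add: hb_iff_sum_squares)
      have "(\<Sum>k\<in>F. (rho k ^ r * cmod (V s k))\<^sup>2) \<le>
          (\<Sum>k\<in>F. (1 + \<tau>) * (rho k ^ r * cmod (V 1 k))\<^sup>2 + Ce * \<tau> * (\<Sum>j=1..s-1.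
            (rho k ^ r * cmod (G j k))\<^sup>2 + (rho k ^ r * cmod (of_real (cmod (\<zeta> j k) / rho k ^ 2)))\<^sup>2))"
      proof (rule sum_mono)
        fix k
        define d where "d j = cmod (\<zeta> j k) / rho k ^ 2" for j
        have d: "cmod (of_real (cmod (\<zeta> j k) / rho k ^ 2)) = d j" for j
          unfolding norm_of_real by (simp add: d_def)
        have "(rho k ^ r)\<^sup>2 * (cmod (V s k))\<^sup>2 \<le> (rho k ^ r)\<^sup>2 * ((1 + \<tau>) * (cmod (V 1 k))\<^sup>2
            + Ce * \<tau> * (\<Sum>j=1..s-1. (cmod (G j k))\<^sup>2 + (d j)\<^sup>2))"
          unfolding d_def by (intro mult_left_mono Ce(2)[OF \<tau> modes]) simp
        also have "\<dots> = (1 + \<tau>) * (rho k ^ r * cmod (V 1 k))\<^sup>2 + Ce * \<tau> * (\<Sum>j=1..s-1.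
            (rho k ^ r * cmod (G j k))\<^sup>2 + (rho k ^ r * d j)\<^sup>2)"
          by (simp add: power_mult_distrib sum_distrib_left distrib_left ac_simps)
        finally show "(rho k ^ r * cmod (V s k))\<^sup>2 \<le> (1 + \<tau>) * (rho k ^ r * cmod (V 1 k))\<^sup>2 + Ce * \<tau> * (\<Sum>j=1..s-1.
            (rho k ^ r * cmod (G j k))\<^sup>2 + (rho k ^ r * cmod (of_real (cmod (\<zeta> j k) / rho k ^ 2)))\<^sup>2)"
          unfolding d by (simp only: power_mult_distrib)
      qed
      also have "\<dots> = (1 + \<tau>) * (\<Sum>k\<in>F. (rho k ^ r * cmod (V 1 k))\<^sup>2) + Ce * \<tau> * (\<Sum>j=1..s-1.
          (\<Sum>k\<in>F. (rho k ^ r * cmod (G j k))\<^sup>2) + (\<Sum>k\<in>F. (rho k ^ r * cmod (of_real (cmod (\<zeta> j k) / rho k ^ 2)))\<^sup>2))"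
        unfolding sum.distrib sum_distrib_left[symmetric]
        by (subst (1 2) sum.swap) simp
      also have "\<dots> \<le> (1 + \<tau>) * X\<^sup>2 + Ce * \<tau> * (\<Sum>j=1..s-1. (Lf * Y)\<^sup>2 + Z\<^sup>2)"
        using \<tau> Ce(1) by (intro add_mono mult_left_mono sum_mono sqs X G hb_smoothed Z r) auto
      also have "(\<Sum>j=1..s-1. (Lf * Y)\<^sup>2 + Z\<^sup>2) = real (s - 1) * ((Lf * Y)\<^sup>2 + Z\<^sup>2)"
        by simp
      also have "(1 + \<tau>) * X\<^sup>2 + Ce * \<tau> * (real (s - 1) * ((Lf * Y)\<^sup>2 + Z\<^sup>2)) \<le>
          (1 + \<tau>) * X\<^sup>2 + Ce * \<tau> * (real (s - 1) * (2 * (Lf * C1)\<^sup>2 * (X\<^sup>2 + Z\<^sup>2) + (X\<^sup>2 + Z\<^sup>2)))"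
        using \<tau> Ce(1) YY by (intro add_left_mono mult_left_mono add_mono) auto
      also have "\<dots> = (1 + \<tau>) * X\<^sup>2 + (C2 - 1) * \<tau> * (X\<^sup>2 + Z\<^sup>2)"
        by (simp add: C2_def algebra_simps)
      also have "\<dots> \<le> ?R"
        using \<tau> by (simp add: algebra_simps)
      finally show "(\<Sum>k\<in>F. (rho k ^ r * cmod (V s k))\<^sup>2) \<le> (sqrt ?R)\<^sup>2"
        using R0 by simp
    qed
    moreover have "sqrt ?R \<le> sqrt ((1 + (C1 + C2) * \<tau>) * X\<^sup>2 + (C1 + C2) * \<tau> * Z\<^sup>2)"
      using C1(1) \<tau> by (intro real_sqrt_le_mono add_mono mult_right_mono) auto
    ultimately show "hb r (V s) (sqrt ((1 + (C1 + C2) * \<tau>) * X\<^sup>2 + (C1 + C2) * \<tau> * Z\<^sup>2))"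
      by (rule hb_mono)
  qed
qed

text \<open>No bound beyond the first stage is available here: the bound of the earlier stages feeds
  the cubic term that determines the next. The result depends on \<open>K\<close> and
  \<open>Z\<close> but not on the step size, so it precedes the choice of
  \<open>\<tau>0\<close>.\<close>

lemma nonlinear_stages_bounded:
  assumes "0 \<le> K"
  obtains B where "K \<le> B"
    "\<And>\<tau> V \<zeta> j. 0 < \<tau> \<Longrightarrow> \<tau> \<le> 1 \<Longrightarrow> \<forall>j\<in>{1..s}. in_L2 L (V j) \<Longrightarrow>
      \<forall>k. mode_sys \<tau> (lam k) (\<lambda>j. fc (V j) k) (\<lambda>j. fc (\<lambda>z. f_nl \<kappa> (V j z)) k) (\<lambda>j. \<zeta> j k) \<Longrightarrow>
      hb 2 (fc (V 1)) K \<Longrightarrow> \<forall>j\<in>{1..s-1}. hb 0 (\<zeta> j) Z \<Longrightarrow> j \<in> {1..s} \<Longrightarrow> hb 2 (fc (V j)) B"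
proof -
  obtain C0 where C0: "1 \<le> C0"
    "\<And>r \<tau> V G \<zeta> Y Y' Z i. 2 \<le> r \<Longrightarrow> 0 < \<tau> \<Longrightarrow> \<tau> \<le> 1 \<Longrightarrow>
      \<forall>k. mode_sys \<tau> (lam k) (\<lambda>j. V j k) (\<lambda>j. G j k) (\<lambda>j. \<zeta> j k) \<Longrightarrow> i \<in> {1..s-1} \<Longrightarrow>
      (\<forall>j\<in>{1..i}. hb r (V j) Y) \<Longrightarrow> (\<forall>j\<in>{1..i}. hb r (G j) Y') \<Longrightarrow> hb (r - 2) (\<zeta> i) Z \<Longrightarrow>
      hb r (V (i + 1)) (C0 * (real i * (Y + Y') + Z))"
    using stage_hb by blast
  define hyp where "hyp \<tau> V \<zeta> \<longleftrightarrow> 0 < \<tau> \<and> \<tau> \<le> 1 \<and> (\<forall>j\<in>{1..s}. in_L2 L (V j)) \<and>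
      (\<forall>k. mode_sys \<tau> (lam k) (\<lambda>j. fc (V j) k) (\<lambda>j. fc (\<lambda>z. f_nl \<kappa> (V j z)) k) (\<lambda>j. \<zeta> j k)) \<and>
      hb 2 (fc (V 1)) K \<and> (\<forall>j\<in>{1..s-1}. hb 0 (\<zeta> j) Z)" for \<tau> V \<zeta>
  have "\<exists>B\<ge>K. \<forall>\<tau> V \<zeta>. hyp \<tau> V \<zeta> \<longrightarrow> (\<forall>j\<in>{1..i}. hb 2 (fc (V j)) B)" if "1 \<le> i" "i \<le> s" for i
    using that
  proof (induction i rule: nat_induct_at_least)
    case base
    show ?case by (intro exI[of _ K]) (auto simp: hyp_def)
  next
    case (Suc i)
    then obtain B where B: "K \<le> B" "\<And>\<tau> V \<zeta>. hyp \<tau> V \<zeta> \<Longrightarrow> \<forall>j\<in>{1..i}. hb 2 (fc (V j)) B"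
      by auto
    have i: "i \<in> {1..s-1}" using Suc by auto
    define B' where "B' = C0 * (real i * (B + nl_const \<kappa> 2 B * B) + Z)"
    show ?case
    proof (intro exI[of _ "max B B'"] conjI allI impI ballI)
      show "K \<le> max B B'" using B by simp
      fix \<tau> V \<zeta> j assume hyp: "hyp \<tau> V \<zeta>" and j: "j \<in> {1..Suc i}"
      note V = B(2)[OF hyp]
      show "hb 2 (fc (V j)) (max B B')"
      proof (cases "j = Suc i")
        case True
        have G: "\<forall>j\<in>{1..i}. hb 2 (fc (\<lambda>z. f_nl \<kappa> (V j z))) (nl_const \<kappa> 2 B * B)"
        proof
          fix j assume j: "j \<in> {1..i}"
          then have "in_L2 L (V j)" using hyp i unfolding hyp_def by auto
          then show "hb 2 (fc (\<lambda>z. f_nl \<kappa> (V j z))) (nl_const \<kappa> 2 B * B)"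
            using V j by (intro f_nl_bound kappa_nonneg) auto
        qed
        have "hb 2 (fc (V (i + 1))) B'"
          unfolding B'_def
          by (rule C0(2)[where V = "\<lambda>j. fc (V j)", OF _ _ _ _ i V G]) (use hyp i in \<open>auto simp: hyp_def\<close>)
        then show ?thesis using True by (auto elim: hb_mono)
      next
        case False
        then have "hb 2 (fc (V j)) B" using V j by auto
        then show ?thesis by (rule hb_mono) simp
      qed
    qed
  qed
  from this[of s] s_ge_2 obtain B where B: "K \<le> B"
    "\<forall>\<tau> V \<zeta>. hyp \<tau> V \<zeta> \<longrightarrow> (\<forall>j\<in>{1..s}. hb 2 (fc (V j)) B)"
    by auto
  show ?thesis
  proof (rule that[OF B(1)])
    fix \<tau> V \<zeta> j
    assume "0 < \<tau>" "\<tau> \<le> 1" "\<forall>j\<in>{1..s}. in_L2 L (V j)"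
      "\<forall>k. mode_sys \<tau> (lam k) (\<lambda>j. fc (V j) k) (\<lambda>j. fc (\<lambda>z. f_nl \<kappa> (V j z)) k) (\<lambda>j. \<zeta> j k)"
      "hb 2 (fc (V 1)) K" "\<forall>j\<in>{1..s-1}. hb 0 (\<zeta> j) Z" and j: "j \<in> {1..s}"
    then have "hyp \<tau> V \<zeta>" unfolding hyp_def by blast
    with B(2) j show "hb 2 (fc (V j)) B" by blast
  qed
qed

text \<open>The stage equations carry an explicit factor \<open>\<tau>\<close>, so dividing by it
  costs nothing. The four orders are lost to the two factors \<open>lam k\<close> of the implicit
  term.\<close>

lemma difference_quotient_hb:
  obtains C where "0 \<le> C"
    "\<And>q \<tau> V G Y i. 0 < \<tau> \<Longrightarrow> \<forall>k. mode_sys \<tau> (lam k) (\<lambda>j. V j k) (\<lambda>j. G j k) (\<lambda>j. 0) \<Longrightarrow>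
      \<forall>j\<in>{1..s}. hb (q + 4) (V j) Y \<Longrightarrow> \<forall>j\<in>{1..s-1}. hb (q + 4) (G j) Y \<Longrightarrow> i \<in> {1..s-1} \<Longrightarrow>
      hb q (\<lambda>k. (V (i + 1) k - V 1 k) / of_real \<tau>) (C * Y)"
proof -
  define K where "K = freq\<^sup>2 * (\<epsilon>\<^sup>2 * freq\<^sup>2 + \<kappa> + 1)"
  have K0: "0 \<le> K" using kappa_nonneg by (simp add: K_def)
  define C where "C = (\<Sum>i=1..s-1. \<Sum>j=1..i. \<bar>a (i + 1) j\<bar> * K)"
  have C0: "0 \<le> C" unfolding C_def using K0 by (intro sum_nonneg) auto
  show ?thesis
  proof (rule that[OF C0])
    fix q \<tau> V G Y i
    assume \<tau>: "0 < \<tau>" and sys: "\<forall>k. mode_sys \<tau> (lam k) (\<lambda>j. V j k) (\<lambda>j. G j k) (\<lambda>j. 0)"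
      and V: "\<forall>j\<in>{1..s}. hb (q + 4) (V j) Y" and G: "\<forall>j\<in>{1..s-1}. hb (q + 4) (G j) Y" and i: "i \<in> {1..s-1}"
    let ?t = "\<lambda>j k. of_real (- lam k) * (of_real (\<epsilon>\<^sup>2 * lam k + \<kappa>) * ((V j k + V (j + 1) k) / 2) - G j k)"
    have one: "1 \<in> {1..s}" using s_ge_2 by simp
    have Y0: "0 \<le> Y" using hb_nonneg V one by blast
    have t: "hb q (?t j) (K * Y)" if j: "j \<in> {1..i}" for j
    proof -
      have js: "j \<in> {1..s}" "j + 1 \<in> {1..s}" "j \<in> {1..s-1}" using j i by auto
      have "hb (q + 4) (\<lambda>k. of_real (1 / 2) * (V j k + V (j + 1) k)) (cmod (of_real (1 / 2)) * (Y + Y))"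
        using V js by (intro hb_cmult hb_add) auto
      then have m: "hb (q + 4) (\<lambda>k. (V j k + V (j + 1) k) / 2) Y" by simp
      have m2: "hb (q + 2 + 2) (\<lambda>k. (V j k + V (j + 1) k) / 2) Y" by (rule hb_exponent_mono[OF m]) simp
      have m0: "hb (q + 2) (\<lambda>k. (V j k + V (j + 1) k) / 2) Y" by (rule hb_exponent_mono[OF m]) simp
      have "hb (q + 4) (G j) Y" using G js by blast
      then have g: "hb (q + 2) (G j) Y" by (rule hb_exponent_mono) simp
      have "hb q (\<lambda>k. of_real (lam k) * (of_real (\<epsilon>\<^sup>2) * (of_real (lam k) * ((V j k + V (j + 1) k) / 2))
          + of_real \<kappa> * ((V j k + V (j + 1) k) / 2) - G j k))
          (freq\<^sup>2 * (cmod (of_real (\<epsilon>\<^sup>2)) * (freq\<^sup>2 * Y) + cmod (of_real \<kappa>) * Y + Y))"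
        by (intro hb_lam hb_diff hb_add hb_cmult m2 m0 g)
      moreover have "freq\<^sup>2 * (cmod (of_real (\<epsilon>\<^sup>2)) * (freq\<^sup>2 * Y) + cmod (of_real \<kappa>) * Y + Y) = K * Y"
        using kappa_nonneg unfolding norm_of_real by (simp add: K_def algebra_simps)
      ultimately have h: "hb q (\<lambda>k. of_real (lam k) * (of_real (\<epsilon>\<^sup>2) * (of_real (lam k) * ((V j k + V (j + 1) k) / 2))
          + of_real \<kappa> * ((V j k + V (j + 1) k) / 2) - G j k)) (K * Y)"
        by (simp only:)
      show ?thesis
      proof (rule hb_smaller[OF h])
        fix k
        have "?t j k = - (of_real (lam k) * (of_real (\<epsilon>\<^sup>2) * (of_real (lam k) * ((V j k + V (j + 1) k) / 2))
          + of_real \<kappa> * ((V j k + V (j + 1) k) / 2) - G j k))"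
          by (simp add: field_simps)
        then show "cmod (?t j k) \<le> cmod (of_real (lam k) * (of_real (\<epsilon>\<^sup>2) * (of_real (lam k) * ((V j k + V (j + 1) k) / 2))
          + of_real \<kappa> * ((V j k + V (j + 1) k) / 2) - G j k))"
          by (simp only: norm_minus_cancel order_refl)
      qed
    qed
    have "(\<lambda>k. (V (i + 1) k - V 1 k) / of_real \<tau>) = (\<lambda>k. \<Sum>j=1..i. of_real (a (i + 1) j) * ?t j k)"
    proof
      fix k
      have "V (i + 1) k = V 1 k + of_real \<tau> * (\<Sum>j=1..i. of_real (a (i + 1) j) * ?t j k) + of_real \<tau> * 0"
        using sys i unfolding mode_sys_def by blast
      then show "(V (i + 1) k - V 1 k) / of_real \<tau> = (\<Sum>j=1..i. of_real (a (i + 1) j) * ?t j k)"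
        using \<tau> by (simp add: field_simps)
    qed
    moreover have "hb q (\<lambda>k. \<Sum>j=1..i. of_real (a (i + 1) j) * ?t j k) (\<Sum>j=1..i. cmod (of_real (a (i + 1) j)) * (K * Y))"
      by (intro hb_sum hb_cmult t)
    moreover have "(\<Sum>j=1..i. cmod (of_real (a (i + 1) j)) * (K * Y)) \<le> C * Y"
    proof -
      have "(\<Sum>j=1..i. cmod (of_real (a (i + 1) j)) * (K * Y)) = (\<Sum>j=1..i. \<bar>a (i + 1) j\<bar> * K) * Y"
        by (simp add: sum_distrib_right mult.assoc)
      also have "\<dots> \<le> C * Y"
        unfolding C_def using i K0 Y0
        by (intro mult_right_mono member_le_sum[of i _ "\<lambda>i. \<Sum>j=1..i. \<bar>a (i + 1) j\<bar> * K"] sum_nonneg) auto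
      finally show ?thesis .
    qed
    ultimately show "hb q (\<lambda>k. (V (i + 1) k - V 1 k) / of_real \<tau>) (C * Y)"
      by (metis (no_types, lifting) hb_mono)
  qed
qed

end

section \<open>Uniform bounds\<close>

lemma H_norm_nonneg: "0 \<le> H_norm L q u"
  by (auto simp: H_norm_def intro!: sum_nonneg)

lemma (in torus) CH_regular_bounds:
  assumes reg: "CH_regular L T m p K \<Phi>0 \<Phi>" and "0 < T"
  shows "in_H L (m + 4) \<Phi>0" "H_norm L (m + 4) \<Phi>0 \<le> K"
    and "t \<in> {0<..<T} \<Longrightarrow> in_H L (m + 4) (\<Phi> t)"
    and "t \<in> {0<..<T} \<Longrightarrow> H_norm L (m + 4) (\<Phi> t) \<le> K"
proof -
  note reg' = reg[unfolded CH_regular_def]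
  show "in_H L (m + 4) \<Phi>0" by (rule conjunct1[OF reg'])
  obtain \<Phi>t where ex: "\<Phi>t 0 = \<Phi> \<and>
      (\<forall>k\<le>p. \<forall>t\<in>{0<..<T}. has_time_deriv L {0<..<T} (\<Phi>t k) (\<Phi>t (Suc k) t) t) \<and>
      (\<forall>t\<in>{0<..<T}. (\<forall>k\<le>2. in_H L (m + 4 - k) (\<Phi>t k t)) \<and>
         H_norm L (m + 4) \<Phi>0 + (\<Sum>k=0..2. H_norm L (m + 4 - k) (\<Phi>t k t))
           + (\<Sum>k=3..p+1. L2_norm L (\<Phi>t k t)) \<le> K)"
    by (rule exE[OF conjunct2[OF reg']], rule that)
  have \<Phi>t0: "\<Phi>t 0 = \<Phi>" by (rule conjunct1[OF ex])
  have *: "in_H L (m + 4) (\<Phi> t)" "H_norm L (m + 4) \<Phi>0 \<le> K" "H_norm L (m + 4) (\<Phi> t) \<le> K"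
    if t: "t \<in> {0<..<T}" for t
  proof -
    define h where "h k = H_norm L (m + 4 - k) (\<Phi>t k t)" for k
    define A where "A = (\<Sum>k=3..p+1. L2_norm L (\<Phi>t k t))"
    have bd: "(\<forall>k\<le>2. in_H L (m + 4 - k) (\<Phi>t k t)) \<and> H_norm L (m + 4) \<Phi>0 + (\<Sum>k=0..2. h k) + A \<le> K"
      using bspec[OF conjunct2[OF conjunct2[OF ex]] t] unfolding h_def A_def .
    have "in_H L (m + 4 - 0) (\<Phi>t 0 t)"
      by (rule conjunct1[OF bd, THEN spec[of _ 0], THEN mp]) simp
    then show "in_H L (m + 4) (\<Phi> t)" by (simp add: \<Phi>t0)
    have "0 \<le> A"
      unfolding A_def by (intro sum_nonneg L2_norm_nonneg)
    moreover have "h 0 \<le> (\<Sum>k=0..2. h k)"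
      by (rule member_le_sum[of 0 "{0..2}" h]) (simp_all add: h_def H_norm_nonneg)
    moreover have h0: "h 0 = H_norm L (m + 4) (\<Phi> t)" by (simp add: h_def \<Phi>t0)
    moreover have "0 \<le> h 0" "0 \<le> H_norm L (m + 4) \<Phi>0" by (simp_all add: h_def H_norm_nonneg)
    ultimately show "H_norm L (m + 4) \<Phi>0 \<le> K" "H_norm L (m + 4) (\<Phi> t) \<le> K"
      using conjunct2[OF bd] by linarith+
  qed
  \<comment> \<open>The bound for the initial value is part of the estimate at every interior time;
    the midpoint is one of them.\<close>
  have "T / 2 \<in> {0<..<T}" using \<open>0 < T\<close> by simp
  then show "H_norm L (m + 4) \<Phi>0 \<le> K" by (rule *(2))
  show "in_H L (m + 4) (\<Phi> t)" "H_norm L (m + 4) (\<Phi> t) \<le> K" if "t \<in> {0<..<T}"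
    using *[OF that] by auto
qed

lemma time_mesh_step:
  assumes "time_mesh T N t" "n < N"
  shows "t n < t (Suc n)"
proof -
  have "Suc n \<in> {1..N}" using assms(2) by simp
  with assms(1) have "t (Suc n - 1) < t (Suc n)"
    unfolding time_mesh_def by blast
  then show ?thesis by simp
qed

lemma time_mesh_mono:
  assumes mesh: "time_mesh T N t" and "i \<le> j" "j \<le> N"
  shows "t i \<le> t j"
  using assms(2,3)
proof (induction j)
  case (Suc j)
  then show ?case
    using time_mesh_step[OF mesh, of j] by (cases "i = Suc j") auto
qed simp

lemma time_mesh_strict:
  assumes mesh: "time_mesh T N t" and "i < j" "j \<le> N"
  shows "t i < t j"
  using time_mesh_step[OF mesh, of i] time_mesh_mono[OF mesh, of "Suc i" j] assms(2,3) by simp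

lemma exact_stage_1: "exact_stage a t \<Phi> n 1 = \<Phi> (t (n - 1))"
  by (simp add: exact_stage_def abscissa_def)

lemma exact_stage_s:
  assumes "RIERK_method s a" "1 \<le> n"
  shows "exact_stage a t \<Phi> n s = exact_stage a t \<Phi> (n + 1) 1"
proof -
  have "abscissa a s = 1" using assms(1) by (simp add: RIERK_method_def)
  then show ?thesis
    unfolding exact_stage_1 unfolding exact_stage_def step_def by simp
qed

text \<open>One step of the discrete Gronwall inequality. The explicit majorant
  \<open>exp (C * t) * (X + C * Q * t)\<close> is evaluated at mesh points, so variable step sizes
  require no products or sums over steps.\<close>

lemma growth_factor:
  fixes C \<tau> t Q X Z :: real
  assumes "0 \<le> C" "0 \<le> \<tau>" "0 \<le> t" "0 \<le> Q" "Z\<^sup>2 \<le> Q" "0 \<le> X"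
  shows "(1 + C * \<tau>) * (exp (C * t) * (X + C * Q * t)) + C * \<tau> * Z\<^sup>2 \<le> exp (C * (t + \<tau>)) * (X + C * Q * (t + \<tau>))"
proof -
  have 1: "1 + C * \<tau> \<le> exp (C * \<tau>)" using exp_ge_add_one_self[of "C * \<tau>"] .
  have "(1 + C * \<tau>) * (exp (C * t) * (X + C * Q * t)) \<le> exp (C * \<tau>) * (exp (C * t) * (X + C * Q * t))"
    using assms by (intro mult_right_mono 1) auto
  also have "\<dots> = exp (C * (t + \<tau>)) * (X + C * Q * t)"
    by (simp add: exp_add distrib_left)
  finally have 2: "(1 + C * \<tau>) * (exp (C * t) * (X + C * Q * t)) \<le> exp (C * (t + \<tau>)) * (X + C * Q * t)" .
  have "C * \<tau> * Z\<^sup>2 \<le> 1 * (C * \<tau> * Q)"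
    using assms by (simp add: mult_left_mono)
  also have "\<dots> \<le> exp (C * (t + \<tau>)) * (C * \<tau> * Q)"
    using assms by (intro mult_right_mono) auto
  finally show ?thesis using 2 by (simp add: algebra_simps)
qed

section \<open>Induction over the time steps\<close>

context rierk
begin

lemma mode_sys_RIERK:
  assumes U: "RIERK_solution L \<epsilon> \<kappa> s a N t \<Phi>0 U" and n: "n \<in> {1..N}"
  shows "mode_sys (step t n) (lam k) (\<lambda>j. fc (U n j) k) (\<lambda>j. fc (\<lambda>z. f_nl \<kappa> (U n j z)) k) (\<lambda>j. 0)"
proof -
  have "mode_sys (step t n) (lam k) (\<lambda>j. fc (U n j) k) (\<lambda>j. fc (\<lambda>z. f_nl \<kappa> (U n j z)) k) (\<lambda>j. fc (\<lambda>z. 0) k)"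
  proof (rule mode_sys_of_stages[where \<zeta> = "\<lambda>i z. 0"])
    show "in_H L 4 (U n j)" if "j \<in> {1..s}" for j
      using U n that by (simp add: RIERK_solution_def)
    show "eq_ae L (U n (i + 1)) (\<lambda>z. U n 1 z + step t n * stage_sum L \<epsilon> \<kappa> a (U n) i z + step t n * 0)"
      if "i \<in> {1..s-1}" for i
      using U n that by (simp add: RIERK_solution_def)
  qed (rule in_L2_const)
  moreover have "fc (\<lambda>z. 0) k = 0" by (simp add: fc_const)
  ultimately show ?thesis by (simp only:)
qed

lemma mode_sys_exact:
  assumes def: "defects_bounded L \<epsilon> \<kappa> s a N t \<Phi> K1" and n: "n \<in> {1..N}" and pos: "0 < step t n"
  shows "mode_sys (step t n) (lam k) (\<lambda>j. fc (exact_stage a t \<Phi> n j) k)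
      (\<lambda>j. fc (\<lambda>z. f_nl \<kappa> (exact_stage a t \<Phi> n j z)) k) (\<lambda>j. fc (defect L \<epsilon> \<kappa> a t \<Phi> n j) k)"
    and "i \<in> {1..s-1} \<Longrightarrow> hb 0 (fc (defect L \<epsilon> \<kappa> a t \<Phi> n i)) (\<bar>K1\<bar> / L * step t n)"
proof -
  have V: "in_H L 4 (exact_stage a t \<Phi> n j)" if "j \<in> {1..s}" for j
    using def n that by (simp add: defects_bounded_def)
  have L2: "in_L2 L (defect L \<epsilon> \<kappa> a t \<Phi> n i)" if i: "i \<in> {1..s-1}" for i
  proof -
    have "in_L2 L (exact_stage a t \<Phi> n (i + 1))" "in_L2 L (exact_stage a t \<Phi> n 1)"
      using V[of "i + 1"] V[of 1] i s_ge_2 by (auto simp: in_H_iff)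
    then have "in_L2 L (\<lambda>z. (1 / step t n) * (exact_stage a t \<Phi> n (i + 1) z - exact_stage a t \<Phi> n 1 z)
        - stage_sum L \<epsilon> \<kappa> a (exact_stage a t \<Phi> n) i z)"
      by (intro in_L2_diff in_L2_cmult stage_sum_props(1) V i) auto
    then show ?thesis by (simp add: defect_def)
  qed
  show "mode_sys (step t n) (lam k) (\<lambda>j. fc (exact_stage a t \<Phi> n j) k)
      (\<lambda>j. fc (\<lambda>z. f_nl \<kappa> (exact_stage a t \<Phi> n j z)) k) (\<lambda>j. fc (defect L \<epsilon> \<kappa> a t \<Phi> n j) k)"
  proof (rule mode_sys_of_stages[OF V L2])
    fix i
    show "eq_ae L (exact_stage a t \<Phi> n (i + 1)) (\<lambda>z. exact_stage a t \<Phi> n 1 z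
        + step t n * stage_sum L \<epsilon> \<kappa> a (exact_stage a t \<Phi> n) i z + step t n * defect L \<epsilon> \<kappa> a t \<Phi> n i z)"
      using pos by (simp add: eq_ae_def defect_def field_simps)
  qed
  assume i: "i \<in> {1..s-1}"
  have "L2_norm L (defect L \<epsilon> \<kappa> a t \<Phi> n i) \<le> K1 * step t n"
    using def n i by (simp add: defects_bounded_def)
  also have "\<dots> \<le> \<bar>K1\<bar> * step t n"
    using pos by (intro mult_right_mono) auto
  finally have "L2_norm L (defect L \<epsilon> \<kappa> a t \<Phi> n i) / L \<le> \<bar>K1\<bar> / L * step t n"
    using L_pos by (simp add: field_simps)
  with hb_0_L2_norm[OF L2[OF i]] show "hb 0 (fc (defect L \<epsilon> \<kappa> a t \<Phi> n i)) (\<bar>K1\<bar> / L * step t n)"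
    by (rule hb_mono)
qed

text \<open>Convergence of first order in the norm of order 2, used only to keep the numerical solution
  within distance 1 of the exact one; the bounds \<open>\<tau>0\<close> and \<open>B\<close> do not depend on the mesh.\<close>

lemma numerical_solution_H2_bounded:
  assumes T: "0 < T" and M0: "0 \<le> M0"
  obtains \<tau>0 B where "0 < \<tau>0" "\<tau>0 \<le> 1" "0 \<le> B"
    "\<And>N t U \<Phi>0 \<Phi> n j. time_mesh T N t \<Longrightarrow> max_step N t \<le> \<tau>0 \<Longrightarrow>
      defects_bounded L \<epsilon> \<kappa> s a N t \<Phi> K1 \<Longrightarrow> RIERK_solution L \<epsilon> \<kappa> s a N t \<Phi>0 U \<Longrightarrow>
      eq_ae L (\<Phi> 0) \<Phi>0 \<Longrightarrow> in_L2 L \<Phi>0 \<Longrightarrow> (\<And>n. n \<in> {1..N} \<Longrightarrow> hb 2 (fc (\<Phi> (t (n - 1)))) M0) \<Longrightarrow>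
      n \<in> {1..N} \<Longrightarrow> j \<in> {1..s} \<Longrightarrow> hb 2 (fc (U n j)) B"
proof -
  \<comment> \<open>The defect constant in coefficient norm: the absolute value makes it
    nonnegative, and the division by \<open>L\<close> comes from the normalisation of
    \<open>fc\<close>.\<close>
  define K where "K = \<bar>K1\<bar> / L"
  have K0: "0 \<le> K" using L_pos by (simp add: K_def)
  have "0 \<le> M0 + 1" using M0 by simp
  from nonlinear_stages_bounded[OF this, of K] obtain B where B: "M0 + 1 \<le> B"
    and stage_bd: "\<And>\<tau> V \<zeta> j. 0 < \<tau> \<Longrightarrow> \<tau> \<le> 1 \<Longrightarrow> \<forall>j\<in>{1..s}. in_L2 L (V j) \<Longrightarrow>
      \<forall>k. mode_sys \<tau> (lam k) (\<lambda>j. fc (V j) k) (\<lambda>j. fc (\<lambda>z. f_nl \<kappa> (V j z)) k) (\<lambda>j. \<zeta> j k) \<Longrightarrow>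
      hb 2 (fc (V 1)) (M0 + 1) \<Longrightarrow> \<forall>j\<in>{1..s-1}. hb 0 (\<zeta> j) K \<Longrightarrow> j \<in> {1..s} \<Longrightarrow> hb 2 (fc (V j)) B"
    by blast
  have lip0: "0 \<le> lip_const \<kappa> B" using kappa_nonneg by (simp add: lip_const_def)
  obtain C where C: "1 \<le> C"
    and "\<And>\<tau> V G \<zeta> X Z j. lin_sys 2 (lip_const \<kappa> B) \<tau> V G \<zeta> X Z \<Longrightarrow> j \<in> {1..s} \<Longrightarrow> hb 2 (V j) (C * (X + Z))"
    and growth: "\<And>\<tau> V G \<zeta> X Z. lin_sys 2 (lip_const \<kappa> B) \<tau> V G \<zeta> X Z \<Longrightarrow>
      hb 2 (V s) (sqrt ((1 + C * \<tau>) * X\<^sup>2 + C * \<tau> * Z\<^sup>2))"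
    using lin_sys_growth[OF order_refl lip0] by blast
  define R where "R = exp (C * T) * (C * K\<^sup>2 * T)"
  have R0: "0 \<le> R" using C T by (simp add: R_def)
  define \<tau>0 where "\<tau>0 = 1 / (1 + R)"
  have \<tau>0: "0 < \<tau>0" "\<tau>0 \<le> 1" using R0 by (simp_all add: \<tau>0_def)
  show ?thesis
  proof (rule that[OF \<tau>0])
    show "0 \<le> B" using B M0 by simp
    fix N t U \<Phi>0 \<Phi> n j
    assume mesh: "time_mesh T N t" and small: "max_step N t \<le> \<tau>0"
      and def: "defects_bounded L \<epsilon> \<kappa> s a N t \<Phi> K1" and U: "RIERK_solution L \<epsilon> \<kappa> s a N t \<Phi>0 U"
      and init: "eq_ae L (\<Phi> 0) \<Phi>0" and \<Phi>0: "in_L2 L \<Phi>0"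
      and M0_bd: "\<And>n. n \<in> {1..N} \<Longrightarrow> hb 2 (fc (\<Phi> (t (n - 1)))) M0"
      and n: "n \<in> {1..N}" and j: "j \<in> {1..s}"
    let ?E = "\<lambda>n j. exact_stage a t \<Phi> n j"
    define m where "m = max_step N t"
    have step: "0 < step t n" "step t n \<le> m" if "n \<in> {1..N}" for n
    proof -
      show "0 < step t n" using mesh that by (simp add: time_mesh_def step_def)
      show "step t n \<le> m" unfolding m_def max_step_def using that by (intro Max_ge) auto
    qed
    have m: "0 \<le> m" "m \<le> \<tau>0" "m \<le> 1" using step[OF n] small \<tau>0 by (auto simp: m_def)
    have t_bd: "0 \<le> t n" "t n \<le> T" if "n \<le> N" for n
      using time_mesh_mono[OF mesh, of 0 n] time_mesh_mono[OF mesh, of n N] that mesh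
      by (auto simp: time_mesh_def)
    have E_L2: "in_L2 L (?E n j)" if "n \<in> {1..N}" "j \<in> {1..s}" for n j
      by (rule in_H_imp_in_L2[of 4]) (use def that in \<open>simp add: defects_bounded_def\<close>)
    have U_L2: "in_L2 L (U n j)" if "n \<in> {1..N}" "j \<in> {1..s}" for n j
      by (rule in_H_imp_in_L2[of 4]) (use U that in \<open>simp add: RIERK_solution_def\<close>)
    have s1: "1 \<in> {1..s}" "s \<in> {1..s}" using s_ge_2 by auto
    define e where "e n j = (\<lambda>k. fc (?E n j) k - fc (U n j) k)" for n j
    \<comment> \<open>The Gronwall majorant of the squared error, in the shape of
      \<open>growth_factor\<close>. The summand 0 is the initial error, since both solutions start
      from \<open>\<Phi>0\<close>.\<close>
    define b where "b x = exp (C * x) * (0 + C * (K * m)\<^sup>2 * x)" for x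
    have b0: "0 \<le> b x" if "0 \<le> x" for x using that C by (simp add: b_def)
    have b1: "b x \<le> 1" if x: "0 \<le> x" "x \<le> T" for x
    proof -
      have "b x \<le> exp (C * T) * (C * (K * m)\<^sup>2 * T)"
        unfolding b_def using x C by (intro mult_mono) (auto intro: mult_left_mono)
      also have "\<dots> = R * m\<^sup>2" by (simp add: R_def power_mult_distrib)
      also have "\<dots> \<le> R * \<tau>0"
        using m R0 by (intro mult_left_mono) (auto simp: power2_eq_square intro: order_trans[OF mult_left_le_one_le])
      also have "\<dots> \<le> 1" using R0 by (simp add: \<tau>0_def)
      finally show ?thesis .
    qed
    have U1: "hb 2 (fc (U n 1)) (M0 + 1)" if n: "n \<in> {1..N}" and e: "hb 2 (e n 1) (sqrt (b (t (n - 1))))" for n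
    proof -
      have "0 \<le> t (n - 1)" "t (n - 1) \<le> T" using t_bd[of "n - 1"] n by auto
      then have "sqrt (b (t (n - 1))) \<le> 1" using b1 by simp
      then have "hb 2 (e n 1) 1" using e by (rule hb_mono[rotated])
      moreover have "hb 2 (fc (?E n 1)) M0" using M0_bd[OF n] by (simp only: exact_stage_1)
      ultimately have "hb 2 (\<lambda>k. fc (?E n 1) k - e n 1 k) (M0 + 1)" by (intro hb_diff)
      then show ?thesis by (simp add: e_def)
    qed
    have defect_K: "hb 0 (fc (defect L \<epsilon> \<kappa> a t \<Phi> n i)) (K * step t n)" if "n \<in> {1..N}" "i \<in> {1..s-1}" for n i
      unfolding K_def by (rule mode_sys_exact(2)[OF def that(1) step(1)[OF that(1)] that(2)])
    have U_bd: "hb 2 (fc (U n j)) B" if n: "n \<in> {1..N}" and "hb 2 (fc (U n 1)) (M0 + 1)" "j \<in> {1..s}" for n j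
    proof (rule stage_bd[of "step t n" "U n" "\<lambda>j k. 0"])
      show "\<forall>k. mode_sys (step t n) (lam k) (\<lambda>j. fc (U n j) k) (\<lambda>j. fc (\<lambda>z. f_nl \<kappa> (U n j z)) k) (\<lambda>j. 0)"
        using mode_sys_RIERK[OF U n] by blast
      show "\<forall>j\<in>{1..s-1}. hb 0 (\<lambda>k. 0) K" using hb_mono[OF hb_zero K0] by blast
    qed (use step[OF n] m U_L2[OF n] that in auto)
    \<comment> \<open>The exact stages are bounded through the stage equations they satisfy with
      defects, not through the regularity of \<open>\<Phi>\<close>: an abscissa larger than 1 may
      lead out of the time interval.\<close>
    have E_bd: "hb 2 (fc (?E n j)) B" if n: "n \<in> {1..N}" and j: "j \<in> {1..s}" for n j
    proof (rule stage_bd[of "step t n" "?E n" "\<lambda>j. fc (defect L \<epsilon> \<kappa> a t \<Phi> n j)"])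
      show "\<forall>k. mode_sys (step t n) (lam k) (\<lambda>j. fc (?E n j) k) (\<lambda>j. fc (\<lambda>z. f_nl \<kappa> (?E n j z)) k)
          (\<lambda>j. fc (defect L \<epsilon> \<kappa> a t \<Phi> n j) k)"
        using mode_sys_exact(1)[OF def n step(1)[OF n]] by blast
      have "K * step t n \<le> K" using step[OF n] m K0 by (intro mult_left_le) auto
      then show "\<forall>j\<in>{1..s-1}. hb 0 (fc (defect L \<epsilon> \<kappa> a t \<Phi> n j)) K"
        using defect_K[OF n] hb_mono by blast
      have "hb 2 (fc (\<Phi> (t (n - 1)))) (M0 + 1)" by (rule hb_mono[OF M0_bd[OF n]]) simp
      then show "hb 2 (fc (?E n 1)) (M0 + 1)" unfolding exact_stage_1 .
    qed (use step[OF n] m E_L2[OF n] j in auto)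
    have err: "hb 2 (e n 1) (sqrt (b (t (n - 1))))" if "1 \<le> n" "n \<le> N" for n
      using that
    proof (induction n rule: nat_induct_at_least)
      case base
      then have one: "1 \<in> {1..N}" by simp
      have t0: "t (1 - 1) = 0" using mesh by (simp add: time_mesh_def)
      have E1: "?E 1 1 = \<Phi> 0" unfolding exact_stage_1 t0 ..
      have "fc (?E 1 1) = fc \<Phi>0"
        using fc_cong_ae[OF E_L2[OF one s1(1)] \<Phi>0] init unfolding E1 by blast
      moreover have "fc (U 1 1) = fc \<Phi>0"
        using U_L2[OF one s1(1)] U \<Phi>0 by (intro fc_cong_ae) (auto simp: RIERK_solution_def)
      ultimately have "e 1 1 = (\<lambda>k. 0)" by (simp add: e_def fun_eq_iff)
      then show ?case using hb_zero[of 2] unfolding t0 by (simp add: b_def)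
    next
      case (Suc n)
      have n: "n \<in> {1..N}" "n \<in> {1..<N}" and n': "Suc n \<in> {1..N}" using Suc by auto
      have e1: "hb 2 (e n 1) (sqrt (b (t (n - 1))))" using Suc by auto
      \<comment> \<open>Here the circle closes: the error bound at the first stage confines all
        numerical stages of this step to \<open>B\<close>, so the Lipschitz constant is available
        for the next error bound.\<close>
      note Ub = U_bd[OF n(1) U1[OF n(1) e1]]
      have sys: "lin_sys 2 (lip_const \<kappa> B) (step t n) (e n)
          (\<lambda>j k. fc (\<lambda>z. f_nl \<kappa> (?E n j z)) k - fc (\<lambda>z. f_nl \<kappa> (U n j z)) k)
          (\<lambda>j k. fc (defect L \<epsilon> \<kappa> a t \<Phi> n j) k - 0) (sqrt (b (t (n - 1)))) (K * step t n)"
        unfolding lin_sys_def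
      proof (intro conjI allI ballI impI)
        show "0 < step t n" "step t n \<le> 1" using step[OF n(1)] m by auto
        show "hb 2 (e n 1) (sqrt (b (t (n - 1))))" by (rule e1)
        fix k
        show "mode_sys (step t n) (lam k) (\<lambda>j. e n j k)
            (\<lambda>j. fc (\<lambda>z. f_nl \<kappa> (?E n j z)) k - fc (\<lambda>z. f_nl \<kappa> (U n j z)) k)
            (\<lambda>j. fc (defect L \<epsilon> \<kappa> a t \<Phi> n j) k - 0)"
          unfolding e_def by (intro mode_sys_diff mode_sys_exact(1)[OF def n(1) step(1)[OF n(1)]] mode_sys_RIERK[OF U n(1)])
      next
        fix j Y assume j: "j \<in> {1..s-1}" and e: "hb 2 (e n j) Y"
        then have js: "j \<in> {1..s}" by auto
        show "hb 2 (\<lambda>k. fc (\<lambda>z. f_nl \<kappa> (?E n j z)) k - fc (\<lambda>z. f_nl \<kappa> (U n j z)) k) (lip_const \<kappa> B * Y)"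
          using f_nl_lipschitz[OF kappa_nonneg E_L2[OF n(1) js] E_bd[OF n(1) js] U_L2[OF n(1) js] Ub[OF js]] e
          unfolding e_def by blast
      next
        fix j assume j: "j \<in> {1..s-1}"
        show "hb (2 - 2) (\<lambda>k. fc (defect L \<epsilon> \<kappa> a t \<Phi> n j) k - 0) (K * step t n)"
          using defect_K[OF n(1) j] by simp
      qed
      have "hb 2 (e n s) (sqrt ((1 + C * step t n) * (sqrt (b (t (n - 1))))\<^sup>2 + C * step t n * (K * step t n)\<^sup>2))"
        by (rule growth[OF sys])
      moreover have "e n s = e (Suc n) 1"
      proof -
        have "fc (U (Suc n) 1) = fc (U n s)"
          using U_L2[OF n' s1(1)] U_L2[OF n(1) s1(2)] U n(2) by (intro fc_cong_ae) (auto simp: RIERK_solution_def)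
        moreover have "?E n s = ?E (Suc n) 1"
          using exact_stage_s[OF rk_method, of n] n(1) unfolding Suc_eq_plus1 by auto
        ultimately show ?thesis unfolding e_def by (simp only:)
      qed
      moreover have "sqrt ((1 + C * step t n) * (sqrt (b (t (n - 1))))\<^sup>2 + C * step t n * (K * step t n)\<^sup>2)
          \<le> sqrt (b (t (Suc n - 1)))"
      proof (rule real_sqrt_le_mono)
        have tn: "t n = t (n - 1) + step t n" by (simp add: step_def)
        have t0: "0 \<le> t (n - 1)" using t_bd[of "n - 1"] n(1) by auto
        have "(K * step t n)\<^sup>2 \<le> (K * m)\<^sup>2"
          using step[OF n(1)] K0 by (intro power_mono mult_left_mono) auto
        then have "(1 + C * step t n) * b (t (n - 1)) + C * step t n * (K * step t n)\<^sup>2 \<le> b (t n)"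
          unfolding b_def tn using C step[OF n(1)] t0 by (intro growth_factor) auto
        then show "(1 + C * step t n) * (sqrt (b (t (n - 1))))\<^sup>2 + C * step t n * (K * step t n)\<^sup>2 \<le> b (t (Suc n - 1))"
          using b0[OF t0] by simp
      qed
      ultimately show ?case by (metis hb_mono)
    qed
    show "hb 2 (fc (U n j)) B"
      using U_bd[OF n U1[OF n err] j] n by auto
  qed
qed

text \<open>Once the norm of order two is bounded by \<open>B\<close>, the cubic term grows linearly
  in the norm of order \<open>r\<close>, so this norm grows at most exponentially in time. The
  induction runs over first stages only; the factor for the other stages is applied once at the
  end.\<close>

lemma numerical_solution_bounded:
  assumes r: "2 \<le> r" and T: "0 < T" and B0: "0 \<le> B" and X0: "0 \<le> X"
  obtains C where "0 \<le> C"
    "\<And>N t U \<Phi>0 n j. time_mesh T N t \<Longrightarrow> max_step N t \<le> 1 \<Longrightarrow>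
      RIERK_solution L \<epsilon> \<kappa> s a N t \<Phi>0 U \<Longrightarrow> in_L2 L \<Phi>0 \<Longrightarrow> hb r (fc \<Phi>0) X \<Longrightarrow>
      (\<And>n j. n \<in> {1..N} \<Longrightarrow> j \<in> {1..s} \<Longrightarrow> hb 2 (fc (U n j)) B) \<Longrightarrow>
      n \<in> {1..N} \<Longrightarrow> j \<in> {1..s} \<Longrightarrow> hb r (fc (U n j)) C"
proof -
  have nl0: "0 \<le> nl_const \<kappa> r B" using kappa_nonneg by (simp add: nl_const_def)
  obtain C where C: "1 \<le> C"
    and stages: "\<And>\<tau> V G \<zeta> X Z j. lin_sys r (nl_const \<kappa> r B) \<tau> V G \<zeta> X Z \<Longrightarrow> j \<in> {1..s} \<Longrightarrow> hb r (V j) (C * (X + Z))"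
    and growth: "\<And>\<tau> V G \<zeta> X Z. lin_sys r (nl_const \<kappa> r B) \<tau> V G \<zeta> X Z \<Longrightarrow>
      hb r (V s) (sqrt ((1 + C * \<tau>) * X\<^sup>2 + C * \<tau> * Z\<^sup>2))"
    using lin_sys_growth[OF r nl0] by blast
  \<comment> \<open>The defect level is zero here, written out to match
    \<open>growth_factor\<close>.\<close>
  define b where "b x = exp (C * x) * (X\<^sup>2 + C * 0 * x)" for x
  show ?thesis
  proof (rule that[of "C * (sqrt (b T) + 0)"])
    show "0 \<le> C * (sqrt (b T) + 0)" using C by (simp add: b_def)
    fix N t U \<Phi>0 n j
    assume mesh: "time_mesh T N t" and small: "max_step N t \<le> 1"
      and U: "RIERK_solution L \<epsilon> \<kappa> s a N t \<Phi>0 U" and \<Phi>0: "in_L2 L \<Phi>0" "hb r (fc \<Phi>0) X"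
      and U2: "\<And>n j. n \<in> {1..N} \<Longrightarrow> j \<in> {1..s} \<Longrightarrow> hb 2 (fc (U n j)) B"
      and n: "n \<in> {1..N}" and j: "j \<in> {1..s}"
    have step: "0 < step t n" "step t n \<le> 1" if "n \<in> {1..N}" for n
    proof -
      show "0 < step t n" using mesh that by (simp add: time_mesh_def step_def)
      have "step t n \<le> max_step N t" unfolding max_step_def using that by (intro Max_ge) auto
      then show "step t n \<le> 1" using small by simp
    qed
    have t_bd: "0 \<le> t n" "t n \<le> T" if "n \<le> N" for n
      using time_mesh_mono[OF mesh, of 0 n] time_mesh_mono[OF mesh, of n N] that mesh
      by (auto simp: time_mesh_def)
    have U_L2: "in_L2 L (U n j)" if "n \<in> {1..N}" "j \<in> {1..s}" for n j
      by (rule in_H_imp_in_L2[of 4]) (use U that in \<open>simp add: RIERK_solution_def\<close>)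
    have s1: "1 \<in> {1..s}" "s \<in> {1..s}" using s_ge_2 by auto
    have sys: "lin_sys r (nl_const \<kappa> r B) (step t n) (\<lambda>j. fc (U n j)) (\<lambda>j. fc (\<lambda>z. f_nl \<kappa> (U n j z)))
        (\<lambda>j k. 0) Y 0" if n: "n \<in> {1..N}" and "hb r (fc (U n 1)) Y" for n Y
      unfolding lin_sys_def
    proof (intro conjI allI ballI impI)
      show "0 < step t n" "step t n \<le> 1" using step[OF n] by auto
      show "hb r (fc (U n 1)) Y" by fact
      show "mode_sys (step t n) (lam k) (\<lambda>j. fc (U n j) k) (\<lambda>j. fc (\<lambda>z. f_nl \<kappa> (U n j z)) k) (\<lambda>j. 0)" for k
        by (rule mode_sys_RIERK[OF U n])
      show "hb r (fc (\<lambda>z. f_nl \<kappa> (U n j z))) (nl_const \<kappa> r B * Y)" if "j \<in> {1..s-1}" "hb r (fc (U n j)) Y" for j Y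
      proof -
        have "j \<in> {1..s}" using that by auto
        then show ?thesis by (intro f_nl_bound kappa_nonneg U_L2 U2 n that)
      qed
    qed (rule hb_zero)
    have start: "hb r (fc (U n 1)) (sqrt (b (t (n - 1))))" if "1 \<le> n" "n \<le> N" for n
      using that
    proof (induction n rule: nat_induct_at_least)
      case base
      then have one: "1 \<in> {1..N}" by simp
      have t0: "t (1 - 1) = 0" using mesh by (simp add: time_mesh_def)
      have "fc (U 1 1) = fc \<Phi>0"
        using U_L2[OF one s1(1)] U \<Phi>0 by (intro fc_cong_ae) (auto simp: RIERK_solution_def)
      then show ?case using \<Phi>0(2) X0 unfolding t0 by (simp add: b_def)
    next
      case (Suc n)
      have n: "n \<in> {1..N}" "n \<in> {1..<N}" and n': "Suc n \<in> {1..N}" using Suc by auto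
      have t0: "0 \<le> t (n - 1)" using t_bd[of "n - 1"] n(1) by auto
      have b0: "0 \<le> b (t (n - 1))" by (simp add: b_def)
      have "hb r (fc (U n 1)) (sqrt (b (t (n - 1))))" using Suc by auto
      from growth[OF sys[OF n(1) this]]
      have "hb r (fc (U n s)) (sqrt ((1 + C * step t n) * b (t (n - 1)) + C * step t n * 0\<^sup>2))"
        using b0 by simp
      moreover have "(1 + C * step t n) * b (t (n - 1)) + C * step t n * 0\<^sup>2 \<le> b (t (n - 1) + step t n)"
        unfolding b_def using C step[OF n(1)] t0 by (intro growth_factor) auto
      moreover have "fc (U (Suc n) 1) = fc (U n s)"
        using U_L2[OF n' s1(1)] U_L2[OF n(1) s1(2)] U n(2) by (intro fc_cong_ae) (auto simp: RIERK_solution_def)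
      moreover have "t (n - 1) + step t n = t (Suc n - 1)" by (simp add: step_def)
      ultimately show ?case by (metis hb_mono real_sqrt_le_mono)
    qed
    have "t (n - 1) \<le> T" using t_bd[of "n - 1"] n by auto
    then have "b (t (n - 1)) \<le> b T"
      unfolding b_def using C by (simp add: mult_right_mono)
    with start[of n] n have "hb r (fc (U n 1)) (sqrt (b T))" by (auto elim: hb_mono)
    from stages[OF sys[OF n this] j] show "hb r (fc (U n j)) (C * (sqrt (b T) + 0))" .
  qed
qed

text \<open>Sobolev norms occur only in the hypotheses and the conclusion. In between everything is
  stated for coefficient norms, with \<open>sob_const\<close> and \<open>sob_const'\<close> as the
  two conversion factors.\<close>

lemma stage_solutions_bounded:
  assumes T: "0 < T" and sol: "CH_solution L T \<epsilon> \<Phi>0 \<Phi>" and reg: "CH_regular L T m p K\<phi> \<Phi>0 \<Phi>"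
  shows "\<exists>\<tau>0>0. \<exists>C\<phi>>0. \<forall>N t U.
    time_mesh T N t \<longrightarrow> max_step N t \<le> \<tau>0 \<longrightarrow>
    defects_bounded L \<epsilon> \<kappa> s a N t \<Phi> K1 \<longrightarrow>
    RIERK_solution L \<epsilon> \<kappa> s a N t \<Phi>0 U \<longrightarrow>
    (\<forall>n\<in>{1..N}. \<forall>i\<in>{2..s}.
       in_H L (m + 4) (U n i) \<and> in_H L m (\<lambda>z. (U n i z - U n 1 z) / step t n) \<and>
       H_norm L (m + 4) (U n i) + H_norm L m (\<lambda>z. (U n i z - U n 1 z) / step t n)
         \<le> C\<phi> / \<epsilon>\<^sup>2)"
proof -
  let ?r = "m + 4"
  note rb = CH_regular_bounds[OF reg T]
  have sc: "0 \<le> sob_const ?r"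
    using L_pos freq_pos by (simp add: sob_const_def)
  have sc': "0 \<le> sob_const' q" for q
    using L_pos freq_pos by (simp add: sob_const'_def)
  define M0 where "M0 = sob_const ?r * \<bar>K\<phi>\<bar>"
  have M0: "0 \<le> M0" using sc by (simp add: M0_def)
  have hbM: "hb ?r (fc u) M0" if "in_H L ?r u" "H_norm L ?r u \<le> K\<phi>" for u
    using hb_mono[OF hb_of_in_H[OF that(1)], of M0] that(2) sc by (simp add: M0_def mult_left_mono)
  have \<Phi>0: "in_L2 L \<Phi>0" "eq_ae L (\<Phi> 0) \<Phi>0" and \<Phi>00: "in_L2 L (\<Phi> 0)"
    using sol T by (auto simp: CH_solution_def)
  have h\<Phi>0: "hb ?r (fc \<Phi>0) M0" by (rule hbM[OF rb(1,2)])
  obtain \<tau>0 B where \<tau>0: "0 < \<tau>0" "\<tau>0 \<le> 1" and B: "0 \<le> B" and bd2: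
    "\<And>N t U \<Phi>0 \<Phi> n j. time_mesh T N t \<Longrightarrow> max_step N t \<le> \<tau>0 \<Longrightarrow>
      defects_bounded L \<epsilon> \<kappa> s a N t \<Phi> K1 \<Longrightarrow> RIERK_solution L \<epsilon> \<kappa> s a N t \<Phi>0 U \<Longrightarrow>
      eq_ae L (\<Phi> 0) \<Phi>0 \<Longrightarrow> in_L2 L \<Phi>0 \<Longrightarrow> (\<And>n. n \<in> {1..N} \<Longrightarrow> hb 2 (fc (\<Phi> (t (n - 1)))) M0) \<Longrightarrow>
      n \<in> {1..N} \<Longrightarrow> j \<in> {1..s} \<Longrightarrow> hb 2 (fc (U n j)) B"
    using numerical_solution_H2_bounded[OF T M0, of K1] by blast
  have r2: "2 \<le> ?r" by simp
  obtain C where C: "0 \<le> C" and bdr: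
    "\<And>N t U \<Phi>0 n j. time_mesh T N t \<Longrightarrow> max_step N t \<le> 1 \<Longrightarrow>
      RIERK_solution L \<epsilon> \<kappa> s a N t \<Phi>0 U \<Longrightarrow> in_L2 L \<Phi>0 \<Longrightarrow> hb ?r (fc \<Phi>0) M0 \<Longrightarrow>
      (\<And>n j. n \<in> {1..N} \<Longrightarrow> j \<in> {1..s} \<Longrightarrow> hb 2 (fc (U n j)) B) \<Longrightarrow>
      n \<in> {1..N} \<Longrightarrow> j \<in> {1..s} \<Longrightarrow> hb ?r (fc (U n j)) C"
    using numerical_solution_bounded[OF r2 T B M0] by blast
  obtain Cq where Cq: "0 \<le> Cq" and quot:
    "\<And>q \<tau> V G Y i. 0 < \<tau> \<Longrightarrow> \<forall>k. mode_sys \<tau> (lam k) (\<lambda>j. V j k) (\<lambda>j. G j k) (\<lambda>j. 0) \<Longrightarrow>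
      \<forall>j\<in>{1..s}. hb (q + 4) (V j) Y \<Longrightarrow> \<forall>j\<in>{1..s-1}. hb (q + 4) (G j) Y \<Longrightarrow> i \<in> {1..s-1} \<Longrightarrow>
      hb q (\<lambda>k. (V (i + 1) k - V 1 k) / of_real \<tau>) (Cq * Y)"
    using difference_quotient_hb by blast
  \<comment> \<open>A common bound of order \<open>m + 4\<close> for the stages and for their
    nonlinear terms, as the difference quotients require.\<close>
  define Y where "Y = C + nl_const \<kappa> ?r B * C"
  have nl: "0 \<le> nl_const \<kappa> ?r B" using kappa_nonneg by (simp add: nl_const_def)
  define D where "D = sob_const' ?r * C + sob_const' m * (Cq * Y)"
  have D: "0 \<le> D" using sc' C Cq nl by (simp add: D_def Y_def)
  \<comment> \<open>The constant may depend on \<open>\<epsilon>\<close>, so the factor in front of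
    the claimed bound is absorbed into it; adding 1 makes it positive.\<close>
  define C\<phi> where "C\<phi> = (D + 1) * \<epsilon>\<^sup>2"
  have C\<phi>: "0 < C\<phi>" "D \<le> C\<phi> / \<epsilon>\<^sup>2" using D eps_pos by (simp_all add: C\<phi>_def)
  show ?thesis
  proof (rule exI[of _ \<tau>0], intro conjI \<tau>0(1), rule exI[of _ C\<phi>], intro conjI C\<phi>(1) allI impI ballI)
    fix N t U n i
    assume mesh: "time_mesh T N t" and small: "max_step N t \<le> \<tau>0"
      and def: "defects_bounded L \<epsilon> \<kappa> s a N t \<Phi> K1" and U: "RIERK_solution L \<epsilon> \<kappa> s a N t \<Phi>0 U"
      and n: "n \<in> {1..N}" and i: "i \<in> {2..s}"
    \<comment> \<open>At time 0 the bound comes from the initial value, at later mesh points before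
      \<open>T\<close> from the regularity on the open interval.\<close>
    have start: "hb 2 (fc (\<Phi> (t (n - 1)))) M0" if n: "n \<in> {1..N}" for n
    proof (cases "n = 1")
      case True
      have "t 0 = 0" using mesh by (simp add: time_mesh_def)
      then have "fc (\<Phi> (t (n - 1))) = fc \<Phi>0"
        using True fc_cong_ae[OF \<Phi>00 \<Phi>0] by simp
      then show ?thesis using hb_exponent_mono[OF h\<Phi>0 r2] by simp
    next
      case False
      have "t 0 < t (n - 1)" "t (n - 1) < t N"
        using time_mesh_strict[OF mesh, of 0 "n - 1"] time_mesh_strict[OF mesh, of "n - 1" N] n False by auto
      then have "t (n - 1) \<in> {0<..<T}" using mesh by (simp add: time_mesh_def)
      from hb_exponent_mono[OF hbM[OF rb(3,4)[OF this]] r2] show ?thesis .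
    qed
    have U2: "hb 2 (fc (U n j)) B" if "n \<in> {1..N}" "j \<in> {1..s}" for n j
      by (rule bd2[OF mesh small def U \<Phi>0(2,1) start that])
    have "max_step N t \<le> 1" using small \<tau>0 by simp
    from bdr[OF mesh this U \<Phi>0(1) h\<Phi>0 U2 n]
    have Ur: "hb ?r (fc (U n j)) C" if "j \<in> {1..s}" for j using that by blast
    have U_L2: "in_L2 L (U n j)" if "j \<in> {1..s}" for j
      by (rule in_H_imp_in_L2[of 4]) (use U n that in \<open>simp add: RIERK_solution_def\<close>)
    have iS: "i \<in> {1..s}" "1 \<in> {1..s}" using i s_ge_2 by auto
    let ?q = "\<lambda>z. (U n i z - U n 1 z) / step t n"
    have pos: "0 < step t n" using mesh n by (simp add: time_mesh_def step_def)
    have q_eq: "?q = (\<lambda>z. (1 / step t n) * (U n i z - U n 1 z))" by (simp add: fun_eq_iff)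
    have q_L2: "in_L2 L ?q" unfolding q_eq by (intro in_L2_cmult in_L2_diff U_L2 iS)
    have "C \<le> Y" "nl_const \<kappa> ?r B * C \<le> Y" using nl C by (simp_all add: Y_def)
    have "hb m (\<lambda>k. (fc (U n (i - 1 + 1)) k - fc (U n 1) k) / of_real (step t n)) (Cq * Y)"
    proof (rule quot[OF pos])
      show "\<forall>k. mode_sys (step t n) (lam k) (\<lambda>j. fc (U n j) k) (\<lambda>j. fc (\<lambda>z. f_nl \<kappa> (U n j z)) k) (\<lambda>j. 0)"
        using mode_sys_RIERK[OF U n] by blast
      show "\<forall>j\<in>{1..s}. hb (m + 4) (fc (U n j)) Y"
        using Ur \<open>C \<le> Y\<close> hb_mono by blast
      show "\<forall>j\<in>{1..s-1}. hb (m + 4) (fc (\<lambda>z. f_nl \<kappa> (U n j z))) Y"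
      proof
        fix j assume "j \<in> {1..s-1}"
        then have j: "j \<in> {1..s}" by auto
        from f_nl_bound(2)[OF kappa_nonneg U_L2[OF j] U2[OF n j] Ur[OF j]] \<open>nl_const \<kappa> ?r B * C \<le> Y\<close>
        show "hb (m + 4) (fc (\<lambda>z. f_nl \<kappa> (U n j z))) Y" by (rule hb_mono)
      qed
      show "i - 1 \<in> {1..s-1}" using i by auto
    qed
    moreover have "i - 1 + 1 = i" using i by auto
    moreover have "fc ?q = (\<lambda>k. (fc (U n i) k - fc (U n 1) k) / of_real (step t n))"
      unfolding q_eq by (rule ext) (simp only: fc_cmult fc_diff[OF U_L2[OF iS(1)] U_L2[OF iS(2)]], simp)
    ultimately have q_hb: "hb m (fc ?q) (Cq * Y)" by (simp only:)
    show "in_H L ?r (U n i)" "in_H L m ?q"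
      by (rule in_H_of_hb(1)[OF U_L2[OF iS(1)] Ur[OF iS(1)]] in_H_of_hb(1)[OF q_L2 q_hb])+
    have "H_norm L ?r (U n i) + H_norm L m ?q \<le> D"
      unfolding D_def by (intro add_mono in_H_of_hb(2) U_L2 Ur iS q_L2 q_hb)
    with C\<phi>(2) show "H_norm L ?r (U n i) + H_norm L m ?q \<le> C\<phi> / \<epsilon>\<^sup>2" by simp
  qed
qed

end

theorem theorem4p1:
  fixes L T \<epsilon> \<kappa> K\<phi> K1 KT :: real
    and m p s :: nat
    and a :: "nat \<Rightarrow> nat \<Rightarrow> real"
    and \<Phi>0 :: field2
    and \<Phi> :: "real \<Rightarrow> field2"
  assumes "0 < L" and "0 < T" and "0 < \<epsilon>" and "\<epsilon> < 1" and "0 \<le> \<kappa>"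
    and "1 \<le> m" and "1 \<le> p" and "0 < K\<phi>"
    and "CH_solution L T \<epsilon> \<Phi>0 \<Phi>"
    and "CH_regular L T m p K\<phi> \<Phi>0 \<Phi>"
    and "RIERK_method s a"
    and "pos_def (D_R s a)"
    and "pos_def (the (mat_inverse (D_R s a)))"
  shows "\<exists>\<tau>0>0. \<exists>C\<phi>>0. \<forall>N t U.
    time_mesh T N t \<longrightarrow> max_step N t \<le> \<tau>0 \<longrightarrow> real N * max_step N t \<le> KT * T \<longrightarrow>
    defects_bounded L \<epsilon> \<kappa> s a N t \<Phi> K1 \<longrightarrow>
    RIERK_solution L \<epsilon> \<kappa> s a N t \<Phi>0 U \<longrightarrow>
    (\<forall>n\<in>{1..N}. \<forall>i\<in>{2..s}.
       in_H L (m + 4) (U n i) \<and> in_H L m (\<lambda>z. (U n i z - U n 1 z) / step t n) \<and>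
       H_norm L (m + 4) (U n i) + H_norm L m (\<lambda>z. (U n i z - U n 1 z) / step t n)
         \<le> C\<phi> / \<epsilon>\<^sup>2)"
proof -
  have "2 \<le> s" using assms(11) by (simp add: RIERK_method_def)
  then interpret rierk L \<epsilon> \<kappa> s a
    using assms by unfold_locales auto
  show ?thesis
    using stage_solutions_bounded[OF assms(2,9,10), of K1] by blast
qed

end
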